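(* The (nonlinear) operator $\mathcal{K}:\mathcal{U}\to\mathcal{U}$ has the following properties: (1) $\mathcal{K}(U)\in W^{1,p(x)}(\Omega)\cap\mathcal{U}$ for any $U\in\mathcal{U}$. (2) $\mathcal{K}$ is strictly monotone: for any $U_1,U_2\in\mathcal{U}$ with $U_1\le U_2$ a.e. on $\Omega$ and $U_1\not\equiv U_2$ we have $\mathcal{K}(U_1)\le\mathcal{K}(U_2)$ a.e. on $\Omega$ and $\mathcal{K}(U_1)\not\equiv\mathcal{K}(U_2)$. (3) If $\varepsilon\in[0,\delta_0]$ and $f(x,\varepsilon)\ge0$ for a.a. $x\in\Omega$, then $\mathcal{K}(\varepsilon)\ge\varepsilon$ a.e. on $\Omega$. Similarly, if $\delta\in[0,\delta_0]$ and $f(x,\delta)\le0$ for a.a. $x\in\Omega$, then $\mathcal{K}(\delta)\le\delta$ a.e. on $\Omega$. (Here $\varepsilon,\delta$ also denote the constant functions.) (4) $\mathcal{K}$ is continuous with respect to the norm of $L^2(\Omega)$: for any sequence $(U_n)_{n\ge1}\subset\mathcal{U}$ and $U\in\mathcal{U}$ with $U_n\to U$ in $L^2(\Omega)$ we have $\mathcal{K}(U_n)\to\mathcal{K}(U)$ in $L^2(\Omega)$.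
   Context: Setting. $\Omega\subset\mathbb{R}^N$, $N\ge 2$, is an open, bounded, connected Lipschitz domain. $p:\overline{\Omega}\to(1,\infty)$ is either log-Hölder continuous with $p^-:=\min_{\overline\Omega}p\ge\frac{2N}{N+2}$, or continuous with $p^->\frac{2N}{N+2}$; put $p^+:=\max_{\overline\Omega}p$ and $p'(x)=\frac{p(x)}{p(x)-1}$. (In both cases $W^{1,p(x)}(\Omega)\hookrightarrow L^2(\Omega)$.) $L^{p(x)}(\Omega)$ is the space of measurable $u$ with $\int_\Omega|u|^{p(x)}dx<\infty$, with the Luxemburg norm $\inf\{\lambda>0:\int_\Omega|u/\lambda|^{p(x)}dx\le1\}$, and $W^{1,p(x)}(\Omega)$ is the corresponding Sobolev space of $u\in L^{p(x)}(\Omega)$ with $|\nabla u|\in L^{p(x)}(\Omega)$, with its usual norm. $\Psi:\overline{\Omega}\times(0,\infty)\to(0,\infty)$ satisfies: $\Psi(\cdot,s)$ is measurable for each $s>0$; for a.a. $x\in\Omega$, $\Psi(x,\cdot)$ is locally absolutely continuous on $(0,\infty)$, $\lim_{s\to0^+}\Psi(x,s)s=0$, and $s\mapsto\Psi(x,s)s$ is strictly increasing on $(0,\infty)$. Put $\mathbf{a}(x,\xi)=\Psi(x,|\xi|)\xi$ for $\xi\in\mathbb{R}^N\setminus\{\mathbf 0\}$, $\mathbf{a}(x,\mathbf 0)=\mathbf 0$; $\Phi(x,s)=\Psi(x,|s|)|s|$ for $s\ne0$, $\Phi(x,0)=0$; $A(x,\xi)=\int_0^{|\xi|}\Phi(x,s)\,ds$.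 It is assumed that $\Phi(\cdot,v(\cdot))\in L^{p'(x)}(\Omega)$ for every $v\in L^{p(x)}(\Omega)$, and that for any sequence $(V_n)\subset W^{1,p(x)}(\Omega)$ with $\int_\Omega|\nabla V_n|^{p(x)}dx\to\infty$ one has $\int_\Omega A(x,\nabla V_n)\,dx\to\infty$. $0<\delta_0<\infty$ is a constant. $b:\overline\Omega\times[0,\delta_0]\to[0,\infty)$ is a Carathéodory function (measurable in $x$ for every $s$, continuous in $s$ for a.a. $x$) such that $b(\cdot,0),b(\cdot,\delta_0)\in L^2(\Omega)$ and $s\mapsto b(x,s)$ is strictly increasing on $[0,\delta_0]$ for a.a. $x\in\Omega$. The source $f:\overline\Omega\times\mathbb{R}\to\mathbb{R}$ (only its restriction to $\overline\Omega\times[0,\delta_0]$ matters) satisfies $f(x,0)\ge0$ and $f(x,\delta_0)\le0$ for a.a. $x\in\Omega$, its restriction to $\overline\Omega\times[0,\delta_0]$ is a Carathéodory function, and $\lambda_0>0$ is a constant such that $s\mapsto f(x,s)+\lambda_0b(x,s)$ is strictly increasing on $[0,\delta_0]$ for a.a. $x\in\Omega$. $\overline b:\overline\Omega\times\mathbb{R}\to\mathbb{R}$ is $\overline b(x,s)=b(x,0)+s$ for $s<0$, $\overline b(x,s)=b(x,s)$ for $s\in[0,\delta_0]$, $\overline b(x,s)=b(x,\delta_0)+s-\delta_0$ for $s>\delta_0$. $\mathcal{U}=\{U\in L^\infty(\Omega):0\le U\le\delta_0\text{ a.e. on }\Omega\}$. Definition of $\mathcal{K}$. For $U\in\mathcal{U}$,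 $\mathcal{K}(U)=V$ is the unique weak solution $V\in W^{1,p(x)}(\Omega)$, which belongs to $\mathcal{U}$ (such a solution exists and is unique for every $U\in\mathcal{U}$), of $-\operatorname{div}\mathbf{a}(x,\nabla V)+\lambda_0\overline b(x,V)=f(x,U)+\lambda_0b(x,U)$ in $\Omega$, $\mathbf{a}(x,\nabla V)\cdot\nu=0$ on $\partial\Omega$; that is, for every $\phi\in W^{1,p(x)}(\Omega)$, $$\int_\Omega\mathbf{a}(x,\nabla V)\cdot\nabla\phi\,dx+\lambda_0\int_\Omega\overline b(x,V)\phi\,dx=\int_\Omega\big(f(x,U)+\lambda_0b(x,U)\big)\phi\,dx.$$ *)

theory Defs
  imports "HOL-Analysis.Analysis"
begin

section \<open>Domains and exponents\<close>

text \<open>Near each boundary point the domain is the part above a Lipschitz graph; \<open>e\<close> is the vertical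
  direction and \<open>g\<close> a function on the hyperplane orthogonal to \<open>e\<close>.\<close>

definition lipschitz_domain :: "'a::euclidean_space set \<Rightarrow> bool" where
  "lipschitz_domain \<Omega> \<longleftrightarrow>
     open \<Omega> \<and> bounded \<Omega> \<and> connected \<Omega> \<and> \<Omega> \<noteq> {} \<and>
     (\<forall>x\<in>frontier \<Omega>. \<exists>r>0. \<exists>e g L. norm e = 1 \<and> L-lipschitz_on {y. y \<bullet> e = 0} g \<and>
        \<Omega> \<inter> ball x r = {y \<in> ball x r. g (y - (y \<bullet> e) *\<^sub>R e) < y \<bullet> e})"

definition log_Hoelder_on :: "'a::euclidean_space set \<Rightarrow> ('a \<Rightarrow> real) \<Rightarrow> bool" where
  "log_Hoelder_on S p \<longleftrightarrow>
     (\<exists>C>0. \<forall>x\<in>S. \<forall>y\<in>S. 0 < dist x y \<and> dist x y \<le> 1/2 \<longrightarrow> \<bar>p x - p y\<bar> \<le> C / (- ln (dist x y)))"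

definition admissible_exponent :: "'a::euclidean_space set \<Rightarrow> ('a \<Rightarrow> real) \<Rightarrow> bool" where
  "admissible_exponent \<Omega> p \<longleftrightarrow>
     (\<forall>x\<in>closure \<Omega>. 1 < p x) \<and>
     (let N = real DIM('a); p_minus = (INF x\<in>closure \<Omega>. p x) in
        log_Hoelder_on (closure \<Omega>) p \<and> p_minus \<ge> 2 * N / (N + 2) \<or>
        continuous_on (closure \<Omega>) p \<and> p_minus > 2 * N / (N + 2))"

section \<open>Variable exponent Lebesgue and Sobolev spaces\<close>

text \<open>Elements are functions rather than classes modulo null sets; only their values on \<open>\<Omega>\<close> matter.\<close>

definition Lvar :: "'a::euclidean_space set \<Rightarrow> ('a \<Rightarrow> real) \<Rightarrow> ('a \<Rightarrow> real) set" where
  "Lvar \<Omega> p = {u \<in> borel_measurable (lebesgue_on \<Omega>).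
     integrable (lebesgue_on \<Omega>) (\<lambda>x. \<bar>u x\<bar> powr p x)}"

definition L2_norm_on :: "'a::euclidean_space set \<Rightarrow> ('a \<Rightarrow> real) \<Rightarrow> real" where
  "L2_norm_on \<Omega> u = sqrt (\<integral>x. (u x)\<^sup>2 \<partial>lebesgue_on \<Omega>)"

primrec Ck :: "nat \<Rightarrow> ('a::euclidean_space \<Rightarrow> real) \<Rightarrow> bool" where
  "Ck 0 \<phi> \<longleftrightarrow> continuous_on UNIV \<phi>"
| "Ck (Suc k) \<phi> \<longleftrightarrow> \<phi> differentiable_on UNIV \<and>
     (\<forall>i\<in>Basis. Ck k (\<lambda>x. frechet_derivative \<phi> (at x) i))"

definition test_functions :: "'a::euclidean_space set \<Rightarrow> ('a \<Rightarrow> real) set" where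
  "test_functions \<Omega> = {\<phi>. (\<forall>k. Ck k \<phi>) \<and>
     compact (closure {x. \<phi> x \<noteq> 0}) \<and> closure {x. \<phi> x \<noteq> 0} \<subseteq> \<Omega>}"

definition locally_integrable_on ::
  "'a::euclidean_space set \<Rightarrow> ('a \<Rightarrow> 'b::euclidean_space) \<Rightarrow> bool" where
  "locally_integrable_on \<Omega> u \<longleftrightarrow> (\<forall>C. compact C \<and> C \<subseteq> \<Omega> \<longrightarrow> set_integrable lebesgue C u)"

definition has_weak_gradient ::
  "'a::euclidean_space set \<Rightarrow> ('a \<Rightarrow> real) \<Rightarrow> ('a \<Rightarrow> 'a) \<Rightarrow> bool" where
  "has_weak_gradient \<Omega> u G \<longleftrightarrow>
     locally_integrable_on \<Omega> u \<and> locally_integrable_on \<Omega> G \<and>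
     (\<forall>\<phi>\<in>test_functions \<Omega>. \<forall>i\<in>Basis.
        (\<integral>x. u x * frechet_derivative \<phi> (at x) i \<partial>lebesgue_on \<Omega>) =
        - (\<integral>x. (G x \<bullet> i) * \<phi> x \<partial>lebesgue_on \<Omega>))"

text \<open>A representative; weak gradients are unique up to null sets.\<close>

definition weak_gradient :: "'a::euclidean_space set \<Rightarrow> ('a \<Rightarrow> real) \<Rightarrow> 'a \<Rightarrow> 'a" where
  "weak_gradient \<Omega> u = (SOME G. has_weak_gradient \<Omega> u G)"

definition W1var :: "'a::euclidean_space set \<Rightarrow> ('a \<Rightarrow> real) \<Rightarrow> ('a \<Rightarrow> real) set" where
  "W1var \<Omega> p = {u \<in> Lvar \<Omega> p. has_weak_gradient \<Omega> u (weak_gradient \<Omega> u) \<and>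
     (\<lambda>x. norm (weak_gradient \<Omega> u x)) \<in> Lvar \<Omega> p}"

section \<open>The elliptic operator\<close>

definition abs_continuous_on_Icc :: "real \<Rightarrow> real \<Rightarrow> (real \<Rightarrow> real) \<Rightarrow> bool" where
  "abs_continuous_on_Icc c d g \<longleftrightarrow>
     (\<forall>\<epsilon>>0. \<exists>\<eta>>0. \<forall>D. D division_of \<Union>D \<and> \<Union>D \<subseteq> {c..d} \<and> (\<Sum>I\<in>D. Sup I - Inf I) < \<eta> \<longrightarrow>
        (\<Sum>I\<in>D. \<bar>g (Sup I) - g (Inf I)\<bar>) < \<epsilon>)"

definition a_field :: "('a::euclidean_space \<Rightarrow> real \<Rightarrow> real) \<Rightarrow> 'a \<Rightarrow> 'a \<Rightarrow> 'a" where
  "a_field \<Psi> x \<xi> = (if \<xi> = 0 then 0 else \<Psi> x (norm \<xi>) *\<^sub>R \<xi>)"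

definition Phi :: "('a::euclidean_space \<Rightarrow> real \<Rightarrow> real) \<Rightarrow> 'a \<Rightarrow> real \<Rightarrow> real" where
  "Phi \<Psi> x s = (if s = 0 then 0 else \<Psi> x \<bar>s\<bar> * \<bar>s\<bar>)"

definition A_energy :: "('a::euclidean_space \<Rightarrow> real \<Rightarrow> real) \<Rightarrow> 'a \<Rightarrow> 'a \<Rightarrow> real" where
  "A_energy \<Psi> x \<xi> = (LINT s:{0..norm \<xi>}|lborel. Phi \<Psi> x s)"

text \<open>Measurability is required on \<open>\<Omega>\<close> only: the boundary of a Lipschitz domain is a null set.\<close>

definition admissible_Psi ::
  "'a::euclidean_space set \<Rightarrow> ('a \<Rightarrow> real) \<Rightarrow> ('a \<Rightarrow> real \<Rightarrow> real) \<Rightarrow> bool" where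
  "admissible_Psi \<Omega> p \<Psi> \<longleftrightarrow>
     (\<forall>x\<in>closure \<Omega>. \<forall>s>0. 0 < \<Psi> x s) \<and>
     (\<forall>s>0. (\<lambda>x. \<Psi> x s) \<in> borel_measurable (lebesgue_on \<Omega>)) \<and>
     (AE x in lebesgue_on \<Omega>.
        (\<forall>c d. 0 < c \<and> c \<le> d \<longrightarrow> abs_continuous_on_Icc c d (\<Psi> x)) \<and>
        ((\<lambda>s. \<Psi> x s * s) \<longlongrightarrow> 0) (at_right 0) \<and>
        strict_mono_on {0<..} (\<lambda>s. \<Psi> x s * s)) \<and>
     (\<forall>v\<in>Lvar \<Omega> p. (\<lambda>x. Phi \<Psi> x (v x)) \<in> Lvar \<Omega> (\<lambda>x. p x / (p x - 1))) \<and>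
     (\<forall>V. (\<forall>n::nat. V n \<in> W1var \<Omega> p) \<and>
        filterlim (\<lambda>n. \<integral>x. norm (weak_gradient \<Omega> (V n) x) powr p x \<partial>lebesgue_on \<Omega>)
          at_top sequentially \<longrightarrow>
        filterlim (\<lambda>n. \<integral>x. A_energy \<Psi> x (weak_gradient \<Omega> (V n) x) \<partial>lebesgue_on \<Omega>)
          at_top sequentially)"

section \<open>Lower order terms\<close>

definition Caratheodory_on ::
  "'a::euclidean_space set \<Rightarrow> real set \<Rightarrow> ('a \<Rightarrow> real \<Rightarrow> real) \<Rightarrow> bool" where
  "Caratheodory_on \<Omega> S g \<longleftrightarrow>
     (\<forall>s\<in>S. (\<lambda>x. g x s) \<in> borel_measurable (lebesgue_on \<Omega>)) \<and>
     (AE x in lebesgue_on \<Omega>. continuous_on S (g x))"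

definition admissible_b ::
  "'a::euclidean_space set \<Rightarrow> real \<Rightarrow> ('a \<Rightarrow> real \<Rightarrow> real) \<Rightarrow> bool" where
  "admissible_b \<Omega> \<delta>0 b \<longleftrightarrow>
     (\<forall>x\<in>closure \<Omega>. \<forall>s\<in>{0..\<delta>0}. 0 \<le> b x s) \<and>
     Caratheodory_on \<Omega> {0..\<delta>0} b \<and>
     (\<lambda>x. b x 0) \<in> Lvar \<Omega> (\<lambda>_. 2) \<and> (\<lambda>x. b x \<delta>0) \<in> Lvar \<Omega> (\<lambda>_. 2) \<and>
     (AE x in lebesgue_on \<Omega>. strict_mono_on {0..\<delta>0} (b x))"

definition admissible_f ::
  "'a::euclidean_space set \<Rightarrow> real \<Rightarrow> real \<Rightarrow> ('a \<Rightarrow> real \<Rightarrow> real) \<Rightarrow> ('a \<Rightarrow> real \<Rightarrow> real) \<Rightarrow> bool" where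
  "admissible_f \<Omega> \<delta>0 lam0 b f \<longleftrightarrow>
     (AE x in lebesgue_on \<Omega>. 0 \<le> f x 0 \<and> f x \<delta>0 \<le> 0) \<and>
     Caratheodory_on \<Omega> {0..\<delta>0} f \<and>
     (AE x in lebesgue_on \<Omega>. strict_mono_on {0..\<delta>0} (\<lambda>s. f x s + lam0 * b x s))"

definition b_bar :: "real \<Rightarrow> ('a \<Rightarrow> real \<Rightarrow> real) \<Rightarrow> 'a \<Rightarrow> real \<Rightarrow> real" where
  "b_bar \<delta>0 b x s =
     (if s < 0 then b x 0 + s else if s \<le> \<delta>0 then b x s else b x \<delta>0 + s - \<delta>0)"

definition order_interval :: "'a::euclidean_space set \<Rightarrow> real \<Rightarrow> ('a \<Rightarrow> real) set" where
  "order_interval \<Omega> \<delta>0 = {U \<in> borel_measurable (lebesgue_on \<Omega>).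
     AE x in lebesgue_on \<Omega>. 0 \<le> U x \<and> U x \<le> \<delta>0}"

section \<open>The solution operator\<close>

text \<open>Convergence of the three integrals is made explicit, because Isabelle's integral is \<open>0\<close> for
  non-integrable functions. For admissible data it is automatic, by Hoelder's inequality and the
  embedding of the Sobolev space into \<open>L\<^sup>2\<close>. The boundary condition is the natural one: test
  functions need not vanish on the boundary.\<close>

definition weak_solution ::
  "'a::euclidean_space set \<Rightarrow> ('a \<Rightarrow> real) \<Rightarrow> ('a \<Rightarrow> real \<Rightarrow> real) \<Rightarrow> real \<Rightarrow> real \<Rightarrow>
   ('a \<Rightarrow> real \<Rightarrow> real) \<Rightarrow> ('a \<Rightarrow> real \<Rightarrow> real) \<Rightarrow> ('a \<Rightarrow> real) \<Rightarrow> ('a \<Rightarrow> real) \<Rightarrow> bool" where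
  "weak_solution \<Omega> p \<Psi> \<delta>0 lam0 b f U V \<longleftrightarrow>
     V \<in> W1var \<Omega> p \<and>
     (\<forall>\<phi>\<in>W1var \<Omega> p.
        integrable (lebesgue_on \<Omega>)
          (\<lambda>x. a_field \<Psi> x (weak_gradient \<Omega> V x) \<bullet> weak_gradient \<Omega> \<phi> x) \<and>
        integrable (lebesgue_on \<Omega>) (\<lambda>x. b_bar \<delta>0 b x (V x) * \<phi> x) \<and>
        integrable (lebesgue_on \<Omega>) (\<lambda>x. (f x (U x) + lam0 * b x (U x)) * \<phi> x) \<and>
        (\<integral>x. a_field \<Psi> x (weak_gradient \<Omega> V x) \<bullet> weak_gradient \<Omega> \<phi> x \<partial>lebesgue_on \<Omega>)
          + lam0 * (\<integral>x. b_bar \<delta>0 b x (V x) * \<phi> x \<partial>lebesgue_on \<Omega>)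
        = (\<integral>x. (f x (U x) + lam0 * b x (U x)) * \<phi> x \<partial>lebesgue_on \<Omega>))"

text \<open>\<open>K\<close> assigns to each \<open>U\<close> a representative of the weak solution, whose existence it
  presupposes. Neither uniqueness nor
  \<open>0 \<le> K U \<le> \<delta>0\<close> is part of the definition, as both follow from the equation.\<close>

definition solution_operator ::
  "'a::euclidean_space set \<Rightarrow> ('a \<Rightarrow> real) \<Rightarrow> ('a \<Rightarrow> real \<Rightarrow> real) \<Rightarrow> real \<Rightarrow> real \<Rightarrow>
   ('a \<Rightarrow> real \<Rightarrow> real) \<Rightarrow> ('a \<Rightarrow> real \<Rightarrow> real) \<Rightarrow> (('a \<Rightarrow> real) \<Rightarrow> 'a \<Rightarrow> real) \<Rightarrow> bool" where
  "solution_operator \<Omega> p \<Psi> \<delta>0 lam0 b f K \<longleftrightarrow>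
     (\<forall>U\<in>order_interval \<Omega> \<delta>0. weak_solution \<Omega> p \<Psi> \<delta>0 lam0 b f U (K U))"

end

theory Submission
  imports Defs "HOL-Computational_Algebra.Polynomial"
begin

text \<open>Everything follows from testing the difference of two weak formulations. With a nondecreasing
  \<open>C\<^sup>1\<close> function of \<open>w\<close>, positive exactly where \<open>w > 0\<close>, as test function, monotonicity of the flux
  and strict monotonicity of \<open>b_bar\<close> force \<open>w \<le> 0\<close>, for \<open>w\<close> the difference of two solutions or of a
  solution and a constant. Strictness follows by testing with \<open>1\<close>, and continuity by testing with the
  difference of the solutions and passing to almost everywhere convergent subsequences.

  The chain rule for weak gradients is obtained from difference quotients: testing with translates of
  a test function and the mean value theorem show that the difference quotients of a function converge
  in \<open>L\<^sup>1\<close>, locally, to its weak derivative.\<close>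

section \<open>Smooth functions\<close>

text \<open>The usual test function, the positive part, has a corner, and its weak gradient would
  need a further limit. A \<open>C\<^sup>1\<close> function with derivative bounded by 1 needs none,
  and composing with it stays in the same variable exponent space, because both the function and its
  gradient only shrink.

  In the chain rule the L^1 estimate comes from duality: the L^1 norm is the supremum over test
  functions bounded by 1, and for each of them the problem is one of a single real variable, the
  length of the translation. Weak gradients are merely locally integrable, so such arguments are
  first localised to compact sets; and since \<open>weak_gradient\<close> is a choice, statements
  about it pass through uniqueness almost everywhere.

  For continuity, strict monotonicity of \<open>b_bar\<close> comes without a modulus uniform in x.
  Smallness of the integrated monotone product therefore says nothing direct about the distance of
  the solutions; it is used pointwise, and the bounds 0 and \<delta>0 lead back to L^2.\<close>

lemma Ck_SucI:
  assumes "\<And>x. (\<phi> has_derivative D x) (at x)" "\<And>i. i \<in> Basis \<Longrightarrow> Ck k (\<lambda>x. D x i)"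
  shows "Ck (Suc k) \<phi>"
proof -
  have "frechet_derivative \<phi> (at x) = D x" for x
    using frechet_derivative_at[OF assms(1)[of x]] by simp
  then show ?thesis
    using assms by (auto simp: differentiable_on_def differentiable_def intro: has_derivative_at_withinI)
qed

lemma Ck_Suc_has_derivative:
  "Ck (Suc k) \<phi> \<Longrightarrow> (\<phi> has_derivative frechet_derivative \<phi> (at x)) (at x)"
  by (simp add: differentiable_on_def frechet_derivative_works)

lemma Ck_SucD: "Ck (Suc k) \<phi> \<Longrightarrow> Ck k \<phi>"
proof (induction k arbitrary: \<phi>)
  case 0
  then show ?case by (simp add: differentiable_imp_continuous_on)
next
  case (Suc k)
  show ?case
    using Suc.prems
    by (intro Ck_SucI[OF Ck_Suc_has_derivative[OF Suc.prems]] Suc.IH) (subst (asm) Ck.simps(2), blast)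
qed

lemma Ck_const [simp]: "Ck k (\<lambda>x. c)"
  by (induction k arbitrary: c) auto

lemma Ck_add: "Ck k f \<Longrightarrow> Ck k g \<Longrightarrow> Ck k (\<lambda>x. f x + g x)"
proof (induction k arbitrary: f g)
  case 0
  then show ?case by (auto intro: continuous_intros)
next
  case (Suc k)
  show ?case
    by (rule Ck_SucI[OF has_derivative_add[OF Ck_Suc_has_derivative[OF Suc.prems(1)]
            Ck_Suc_has_derivative[OF Suc.prems(2)]]])
       (use Suc in auto)
qed

lemma Ck_mult: "Ck k f \<Longrightarrow> Ck k g \<Longrightarrow> Ck k (\<lambda>x. f x * g x)"
proof (induction k arbitrary: f g)
  case 0
  then show ?case by (auto intro: continuous_intros)
next
  case (Suc k)
  have "Ck k f" "Ck k g" using Suc.prems Ck_SucD by blast+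
  then show ?case
    using Suc
    by (intro Ck_SucI[OF has_derivative_mult[OF Ck_Suc_has_derivative[OF Suc.prems(1)]
            Ck_Suc_has_derivative[OF Suc.prems(2)]]] Ck_add Suc.IH) auto
qed

lemma Ck_sum: "(\<And>i. i \<in> I \<Longrightarrow> Ck k (f i)) \<Longrightarrow> Ck k (\<lambda>x. \<Sum>i\<in>I. f i x)"
  by (induction I rule: infinite_finite_induct) (auto intro: Ck_add)

lemma Ck_bounded_linear: "bounded_linear f \<Longrightarrow> Ck k f"
proof (cases k)
  case 0
  then show "bounded_linear f \<Longrightarrow> ?thesis" by (simp add: linear_continuous_on)
next
  case (Suc j)
  assume "bounded_linear f"
  then show ?thesis unfolding Suc
    by (intro Ck_SucI[of f "\<lambda>_. f"] bounded_linear_imp_has_derivative) auto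
qed

lemma Ck_real_polynomial_function: "real_polynomial_function f \<Longrightarrow> Ck k f"
  by (induction rule: real_polynomial_function.induct)
     (auto intro: Ck_bounded_linear Ck_add Ck_mult)

text \<open>\<open>g\<close> lists the successive derivatives of \<open>g 0\<close>. The chain rule
  lowers \<open>k\<close> by one at the price of passing from \<open>g n\<close> to
  \<open>g (Suc n)\<close>, so the induction must leave \<open>n\<close> free.\<close>

lemma Ck_compose:
  fixes g :: "nat \<Rightarrow> real \<Rightarrow> real"
  assumes g: "\<And>n s. (g n has_field_derivative g (Suc n) s) (at s)" and "Ck k h"
  shows "Ck k (\<lambda>x. g n (h x))"
  using \<open>Ck k h\<close>
proof (induction k arbitrary: n)
  case 0
  have "continuous_on UNIV (g n)"
    using DERIV_isCont[OF g] by (simp add: continuous_at_imp_continuous_on)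
  with 0 show ?case
    by (auto intro: continuous_on_compose2[of UNIV "g n"])
next
  case (Suc k)
  have "Ck k h" using Suc.prems Ck_SucD by blast
  have D: "((\<lambda>x. g n (h x)) has_derivative (\<lambda>v. g (Suc n) (h x) * frechet_derivative h (at x) v)) (at x)" for x
    using has_derivative_compose[OF Ck_Suc_has_derivative[OF Suc.prems],
        of "g n" "(*) (g (Suc n) (h x))" x] g[of n "h x"]
    by (simp add: has_field_derivative_def)
  show ?case
    by (rule Ck_SucI[OF D]) (use Suc \<open>Ck k h\<close> in \<open>auto intro!: Ck_mult\<close>)
qed

lemma has_derivative_translate:
  assumes "Ck (Suc k) \<phi>"
  shows "((\<lambda>x. \<phi> (x - c)) has_derivative frechet_derivative \<phi> (at (x - c))) (at x)"
proof -
  have "((\<lambda>x. x - c) has_derivative (\<lambda>h. h)) (at x)"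
    by (auto intro!: derivative_eq_intros)
  from has_derivative_compose[OF this Ck_Suc_has_derivative[OF assms]]
  show ?thesis by simp
qed

lemma frechet_derivative_translate:
  assumes "Ck (Suc k) \<phi>"
  shows "frechet_derivative (\<lambda>x. \<phi> (x - c)) (at x) = frechet_derivative \<phi> (at (x - c))"
  using frechet_derivative_at[OF has_derivative_translate[OF assms]] by simp

lemma Ck_translate: "Ck k \<phi> \<Longrightarrow> Ck k (\<lambda>x. \<phi> (x - c))"
proof (induction k arbitrary: \<phi>)
  case 0
  then show ?case by (auto intro!: continuous_intros intro: continuous_on_compose2[of UNIV \<phi>])
next
  case (Suc k)
  show ?case
    by (rule Ck_SucI[OF has_derivative_translate[OF Suc.prems]]) (use Suc in auto)
qed

text \<open>This class of functions is closed under differentiation: \<open>P\<close> is replaced by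
  \<open>X\<^sup>2 (P - P')\<close>.\<close>

definition exp_rat :: "real poly \<Rightarrow> real \<Rightarrow> real" where
  "exp_rat P x = (if 0 < x then poly P (1 / x) * exp (- (1 / x)) else 0)"

lemma poly_div_exp_tendsto_0: "((\<lambda>y::real. poly P y / exp y) \<longlongrightarrow> 0) at_top"
proof -
  have "((\<lambda>y::real. \<Sum>i\<le>degree P. coeff P i * (y ^ i / exp y)) \<longlongrightarrow> (\<Sum>i\<le>degree P. coeff P i * 0)) at_top"
    by (intro tendsto_intros tendsto_power_div_exp_0)
  then show ?thesis by (simp add: poly_altdef sum_divide_distrib)
qed

lemma exp_rat_tendsto_0: "(exp_rat P \<longlongrightarrow> 0) (at 0)"
proof -
  have "((\<lambda>x. poly P (inverse x) / exp (inverse x)) \<longlongrightarrow> 0) (at_right (0::real))"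
    using filterlim_compose[OF poly_div_exp_tendsto_0 filterlim_inverse_at_top_right] by blast
  then have "(exp_rat P \<longlongrightarrow> 0) (at_right 0)"
    by (rule Lim_transform_eventually)
       (auto simp: eventually_at_right_field exp_rat_def exp_minus divide_inverse intro!: exI[of _ 1])
  moreover have "(exp_rat P \<longlongrightarrow> 0) (at_left 0)"
    by (rule Lim_transform_eventually[of "\<lambda>_. 0"])
       (auto simp: eventually_at_left_field exp_rat_def intro!: exI[of _ "-1"])
  ultimately show ?thesis by (simp add: filterlim_at_split)
qed

lemma exp_rat_has_derivative:
  "(exp_rat P has_field_derivative exp_rat ([:0, 0, 1:] * (P - pderiv P)) x) (at x)"
proof -
  consider "x < 0" | "x = 0" | "0 < x" by linarith
  then show ?thesis
  proof cases
    case 1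
    have "((\<lambda>_. 0) has_field_derivative 0) (at x)" by simp
    then have "(exp_rat P has_field_derivative 0) (at x)"
      by (rule has_field_derivative_transform_within_open[of _ _ _ "{..<0}"])
         (use 1 in \<open>auto simp: exp_rat_def\<close>)
    with 1 show ?thesis by (simp add: exp_rat_def)
  next
    case 2
    \<comment> \<open>The difference quotient at 0 belongs to the same class: dividing by
      \<open>h\<close> multiplies \<open>P\<close> by X.\<close>
    have "((\<lambda>h. exp_rat ([:0, 1:] * P) h) \<longlongrightarrow> 0) (at 0)" by (rule exp_rat_tendsto_0)
    moreover have "exp_rat ([:0, 1:] * P) h = (exp_rat P (0 + h) - exp_rat P 0) / h" for h
      by (simp add: exp_rat_def)
    ultimately show ?thesis
      using 2 by (simp add: DERIV_def exp_rat_def)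
  next
    case 3
    have "((\<lambda>x. poly P (1 / x) * exp (- (1 / x))) has_field_derivative
        poly (pderiv P) (1 / x) * (- 1 / x\<^sup>2) * exp (- (1 / x))
          + exp (- (1 / x)) * (1 / x\<^sup>2) * poly P (1 / x)) (at x)"
      using 3 by (auto intro!: derivative_eq_intros DERIV_chain2[OF poly_DERIV] simp: power2_eq_square)
    moreover have "poly (pderiv P) (1 / x) * (- 1 / x\<^sup>2) * exp (- (1 / x))
          + exp (- (1 / x)) * (1 / x\<^sup>2) * poly P (1 / x) = exp_rat ([:0, 0, 1:] * (P - pderiv P)) x"
      using 3 by (simp add: exp_rat_def power2_eq_square algebra_simps)
    ultimately have "((\<lambda>x. poly P (1 / x) * exp (- (1 / x))) has_field_derivative
         exp_rat ([:0, 0, 1:] * (P - pderiv P)) x) (at x)" by metis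
    then show ?thesis
      by (rule has_field_derivative_transform_within_open[of _ _ _ "{0<..}"])
         (use 3 in \<open>auto simp: exp_rat_def\<close>)
  qed
qed

text \<open>The classical smooth function that is flat at 0, \<open>exp_rat\<close> of the
  polynomial 1. It serves as the profile of bumps and, as \<open>flat_exp (n * \<sigma> x)\<close>,
  as a smooth cut-off tending to the indicator of the set where \<sigma> is positive.\<close>

definition flat_exp :: "real \<Rightarrow> real" where
  "flat_exp x = (if 0 < x then exp (- (1 / x)) else 0)"

lemma Ck_flat_exp: assumes "Ck k h" shows "Ck k (\<lambda>x. flat_exp (h x))"
proof -
  \<comment> \<open>Iterating the differentiation rule of \<open>exp_rat\<close> from the polynomial
    1 enumerates all derivatives of \<open>flat_exp\<close>.\<close>
  define g where "g = (\<lambda>n. exp_rat (((\<lambda>P. [:0, 0, 1:] * (P - pderiv P)) ^^ n) 1))"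
  have "(g n has_field_derivative g (Suc n) s) (at s)" for n s
    unfolding g_def funpow.simps o_def by (rule exp_rat_has_derivative)
  from Ck_compose[of g, OF this assms, of 0] have "Ck k (\<lambda>x. g 0 (h x))" .
  moreover have "g 0 = flat_exp" by (auto simp: g_def exp_rat_def flat_exp_def)
  ultimately show ?thesis by simp
qed

lemma flat_exp_bounds: "0 \<le> flat_exp x" "flat_exp x \<le> 1" "\<bar>flat_exp x\<bar> \<le> 1"
  by (auto simp: flat_exp_def)

lemma flat_exp_tendsto_1:
  assumes "0 < s"
  shows "(\<lambda>n. flat_exp (real n * s)) \<longlonglongrightarrow> 1"
proof -
  have "(\<lambda>n. exp (- (inverse (real n) * (1 / s)))) \<longlonglongrightarrow> exp (- (0 * (1 / s)))"
    by (intro tendsto_intros lim_inverse_n)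
  then have "(\<lambda>n. exp (- (inverse (real n) * (1 / s)))) \<longlonglongrightarrow> 1" by simp
  then show ?thesis
    by (rule Lim_transform_eventually)
       (use assms in \<open>auto simp: flat_exp_def field_simps intro!: eventually_sequentiallyI[of 1]\<close>)
qed

section \<open>Test functions\<close>

lemma test_functionsD:
  fixes \<phi> :: "'a::euclidean_space \<Rightarrow> real"
  assumes "\<phi> \<in> test_functions \<Omega>"
  shows "Ck k \<phi>" "compact (closure {x. \<phi> x \<noteq> 0})" "closure {x. \<phi> x \<noteq> 0} \<subseteq> \<Omega>"
    "continuous_on UNIV \<phi>"
  using assms Ck.simps(1) unfolding test_functions_def by blast+

lemma test_functionsI:
  assumes "\<And>k. Ck k \<phi>" "compact K" "K \<subseteq> \<Omega>" "\<And>x. x \<notin> K \<Longrightarrow> \<phi> x = 0"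
  shows "\<phi> \<in> test_functions \<Omega>"
proof -
  have "closure {x. \<phi> x \<noteq> 0} \<subseteq> K"
    using assms(2,4) by (intro closure_minimal compact_imp_closed) auto
  moreover have "compact (closure {x. \<phi> x \<noteq> 0})"
    unfolding compact_closure using compact_imp_bounded[OF assms(2)] by (rule bounded_subset) (use assms(4) in auto)
  ultimately show ?thesis using assms(1,3) unfolding test_functions_def by blast
qed

text \<open>By compactness finitely many balls, whose closed versions lie in \<open>S\<close>, cover
  \<open>K\<close>. Each carries a bump positive exactly on the open ball, and their sum is the
  required function.\<close>

lemma exists_bump:
  fixes K :: "'a::euclidean_space set"
  assumes "compact K" "open S" "K \<subseteq> S"
  obtains \<sigma> where "\<sigma> \<in> test_functions S" "\<And>x. 0 \<le> \<sigma> x" "\<And>x. x \<in> K \<Longrightarrow> 0 < \<sigma> x"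
proof -
  \<comment> \<open>The squared distance is spelled out in coordinates, so that the exponent is a
    polynomial and smoothness of polynomials applies.\<close>
  define B where "B = (\<lambda>c r (x::'a). flat_exp (r\<^sup>2 - (\<Sum>i\<in>Basis. (x \<bullet> i - c \<bullet> i)\<^sup>2)))"
  have dist: "(\<Sum>i\<in>Basis. (x \<bullet> i - c \<bullet> i)\<^sup>2) = (dist c x)\<^sup>2" for x c :: 'a
  proof -
    have "(dist c x)\<^sup>2 = (x - c) \<bullet> (x - c)"
      by (metis dist_commute dist_norm power2_norm_eq_inner)
    also have "\<dots> = (\<Sum>i\<in>Basis. ((x - c) \<bullet> i) * ((x - c) \<bullet> i))"
      by (rule euclidean_inner)
    finally show ?thesis by (simp add: inner_diff_left power2_eq_square)
  qed
  have B_pos: "0 < B c r x \<longleftrightarrow> dist c x < r" and B_0: "dist c x \<ge> r \<Longrightarrow> B c r x = 0" if "r > 0" for c x r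
    using that power_mono_iff[of r "dist c x" 2] by (auto simp: B_def dist flat_exp_def simp flip: not_le)
  have B_nonneg: "0 \<le> B c r x" for c r x by (simp add: B_def flat_exp_bounds)
  have B_Ck: "Ck k (B c r)" for c r k
    unfolding B_def
    by (intro Ck_flat_exp Ck_real_polynomial_function)
       (auto intro!: real_polynomial_function_diff real_polynomial_function_sum
         real_polynomial_function_power intro: bounded_linear_inner_left)
  have "\<exists>r>0. cball x r \<subseteq> S" if "x \<in> K" for x
    using assms that open_contains_cball by blast
  then obtain r where r: "\<And>x. x \<in> K \<Longrightarrow> r x > 0" "\<And>x. x \<in> K \<Longrightarrow> cball x (r x) \<subseteq> S"
    by metis
  obtain D where D: "D \<subseteq> K" "finite D" "K \<subseteq> (\<Union>x\<in>D. ball x (r x))"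
    using compactE_image[OF \<open>compact K\<close>, of K "\<lambda>x. ball x (r x)"] r by force
  define \<sigma> where "\<sigma> = (\<lambda>x. \<Sum>c\<in>D. B c (r c) x)"
  show ?thesis
  proof (rule that)
    show "\<sigma> \<in> test_functions S"
    proof (rule test_functionsI)
      show "Ck k \<sigma>" for k unfolding \<sigma>_def by (intro Ck_sum B_Ck)
      show "compact (\<Union>c\<in>D. cball c (r c))" using D by (intro compact_UN) auto
      show "(\<Union>c\<in>D. cball c (r c)) \<subseteq> S" using D r by blast
      show "\<sigma> x = 0" if "x \<notin> (\<Union>c\<in>D. cball c (r c))" for x
        unfolding \<sigma>_def
      proof (rule sum.neutral, rule)
        fix c assume "c \<in> D"
        with that D have "dist c x \<ge> r c" "c \<in> K" by force+
        then show "B c (r c) x = 0" using r by (intro B_0) auto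
      qed
    qed
    show "0 \<le> \<sigma> x" for x by (auto simp: \<sigma>_def intro: sum_nonneg B_nonneg)
    show "0 < \<sigma> x" if x: "x \<in> K" for x
    proof -
      obtain c where "c \<in> D" "dist c x < r c" using D x by force
      then show ?thesis unfolding \<sigma>_def
        using D r B_pos by (intro sum_pos2[of _ c] B_nonneg) auto
    qed
  qed
qed

lemma test_functions_mono: "S \<subseteq> T \<Longrightarrow> test_functions S \<subseteq> test_functions T"
  by (auto simp: test_functions_def)

text \<open>A measurable function is an almost everywhere limit of continuous ones. These are
  truncated to [-1,1], replaced by polynomials on the compact support \<open>T\<close> of a bump
  \<sigma>, and multiplied by a smooth cut-off built from \<sigma>. Where \<sigma> vanishes, so does
  \<open>g\<close>. The bound 1 is kept exactly, because the duality argument for L^1 norms needs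
  it.\<close>

lemma test_function_approximation:
  fixes g :: "'a::euclidean_space \<Rightarrow> real"
  assumes "compact K" "open S" "K \<subseteq> S"
    and g: "g \<in> borel_measurable lebesgue" "\<And>x. \<bar>g x\<bar> \<le> 1" "\<And>x. x \<notin> K \<Longrightarrow> g x = 0"
  obtains \<psi> where "\<And>n. \<psi> n \<in> test_functions S" "\<And>n x. \<bar>\<psi> n x\<bar> \<le> 1"
    "AE x in lebesgue. (\<lambda>n. \<psi> n x) \<longlonglongrightarrow> g x"
proof -
  obtain \<sigma> where \<sigma>: "\<sigma> \<in> test_functions S" "\<And>x. 0 \<le> \<sigma> x" "\<And>x. x \<in> K \<Longrightarrow> 0 < \<sigma> x"
    using exists_bump[OF assms(1-3)] by blast
  define T where "T = closure {x. \<sigma> x \<noteq> 0}"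
  have T: "compact T" "T \<subseteq> S"
    using test_functionsD(2,3)[OF \<sigma>(1)] by (auto simp: T_def)
  have \<sigma>T: "\<And>x. x \<notin> T \<Longrightarrow> \<sigma> x = 0"
    using closure_subset[of "{x. \<sigma> x \<noteq> 0}"] by (auto simp: T_def)
  have "g measurable_on UNIV"
    using g(1) by (rule lebesgue_measurable_imp_measurable_on) auto
  then obtain N h where N: "negligible N" and h: "\<And>n. continuous_on UNIV (h n)"
    and lim: "\<And>x. x \<notin> N \<Longrightarrow> (\<lambda>n. h n x) \<longlonglongrightarrow> g x"
    unfolding measurable_on_def by auto
  define c where "c n x = max (-1) (min 1 (h n x))" for n :: nat and x
  have c: "continuous_on T (c n)" "\<bar>c n x\<bar> \<le> 1" for n x
    unfolding c_def[abs_def] using continuous_on_subset[OF h, of T n] by (auto intro!: continuous_intros)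
  have "\<exists>q. real_polynomial_function q \<and> (\<forall>x\<in>T. \<bar>c n x - q x\<bar> < 1 / (real n + 1))" for n
  proof -
    have "0 < 1 / (real n + 1)" by simp
    from Stone_Weierstrass_real_polynomial_function[OF T(1) c(1) this] show ?thesis by metis
  qed
  then obtain q where q: "\<And>n. real_polynomial_function (q n)"
    "\<And>n x. x \<in> T \<Longrightarrow> \<bar>c n x - q n x\<bar> < 1 / (real n + 1)"
    by metis
  \<comment> \<open>A polynomial within 1/(n+1) of values in [-1,1] is bounded by (n+2)/(n+1). The
    last factor restores the bound 1 and tends to 1.\<close>
  define \<psi> where "\<psi> n x = flat_exp (real n * \<sigma> x) * (q n x * ((real n + 1) / (real n + 2)))" for n x
  show ?thesis
  proof (rule that)
    show "\<psi> n \<in> test_functions S" for n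
    proof (rule test_functionsI[OF _ T])
      show "Ck k (\<psi> n)" for k
        unfolding \<psi>_def
        by (intro Ck_mult Ck_flat_exp Ck_const test_functionsD(1)[OF \<sigma>(1)]
            Ck_real_polynomial_function q)
      show "\<psi> n x = 0" if "x \<notin> T" for x
        using \<sigma>T[OF that] by (simp add: \<psi>_def flat_exp_def)
    qed
    show "\<bar>\<psi> n x\<bar> \<le> 1" for n x
    proof (cases "x \<in> T")
      case True
      have "\<bar>q n x\<bar> \<le> 1 + 1 / (real n + 1)" using q(2)[OF True, of n] c(2)[of n x] by linarith
      also have "\<dots> = (real n + 2) / (real n + 1)" by (simp add: field_simps)
      finally have "\<bar>q n x\<bar> * ((real n + 1) / (real n + 2)) \<le> 1" by (simp add: field_simps)
      then have "\<bar>flat_exp (real n * \<sigma> x)\<bar> * \<bar>q n x * ((real n + 1) / (real n + 2))\<bar> \<le> 1 * 1"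
        by (intro mult_mono flat_exp_bounds) (auto simp: abs_mult)
      then show ?thesis by (simp add: \<psi>_def abs_mult)
    qed (use \<sigma>T in \<open>simp add: \<psi>_def flat_exp_def\<close>)
    have lim_\<psi>: "(\<lambda>n. \<psi> n x) \<longlonglongrightarrow> g x" if "x \<notin> N" for x
    proof (cases "\<sigma> x = 0")
      case True
      then have "x \<notin> K" using \<sigma>(3) by force
      with True g(3) show ?thesis by (simp add: \<psi>_def flat_exp_def)
    next
      case False
      then have x: "0 < \<sigma> x" "x \<in> T" using \<sigma>(2)[of x] \<sigma>T by (auto simp: less_le)
      have "(\<lambda>n. c n x) \<longlonglongrightarrow> max (-1) (min 1 (g x))"
        unfolding c_def by (intro tendsto_intros lim that)
      also have "max (-1) (min 1 (g x)) = g x" using g(2)[of x] by (auto simp: abs_le_iff)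
      finally have "(\<lambda>n. c n x) \<longlonglongrightarrow> g x" .
      moreover have "(\<lambda>n. c n x - q n x) \<longlonglongrightarrow> 0"
      proof (rule tendsto_rabs_zero_cancel,
          rule tendsto_sandwich[of "\<lambda>_. 0" _ _ "\<lambda>n. inverse (real (Suc n))"])
        show "\<forall>\<^sub>F n in sequentially. \<bar>c n x - q n x\<bar> \<le> inverse (real (Suc n))"
        proof (rule always_eventually, rule allI)
          fix n
          have "1 / (real n + 1) = inverse (real (Suc n))" by (simp add: inverse_eq_divide)
          with q(2)[OF x(2), of n] show "\<bar>c n x - q n x\<bar> \<le> inverse (real (Suc n))" by linarith
        qed
        show "(\<lambda>n. inverse (real (Suc n))) \<longlonglongrightarrow> 0" by (rule LIMSEQ_inverse_real_of_nat)
      qed auto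
      ultimately have "(\<lambda>n. c n x - (c n x - q n x)) \<longlonglongrightarrow> g x - 0"
        by (rule tendsto_diff)
      then have "(\<lambda>n. q n x) \<longlonglongrightarrow> g x" by (simp only: diff_diff_eq2 add_diff_cancel_left' diff_zero)
      moreover have "(\<lambda>n. (real n + 1) / (real n + 2)) \<longlonglongrightarrow> 1"
      proof -
        have "(\<lambda>n. 1 - inverse (real (Suc (Suc n)))) \<longlonglongrightarrow> 1 - 0"
          by (rule tendsto_diff[OF tendsto_const LIMSEQ_Suc[OF LIMSEQ_inverse_real_of_nat]])
        moreover have "1 - inverse (real (Suc (Suc n))) = (real n + 1) / (real n + 2)" for n
          by (simp add: field_simps)
        ultimately show ?thesis by (simp only: diff_zero)
      qed
      ultimately have "(\<lambda>n. \<psi> n x) \<longlonglongrightarrow> 1 * (g x * 1)"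
        unfolding \<psi>_def by (intro tendsto_mult flat_exp_tendsto_1 x)
      then show ?thesis by simp
    qed
    have "AE x in lebesgue. x \<notin> N"
      using N by (simp add: negligible_iff_null_sets AE_not_in)
    then show "AE x in lebesgue. (\<lambda>n. \<psi> n x) \<longlonglongrightarrow> g x"
      by eventually_elim (rule lim_\<psi>)
  qed
qed

lemma continuous_imp_lebesgue_measurable:
  fixes \<psi> :: "'a::euclidean_space \<Rightarrow> real"
  shows "continuous_on UNIV \<psi> \<Longrightarrow> \<psi> \<in> borel_measurable lebesgue"
  by (simp add: borel_measurable_continuous_onI measurable_completion)

text \<open>Duality: test functions bounded by 1 approximate the sign of \<open>h\<close> on
  \<open>K\<close>, and dominated convergence carries the bound over. It serves with
  \<open>M\<close> = 0 for uniqueness of weak gradients and with \<open>M\<close> = t \<omega> for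
  difference quotients.\<close>

lemma integral_abs_le_test_functions:
  fixes h :: "'a::euclidean_space \<Rightarrow> real"
  assumes h: "integrable lebesgue h" and "compact K" "open S" "K \<subseteq> S"
    and M: "\<And>\<psi>. \<psi> \<in> test_functions S \<Longrightarrow> (\<And>x. \<bar>\<psi> x\<bar> \<le> 1) \<Longrightarrow> (\<integral>x. h x * \<psi> x \<partial>lebesgue) \<le> M"
  shows "(\<integral>x. \<bar>h x\<bar> * indicator K x \<partial>lebesgue) \<le> M"
proof -
  have [measurable]: "K \<in> sets lebesgue" using \<open>compact K\<close> by (simp add: lmeasurable_compact fmeasurableD)
  note [measurable] = borel_measurable_integrable[OF h]
  define g where "g = (\<lambda>x. sgn (h x) * indicator K x :: real)"
  have "g \<in> borel_measurable lebesgue" unfolding g_def by measurable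
  moreover have "\<bar>g x\<bar> \<le> 1" "x \<notin> K \<Longrightarrow> g x = 0" for x
    by (auto simp: g_def sgn_if indicator_def)
  ultimately obtain \<psi> where \<psi>: "\<And>n. \<psi> n \<in> test_functions S" "\<And>n x. \<bar>\<psi> n x\<bar> \<le> 1"
    "AE x in lebesgue. (\<lambda>n. \<psi> n x) \<longlonglongrightarrow> g x"
    using test_function_approximation[OF assms(2-4)] by metis
  have [measurable]: "\<psi> n \<in> borel_measurable lebesgue" for n
    by (rule continuous_imp_lebesgue_measurable[OF test_functionsD(4)[OF \<psi>(1)]])
  have "(\<lambda>n. \<integral>x. h x * \<psi> n x \<partial>lebesgue) \<longlonglongrightarrow> (\<integral>x. h x * g x \<partial>lebesgue)"
  proof (rule integral_dominated_convergence[where w = "\<lambda>x. \<bar>h x\<bar>"])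
    show "AE x in lebesgue. (\<lambda>n. h x * \<psi> n x) \<longlonglongrightarrow> h x * g x"
      using \<psi>(3) by eventually_elim (intro tendsto_intros)
    show "AE x in lebesgue. norm (h x * \<psi> n x) \<le> \<bar>h x\<bar>" for n
      using \<psi>(2) by (simp add: abs_mult mult_left_le)
  qed (use h \<open>g \<in> _\<close> in auto)
  moreover have "h x * g x = \<bar>h x\<bar> * indicator K x" for x by (simp add: g_def abs_sgn)
  ultimately have "(\<lambda>n. \<integral>x. h x * \<psi> n x \<partial>lebesgue) \<longlonglongrightarrow> (\<integral>x. \<bar>h x\<bar> * indicator K x \<partial>lebesgue)"
    by simp
  then show ?thesis
  proof (rule LIMSEQ_le_const2, intro exI allI impI)
    show "(\<integral>x. h x * \<psi> n x \<partial>lebesgue) \<le> M" for n by (rule M[OF \<psi>(1)]) (rule \<psi>(2))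
  qed
qed

section \<open>Translations\<close>

lemma lebesgue_translate:
  fixes c :: "'a::euclidean_space"
  shows "(\<lambda>x. x + c) \<in> lebesgue \<rightarrow>\<^sub>M lebesgue"
    and "distr lebesgue lebesgue (\<lambda>x. x + c) = lebesgue"
proof -
  \<comment> \<open>A translation is the affine map with all coordinate factors equal to 1, hence
    with density factor 1.\<close>
  have eq: "(\<lambda>x. c + (\<Sum>j\<in>Basis. (1 * (x \<bullet> j)) *\<^sub>R j)) = (\<lambda>x. x + c)"
    by (auto simp: euclidean_representation add.commute)
  show "(\<lambda>x. x + c) \<in> lebesgue \<rightarrow>\<^sub>M lebesgue"
    using lebesgue_affine_measurable[of "\<lambda>_. 1" c] unfolding eq by simp
  have "lebesgue = density (distr lebesgue lebesgue (\<lambda>x. x + c)) (\<lambda>_. 1)"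
    using lebesgue_affine_euclidean[of "\<lambda>_. 1" c] unfolding eq by simp
  then show "distr lebesgue lebesgue (\<lambda>x. x + c) = lebesgue" by (simp add: density_1)
qed

lemma
  fixes f :: "'a::euclidean_space \<Rightarrow> real"
  assumes f: "integrable lebesgue f"
  shows integrable_translate: "integrable lebesgue (\<lambda>x. f (x + c))"
    and integral_translate: "(\<integral>x. f (x + c) \<partial>lebesgue) = (\<integral>x. f x \<partial>lebesgue)"
proof -
  have m: "f \<in> borel_measurable lebesgue" using f by simp
  show "integrable lebesgue (\<lambda>x. f (x + c))"
    using integrable_distr_eq[OF lebesgue_translate(1) m] f by (simp add: lebesgue_translate(2))
  show "(\<integral>x. f (x + c) \<partial>lebesgue) = (\<integral>x. f x \<partial>lebesgue)"
    using integral_distr[OF lebesgue_translate(1) m] by (simp add: lebesgue_translate(2))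
qed

lemma compact_sets_lebesgue [simp]: "compact K \<Longrightarrow> K \<in> sets lebesgue"
  for K :: "'a::euclidean_space set"
  by (simp add: lmeasurable_compact fmeasurableD)

section \<open>Integrals against test functions and their localisation\<close>

lemma integrable_mult_bounded:
  fixes f g :: "'a \<Rightarrow> real"
  assumes "integrable M f" "g \<in> borel_measurable M" "\<And>x. \<bar>g x\<bar> \<le> B"
  shows "integrable M (\<lambda>x. f x * g x)"
proof (rule Bochner_Integration.integrable_bound[of M "\<lambda>x. B * f x"])
  show "AE x in M. norm (f x * g x) \<le> norm (B * f x)"
  proof (rule AE_I2)
    fix x
    have "\<bar>g x\<bar> \<le> \<bar>B\<bar>" using assms(3)[of x] by linarith
    then show "norm (f x * g x) \<le> norm (B * f x)"
      by (simp add: abs_mult mult_left_mono mult.commute[of "\<bar>B\<bar>"])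
  qed
qed (use assms in auto)

lemma frechet_derivative_test_function:
  assumes \<phi>: "\<phi> \<in> test_functions S" and "i \<in> Basis"
  shows "(\<lambda>x. frechet_derivative \<phi> (at x) i) \<in> test_functions S"
proof (rule test_functionsI)
  show "Ck k (\<lambda>x. frechet_derivative \<phi> (at x) i)" for k
    using test_functionsD(1)[OF \<phi>, of "Suc k"] \<open>i \<in> Basis\<close> by simp
  show "compact (closure {x. \<phi> x \<noteq> 0})" "closure {x. \<phi> x \<noteq> 0} \<subseteq> S"
    using test_functionsD[OF \<phi>] by auto
  fix x assume x: "x \<notin> closure {x. \<phi> x \<noteq> 0}"
  have "((\<lambda>_. 0) has_derivative (\<lambda>_. 0)) (at x)" by simp
  then have "(\<phi> has_derivative (\<lambda>_. 0)) (at x)"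
    by (rule has_derivative_transform_within_open[of _ _ _ _ "- closure {x. \<phi> x \<noteq> 0}"])
       (use x closure_subset[of "{x. \<phi> x \<noteq> 0}"] in auto)
  then have "(\<lambda>_. 0) = frechet_derivative \<phi> (at x)" by (rule frechet_derivative_at)
  then show "frechet_derivative \<phi> (at x) i = 0" by (metis)
qed

lemma test_function_eq_0: "\<phi> \<in> test_functions S \<Longrightarrow> x \<notin> S \<Longrightarrow> \<phi> x = 0"
  using test_functionsD(3)[of \<phi> S] closure_subset[of "{x. \<phi> x \<noteq> 0}"] by blast

lemma test_function_bounded:
  assumes "\<phi> \<in> test_functions S"
  obtains B where "0 \<le> B" "\<And>x. \<bar>\<phi> x\<bar> \<le> B"
proof -
  let ?K = "closure {x. \<phi> x \<noteq> 0}"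
  have "bounded (\<phi> ` ?K)"
    using test_functionsD(2,4)[OF assms] continuous_on_subset
    by (intro compact_imp_bounded compact_continuous_image) auto
  then obtain B where B: "\<And>x. x \<in> ?K \<Longrightarrow> \<bar>\<phi> x\<bar> \<le> B" unfolding bounded_iff by auto
  have "\<bar>\<phi> x\<bar> \<le> max 0 B" for x
    using B[of x] closure_subset[of "{x. \<phi> x \<noteq> 0}"] by (cases "\<phi> x = 0") auto
  then show ?thesis using that[of "max 0 B"] by simp
qed

lemma test_function_lebesgue_measurable:
  "\<phi> \<in> test_functions S \<Longrightarrow> \<phi> \<in> borel_measurable lebesgue"
  by (rule continuous_imp_lebesgue_measurable[OF test_functionsD(4)])

text \<open>Weak derivatives are tested over \<Omega>, whereas translations act on the whole space.
  If \<psi> vanishes off \<open>C\<close>, multiplying \<open>H\<close> by the indicator of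
  \<open>C\<close> turns one kind of integral into the other; \<open>H\<close> itself may be
  arbitrary outside \<open>C\<close>.\<close>

lemma
  fixes H \<psi> :: "'a::euclidean_space \<Rightarrow> real"
  assumes H: "set_integrable lebesgue C H" and "C \<subseteq> \<Omega>" "open \<Omega>"
    and \<psi>: "\<psi> \<in> test_functions S" "\<And>x. x \<notin> C \<Longrightarrow> \<psi> x = 0"
  shows integrable_cutoff: "integrable (lebesgue_on \<Omega>) (\<lambda>x. H x * \<psi> x)"
    and integral_cutoff: "(\<integral>x. H x * \<psi> x \<partial>lebesgue_on \<Omega>) = (\<integral>x. (indicator C x * H x) * \<psi> x \<partial>lebesgue)"
    and integrable_cutoff_lebesgue: "integrable lebesgue (\<lambda>x. (indicator C x * H x) * \<psi> x)"
proof -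
  obtain B where B: "\<And>x. \<bar>\<psi> x\<bar> \<le> B" using test_function_bounded[OF \<psi>(1)] by blast
  show 1: "integrable lebesgue (\<lambda>x. (indicator C x * H x) * \<psi> x)"
    using H by (intro integrable_mult_bounded[OF _ _ B] test_function_lebesgue_measurable[OF \<psi>(1)])
      (simp add: set_integrable_def)
  have [simp]: "\<Omega> \<in> sets lebesgue" using \<open>open \<Omega>\<close> by auto
  have eq: "indicator \<Omega> x * (H x * \<psi> x) = (indicator C x * H x) * \<psi> x" for x
    using \<open>C \<subseteq> \<Omega>\<close> \<psi>(2)[of x] by (auto simp: indicator_def)
  show "integrable (lebesgue_on \<Omega>) (\<lambda>x. H x * \<psi> x)"
    using 1 by (simp add: integrable_restrict_space eq)
  show "(\<integral>x. H x * \<psi> x \<partial>lebesgue_on \<Omega>) = (\<integral>x. (indicator C x * H x) * \<psi> x \<partial>lebesgue)"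
    by (simp add: integral_restrict_space eq)
qed

section \<open>Uniqueness of weak gradients\<close>

lemma set_integrable_inner:
  "set_integrable M C G \<Longrightarrow> set_integrable M C (\<lambda>x. G x \<bullet> i)"
  unfolding set_integrable_def using integrable_inner_left by fastforce

text \<open>An exhaustion of \<Omega> by countably many compact sets, each in the interior of the
  next. The larger set \<open>D\<close> leaves room: integrability is available on \<open>D\<close>,
  and test functions approximating something on \<open>C\<close> may spread into its
  interior.\<close>

lemma AE_lebesgue_on_compactI:
  fixes \<Omega> :: "'a::euclidean_space set"
  assumes "open \<Omega>"
    and "\<And>C D. compact C \<Longrightarrow> compact D \<Longrightarrow> C \<subseteq> interior D \<Longrightarrow> D \<subseteq> \<Omega> \<Longrightarrow> AE x in lebesgue. x \<in> C \<longrightarrow> P x"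
  shows "AE x in lebesgue_on \<Omega>. P x"
proof -
  have "\<exists>C::nat \<Rightarrow> 'a set. (\<forall>n. compact (C n) \<and> C n \<subseteq> \<Omega> \<and> C n \<subseteq> interior (C (Suc n))) \<and> \<Union> (range C) = \<Omega>"
  proof (rule open_Union_compact_subsets[OF \<open>open \<Omega>\<close>])
    fix C :: "nat \<Rightarrow> 'a set"
    assume "\<And>n. compact (C n)" "\<And>n. C n \<subseteq> \<Omega>" "\<And>n. C n \<subseteq> interior (C (Suc n))" "\<Union> (range C) = \<Omega>"
    then show ?thesis by (intro exI[of _ C] conjI allI)
  qed
  then obtain C :: "nat \<Rightarrow> 'a set" where C: "\<forall>n. compact (C n) \<and> C n \<subseteq> \<Omega> \<and> C n \<subseteq> interior (C (Suc n))"
    "\<Union> (range C) = \<Omega>" by (elim exE conjE)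
  have "AE x in lebesgue. \<forall>n. x \<in> C n \<longrightarrow> P x"
    unfolding AE_all_countable
  proof
    fix n
    show "AE x in lebesgue. x \<in> C n \<longrightarrow> P x"
      by (rule assms(2)[of "C n" "C (Suc n)"]) (use C(1) in simp_all)
  qed
  then have "AE x in lebesgue. x \<in> \<Omega> \<longrightarrow> P x"
    by eventually_elim (use C(2) in blast)
  then show ?thesis using \<open>open \<Omega>\<close> by (simp add: AE_restrict_space_iff)
qed

text \<open>On \<open>D\<close> the difference of the two gradients annihilates, in every
  coordinate, all test functions of the interior. By duality its L^1 norm over \<open>C\<close> is
  0.\<close>

lemma weak_gradient_unique:
  assumes "open \<Omega>" and G1: "has_weak_gradient \<Omega> u G1" and G2: "has_weak_gradient \<Omega> u G2"
  shows "AE x in lebesgue_on \<Omega>. G1 x = G2 x"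
proof (rule AE_lebesgue_on_compactI[OF \<open>open \<Omega>\<close>])
  fix C D assume C: "compact C" and D: "compact D" "C \<subseteq> interior D" "D \<subseteq> \<Omega>"
  have int: "set_integrable lebesgue D (\<lambda>x. G1 x \<bullet> i)" "set_integrable lebesgue D (\<lambda>x. G2 x \<bullet> i)" for i
    using G1 G2 D by (auto simp: has_weak_gradient_def locally_integrable_on_def intro: set_integrable_inner)
  have "AE x in lebesgue. x \<in> C \<longrightarrow> G1 x \<bullet> i = G2 x \<bullet> i" if i: "i \<in> Basis" for i
  proof -
    define h where "h = (\<lambda>x. indicator D x * (G1 x \<bullet> i) - indicator D x * (G2 x \<bullet> i))"
    have h: "integrable lebesgue h"
      using int unfolding h_def set_integrable_def by simp
    have "(\<integral>x. \<bar>h x\<bar> * indicator C x \<partial>lebesgue) \<le> 0"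
    proof (rule integral_abs_le_test_functions[OF h \<open>compact C\<close> open_interior \<open>C \<subseteq> interior D\<close>])
      fix \<psi> assume \<psi>: "\<psi> \<in> test_functions (interior D)"
      have \<psi>0: "\<psi> x = 0" if "x \<notin> D" for x
        using test_function_eq_0[OF \<psi>] interior_subset[of D] that by blast
      have "\<psi> \<in> test_functions \<Omega>"
        using test_functions_mono[OF order_trans[OF interior_subset D(3)]] \<psi> by (rule subsetD)
      with G1 G2 i have "- (\<integral>x. (G1 x \<bullet> i) * \<psi> x \<partial>lebesgue_on \<Omega>)
          = - (\<integral>x. (G2 x \<bullet> i) * \<psi> x \<partial>lebesgue_on \<Omega>)"
        unfolding has_weak_gradient_def by (metis (no_types, lifting))
      then show "(\<integral>x. h x * \<psi> x \<partial>lebesgue) \<le> 0"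
        using integrable_cutoff_lebesgue[OF int(1)[of i] D(3) \<open>open \<Omega>\<close> \<psi> \<psi>0]
          integrable_cutoff_lebesgue[OF int(2)[of i] D(3) \<open>open \<Omega>\<close> \<psi> \<psi>0]
        by (simp add: h_def left_diff_distrib
            integral_cutoff[OF int(1)[of i] D(3) \<open>open \<Omega>\<close> \<psi> \<psi>0]
            integral_cutoff[OF int(2)[of i] D(3) \<open>open \<Omega>\<close> \<psi> \<psi>0])
    qed
    moreover have ih: "integrable lebesgue (\<lambda>x. \<bar>h x\<bar> * indicator C x)"
      by (rule integrable_mult_bounded[OF integrable_abs[OF h]
            borel_measurable_indicator[OF compact_sets_lebesgue[OF C]], of 1])
        (simp split: split_indicator)
    moreover have "0 \<le> (\<integral>x. \<bar>h x\<bar> * indicator C x \<partial>lebesgue)" by simp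
    ultimately have "AE x in lebesgue. \<bar>h x\<bar> * indicator C x = 0"
      by (subst integral_nonneg_eq_0_iff_AE[symmetric, OF ih]) auto
    then show ?thesis
    proof eventually_elim
      case (elim x)
      moreover have "x \<in> D" if "x \<in> C" using that D(2) interior_subset by blast
      ultimately show ?case by (auto simp: h_def inner_diff_left)
    qed
  qed
  then have "AE x in lebesgue. \<forall>i\<in>Basis. x \<in> C \<longrightarrow> G1 x \<bullet> i = G2 x \<bullet> i"
    by (intro AE_finite_allI) auto
  then show "AE x in lebesgue. x \<in> C \<longrightarrow> G1 x = G2 x"
  proof eventually_elim
    case (elim x)
    then show ?case by (simp add: euclidean_eq_iff[of "G1 x"])
  qed
qed

text \<open>Truncating \<open>f\<close> in space and in height at level \<open>n\<close> costs
  little in L^1 by dominated convergence. Divided by \<open>n\<close>, the truncation is bounded by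
  1 with bounded support, so it has an approximation by test functions with the same bound, and this
  bound dominates.\<close>

lemma test_functions_dense_L1:
  fixes f :: "'a::euclidean_space \<Rightarrow> real"
  assumes f: "integrable lebesgue f" and "0 < e"
  obtains \<psi> where "\<psi> \<in> test_functions UNIV" "integrable lebesgue \<psi>" "(\<integral>x. \<bar>f x - \<psi> x\<bar> \<partial>lebesgue) < e"
proof -
  note [measurable] = borel_measurable_integrable[OF f]
  define g where "g n x = indicator (cball 0 (real n)) x * max (- real n) (min (real n) (f x))" for n :: nat and x
  have g_meas [measurable]: "g n \<in> borel_measurable lebesgue" for n
  proof -
    have [measurable]: "cball 0 (real n) \<in> sets (lebesgue :: 'a measure)" by simp
    show ?thesis unfolding g_def by measurable
  qed
  have g_le: "\<bar>g n x\<bar> \<le> \<bar>f x\<bar>" "\<bar>g n x\<bar> \<le> real n" for n x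
    by (auto simp: g_def indicator_def)
  have g_int: "integrable lebesgue (g n)" for n
    by (rule Bochner_Integration.integrable_bound[OF f]) (auto simp: g_le)
  have "(\<lambda>n. \<integral>x. \<bar>f x - g n x\<bar> \<partial>lebesgue) \<longlonglongrightarrow> (\<integral>x. 0 \<partial>(lebesgue :: 'a measure))"
  proof (rule integral_dominated_convergence[where w = "\<lambda>x. 2 * \<bar>f x\<bar>"])
    show "AE x in lebesgue. (\<lambda>n. \<bar>f x - g n x\<bar>) \<longlonglongrightarrow> 0"
    proof (rule AE_I2)
      fix x
      obtain N where N: "norm x + \<bar>f x\<bar> \<le> real N" using real_arch_simple by blast
      have "g n x = f x" if "n \<ge> N" for n
      proof -
        have "real N \<le> real n" using that by simp
        then have "norm x \<le> real n" "\<bar>f x\<bar> \<le> real n" using N norm_ge_zero[of x] by linarith+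
        then show ?thesis by (auto simp: g_def)
      qed
      then show "(\<lambda>n. \<bar>f x - g n x\<bar>) \<longlonglongrightarrow> 0"
        by (intro tendsto_eventually eventually_sequentiallyI[of N]) auto
    qed
    show "AE x in lebesgue. norm \<bar>f x - g n x\<bar> \<le> 2 * \<bar>f x\<bar>" for n
    proof (rule AE_I2)
      fix x
      show "norm \<bar>f x - g n x\<bar> \<le> 2 * \<bar>f x\<bar>"
        using g_le(1)[of n x] abs_triangle_ineq4[of "f x" "g n x"] by simp
    qed
  qed (use f in auto)
  then have "\<forall>\<^sub>F n in sequentially. (\<integral>x. \<bar>f x - g n x\<bar> \<partial>lebesgue) < e / 2 \<and> 0 < n"
    using \<open>0 < e\<close> by (intro eventually_conj order_tendstoD eventually_gt_at_top) auto
  then obtain n where n: "(\<integral>x. \<bar>f x - g n x\<bar> \<partial>lebesgue) < e / 2" "0 < n"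
    using eventually_happens by force
  \<comment> \<open>The extra radius leaves room for the test functions around the closed ball that
    carries \<open>g n\<close>, while all their supports stay in one set of finite measure.\<close>
  let ?S = "ball (0::'a) (real n + 1)"
  have g1: "\<bar>g n x / real n\<bar> \<le> 1" and g0: "x \<notin> cball 0 (real n) \<Longrightarrow> g n x / real n = 0" for x
    using g_le(2)[of n x] n(2) by (auto simp: g_def)
  have gm: "(\<lambda>x. g n x / real n) \<in> borel_measurable lebesgue" by measurable
  have sub: "cball 0 (real n) \<subseteq> ?S" by auto
  obtain \<psi> where \<psi>: "\<And>j. \<psi> j \<in> test_functions ?S" "\<And>j x. \<bar>\<psi> j x\<bar> \<le> 1"
    "AE x in lebesgue. (\<lambda>j. \<psi> j x) \<longlonglongrightarrow> g n x / real n"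
    using test_function_approximation[OF compact_cball open_ball sub gm g1 g0] by blast
  note [measurable] = test_function_lebesgue_measurable[OF \<psi>(1)]
  have S: "integrable lebesgue (indicator ?S :: 'a \<Rightarrow> real)"
    using emeasure_bounded_finite[OF bounded_ball, of "0 :: 'a" "real n + 1"]
    by (simp add: integrable_indicator_iff)
  have \<psi>0: "\<psi> j x = 0" if "x \<notin> ?S" for j x
    using test_function_eq_0[OF \<psi>(1) that] .
  have "(\<lambda>j. \<integral>x. \<bar>g n x - real n * \<psi> j x\<bar> \<partial>lebesgue) \<longlonglongrightarrow> (\<integral>x. 0 \<partial>(lebesgue :: 'a measure))"
  proof (rule integral_dominated_convergence[where w = "\<lambda>x. 2 * real n * indicator ?S x"])
    show "AE x in lebesgue. (\<lambda>j. \<bar>g n x - real n * \<psi> j x\<bar>) \<longlonglongrightarrow> 0"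
      using \<psi>(3)
    proof eventually_elim
      case (elim x)
      have "(\<lambda>j. \<bar>g n x - real n * \<psi> j x\<bar>) \<longlonglongrightarrow> \<bar>g n x - real n * (g n x / real n)\<bar>"
        by (intro tendsto_intros elim)
      then show ?case using n(2) by simp
    qed
    show "AE x in lebesgue. norm \<bar>g n x - real n * \<psi> j x\<bar> \<le> 2 * real n * indicator ?S x" for j
    proof (rule AE_I2)
      fix x
      have "\<bar>real n * \<psi> j x\<bar> \<le> real n" using \<psi>(2)[of j x] by (simp add: abs_mult mult_left_le)
      moreover have "g n x = 0" if "x \<notin> ?S" using that by (auto simp: g_def)
      ultimately show "norm \<bar>g n x - real n * \<psi> j x\<bar> \<le> 2 * real n * indicator ?S x"
        using g_le(2)[of n x] \<psi>0[of x j] by (cases "x \<in> ?S") auto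
    qed
  qed (use S in auto)
  then have "\<forall>\<^sub>F j in sequentially. (\<integral>x. \<bar>g n x - real n * \<psi> j x\<bar> \<partial>lebesgue) < e / 2"
    using \<open>0 < e\<close> by (intro order_tendstoD) auto
  then obtain j where j: "(\<integral>x. \<bar>g n x - real n * \<psi> j x\<bar> \<partial>lebesgue) < e / 2"
    using eventually_happens by force
  have \<psi>_int: "integrable lebesgue (\<lambda>x. real n * \<psi> j x)"
  proof (rule Bochner_Integration.integrable_bound[OF integrable_mult_right[OF S, of "real n"]])
    show "AE x in lebesgue. norm (real n * \<psi> j x) \<le> norm (real n * indicator ?S x)"
      using \<psi>(2)[of j] \<psi>0[of _ j]
      by (intro AE_I2) (auto simp: abs_mult mult_left_le split: split_indicator)
  qed simp
  show ?thesis
  proof (rule that[OF _ \<psi>_int])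
    show "(\<lambda>x. real n * \<psi> j x) \<in> test_functions UNIV"
      by (rule test_functionsI[of _ "closure {x. \<psi> j x \<noteq> 0}"])
         (use test_functionsD[OF \<psi>(1)[of j]] closure_subset[of "{x. \<psi> j x \<noteq> 0}"]
          in \<open>auto intro: Ck_mult\<close>)
    have "(\<integral>x. \<bar>f x - real n * \<psi> j x\<bar> \<partial>lebesgue)
        \<le> (\<integral>x. \<bar>f x - g n x\<bar> + \<bar>g n x - real n * \<psi> j x\<bar> \<partial>lebesgue)"
      using f g_int \<psi>_int by (intro integral_mono) auto
    also have "\<dots> = (\<integral>x. \<bar>f x - g n x\<bar> \<partial>lebesgue) + (\<integral>x. \<bar>g n x - real n * \<psi> j x\<bar> \<partial>lebesgue)"
      using f g_int \<psi>_int by (intro Bochner_Integration.integral_add) auto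
    finally show "(\<integral>x. \<bar>f x - real n * \<psi> j x\<bar> \<partial>lebesgue) < e" using n j by linarith
  qed
qed

text \<open>A test function \<psi> replaces \<open>f\<close> both at x and at x + c, and translation
  invariance makes the two errors equal. The increment of \<psi> is controlled by its uniform
  continuity on a large ball. Each of the three terms takes a third of \<open>e\<close>.\<close>

lemma L1_translation_continuous:
  fixes f :: "'a::euclidean_space \<Rightarrow> real"
  assumes f: "integrable lebesgue f" and "0 < e"
  obtains d where "0 < d" "\<And>c. norm c < d \<Longrightarrow> (\<integral>x. \<bar>f (x + c) - f x\<bar> \<partial>lebesgue) \<le> e"
proof -
  obtain \<psi> where \<psi>: "\<psi> \<in> test_functions UNIV" "integrable lebesgue \<psi>"
    and close: "(\<integral>x. \<bar>f x - \<psi> x\<bar> \<partial>lebesgue) < e / 3"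
    using test_functions_dense_L1[OF f, of "e / 3"] \<open>0 < e\<close> by auto
  have "bounded (closure {x. \<psi> x \<noteq> 0})" using test_functionsD(2)[OF \<psi>(1)] by (rule compact_imp_bounded)
  then obtain R where R: "0 < R" "closure {x. \<psi> x \<noteq> 0} \<subseteq> ball 0 R"
    using bounded_subset_ballD by blast
  have \<psi>0: "\<psi> x = 0" if "R \<le> norm x" for x
    using R(2) closure_subset[of "{x. \<psi> x \<noteq> 0}"] that by force
  let ?m = "measure lebesgue (cball (0::'a) (R + 1))"
  \<comment> \<open>For translations shorter than 1 the increment of \<psi> vanishes outside the
    ball of radius R + 1, whose measure enters here. The added 1 makes the denominator positive
    without knowing that the measure is.\<close>
  define \<eta> where "\<eta> = e / (3 * (?m + 1))"
  have "0 < ?m + 1" using measure_nonneg[of lebesgue "cball (0::'a) (R + 1)"] by linarith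
  then have \<eta>: "0 < \<eta>" "\<eta> * ?m \<le> e / 3"
    using \<open>0 < e\<close> by (auto simp: \<eta>_def field_simps)
  have "uniformly_continuous_on (cball 0 (R + 2)) \<psi>"
    by (intro compact_uniformly_continuous continuous_on_subset[OF test_functionsD(4)[OF \<psi>(1)]]) auto
  then obtain d where d: "0 < d"
    and uc: "\<And>x y. x \<in> cball 0 (R + 2) \<Longrightarrow> y \<in> cball 0 (R + 2) \<Longrightarrow> dist y x < d \<Longrightarrow> dist (\<psi> y) (\<psi> x) < \<eta>"
    using \<eta>(1) unfolding uniformly_continuous_on_def by metis
  show ?thesis
  proof (rule that)
    show "0 < min d 1" using d by simp
    fix c :: 'a assume c: "norm c < min d 1"
    have pt: "\<bar>\<psi> (x + c) - \<psi> x\<bar> \<le> \<eta> * indicator (cball 0 (R + 1)) x" for x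
    proof (cases "norm x \<le> R + 1")
      case True
      then have "x + c \<in> cball 0 (R + 2)" using norm_triangle_ineq[of x c] c by simp
      then have "dist (\<psi> (x + c)) (\<psi> x) < \<eta>"
        using True c by (intro uc) (auto simp: dist_norm)
      then show ?thesis using True by (simp add: dist_real_def)
    next
      case False
      then have "R \<le> norm (x + c)" using norm_diff_ineq[of x c] c by simp
      with False show ?thesis by (simp add: \<psi>0)
    qed
    have "integrable lebesgue (indicator (cball (0::'a) (R + 1)) :: 'a \<Rightarrow> real)"
      using emeasure_bounded_finite[OF bounded_cball, of "0 :: 'a" "R + 1"]
      by (simp add: integrable_indicator_iff)
    note ind = integrable_mult_right[OF this, of \<eta>]
    have fc: "integrable lebesgue (\<lambda>x. \<bar>f (x + c) - \<psi> (x + c)\<bar>)"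
      using integrable_translate[of "\<lambda>x. \<bar>f x - \<psi> x\<bar>"] f \<psi>(2) by simp
    have fc0: "integrable lebesgue (\<lambda>x. \<bar>f x - \<psi> x\<bar>)"
      using f \<psi>(2) by simp
    have "(\<integral>x. \<bar>f (x + c) - f x\<bar> \<partial>lebesgue)
        \<le> (\<integral>x. \<bar>f (x + c) - \<psi> (x + c)\<bar> + \<eta> * indicator (cball 0 (R + 1)) x + \<bar>f x - \<psi> x\<bar> \<partial>lebesgue)"
    proof (rule integral_mono)
      show "integrable lebesgue (\<lambda>x. \<bar>f (x + c) - f x\<bar>)"
        using f integrable_translate[OF f] by simp
      show "integrable lebesgue
         (\<lambda>x. \<bar>f (x + c) - \<psi> (x + c)\<bar> + \<eta> * indicator (cball 0 (R + 1)) x + \<bar>f x - \<psi> x\<bar>)"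
        by (intro Bochner_Integration.integrable_add fc fc0 ind)
      show "\<bar>f (x + c) - f x\<bar> \<le> \<bar>f (x + c) - \<psi> (x + c)\<bar> + \<eta> * indicator (cball 0 (R + 1)) x + \<bar>f x - \<psi> x\<bar>" for x
        using pt[of x] by linarith
    qed
    also have "\<dots> = (\<integral>x. \<bar>f (x + c) - \<psi> (x + c)\<bar> \<partial>lebesgue)
        + (\<integral>x. \<eta> * indicator (cball (0::'a) (R + 1)) x \<partial>lebesgue) + (\<integral>x. \<bar>f x - \<psi> x\<bar> \<partial>lebesgue)"
      by (subst Bochner_Integration.integral_add
          | intro Bochner_Integration.integrable_add fc fc0 ind refl)+
    also have "(\<integral>x. \<bar>f (x + c) - \<psi> (x + c)\<bar> \<partial>lebesgue) = (\<integral>x. \<bar>f x - \<psi> x\<bar> \<partial>lebesgue)"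
      by (rule integral_translate[OF fc0])
    also have "(\<integral>x. \<eta> * indicator (cball (0::'a) (R + 1)) x \<partial>lebesgue) = \<eta> * ?m" by simp
    finally show "(\<integral>x. \<bar>f (x + c) - f x\<bar> \<partial>lebesgue) \<le> e" using close \<eta>(2) by linarith
  qed
qed

section \<open>Difference quotients\<close>

lemma test_function_directional:
  fixes \<psi> :: "'a::euclidean_space \<Rightarrow> real"
  assumes "\<psi> \<in> test_functions S"
  shows "((\<lambda>s. \<psi> (x - s *\<^sub>R e)) has_real_derivative - frechet_derivative \<psi> (at (x - s *\<^sub>R e)) e) (at s)"
proof -
  have D: "(\<psi> has_derivative frechet_derivative \<psi> (at y)) (at y)" for y
    using Ck_Suc_has_derivative[OF test_functionsD(1)[OF assms, of "Suc 0"]] .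
  have "((\<lambda>s. x - s *\<^sub>R e) has_derivative (\<lambda>h. - (h *\<^sub>R e))) (at s)"
    by (auto intro!: derivative_eq_intros)
  from has_derivative_compose[OF this D]
  have "((\<lambda>s. \<psi> (x - s *\<^sub>R e)) has_derivative
      (\<lambda>h. frechet_derivative \<psi> (at (x - s *\<^sub>R e)) (- (h *\<^sub>R e)))) (at s)" .
  moreover have "frechet_derivative \<psi> (at y) (- (h *\<^sub>R e)) = - frechet_derivative \<psi> (at y) e * h" for h y
  proof -
    have "linear (frechet_derivative \<psi> (at y))" using D has_derivative_linear by blast
    then show ?thesis by (simp add: linear_neg linear_scale)
  qed
  ultimately show ?thesis unfolding has_field_derivative_def by (simp only:)
qed

text \<open>Differentiation under the integral sign: the translations fall on the smooth factor,
  whose difference quotients are bounded by a bound \<open>B\<close> of its derivative, so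
  \<open>B * \<bar>U x\<bar>\<close> dominates. Limits are taken along sequences to fit dominated
  convergence.\<close>

lemma DERIV_integral_test_function:
  fixes U \<psi> :: "'a::euclidean_space \<Rightarrow> real"
  assumes U: "integrable lebesgue U" and \<psi>: "\<psi> \<in> test_functions S" and e: "e \<in> Basis"
  shows "((\<lambda>s. \<integral>x. U x * \<psi> (x - s *\<^sub>R e) \<partial>lebesgue) has_real_derivative
     - (\<integral>x. U x * frechet_derivative \<psi> (at (x - s *\<^sub>R e)) e \<partial>lebesgue)) (at s)"
proof -
  let ?D = "\<lambda>x. frechet_derivative \<psi> (at x) e"
  have D: "?D \<in> test_functions S" by (rule frechet_derivative_test_function[OF \<psi> e])
  obtain B where B: "\<And>x. \<bar>?D x\<bar> \<le> B" using test_function_bounded[OF D] by blast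
  obtain B' where B': "\<And>x. \<bar>\<psi> x\<bar> \<le> B'" using test_function_bounded[OF \<psi>] by blast
  have lip: "\<bar>\<psi> (x - a *\<^sub>R e) - \<psi> (x - b *\<^sub>R e)\<bar> \<le> B * \<bar>a - b\<bar>" for x a b
    using field_differentiable_bound[of UNIV "\<lambda>s. \<psi> (x - s *\<^sub>R e)" "\<lambda>s. - ?D (x - s *\<^sub>R e)" B a b]
      test_function_directional[OF \<psi>] B by simp
  have m\<psi> [measurable]: "(\<lambda>x. \<psi> (x - a *\<^sub>R e)) \<in> borel_measurable lebesgue" for a
    by (intro continuous_imp_lebesgue_measurable continuous_intros
        continuous_on_compose2[OF test_functionsD(4)[OF \<psi>]]) auto
  have mD [measurable]: "(\<lambda>x. ?D (x - a *\<^sub>R e)) \<in> borel_measurable lebesgue" for a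
    by (intro continuous_imp_lebesgue_measurable continuous_intros
        continuous_on_compose2[OF test_functionsD(4)[OF D]]) auto
  have iU: "integrable lebesgue (\<lambda>x. U x * \<psi> (x - a *\<^sub>R e))" for a
    by (rule integrable_mult_bounded[OF U m\<psi> B'])
  note [measurable] = borel_measurable_integrable[OF U]
  have "((\<lambda>h. ((\<integral>x. U x * \<psi> (x - (s + h) *\<^sub>R e) \<partial>lebesgue) - (\<integral>x. U x * \<psi> (x - s *\<^sub>R e) \<partial>lebesgue)) / h)
     \<longlongrightarrow> - (\<integral>x. U x * ?D (x - s *\<^sub>R e) \<partial>lebesgue)) (at 0)"
    unfolding tendsto_at_iff_sequentially o_def
  proof (intro allI impI)
    fix X :: "nat \<Rightarrow> real"
    assume X: "\<forall>i. X i \<in> UNIV - {0}" "X \<longlonglongrightarrow> 0"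
    let ?q = "\<lambda>n x. U x * ((\<psi> (x - (s + X n) *\<^sub>R e) - \<psi> (x - s *\<^sub>R e)) / X n)"
    have "(\<lambda>n. \<integral>x. ?q n x \<partial>lebesgue) \<longlonglongrightarrow> (\<integral>x. U x * (- ?D (x - s *\<^sub>R e)) \<partial>lebesgue)"
    proof (rule integral_dominated_convergence[where w = "\<lambda>x. B * \<bar>U x\<bar>"])
      show "AE x in lebesgue. (\<lambda>n. ?q n x) \<longlonglongrightarrow> U x * (- ?D (x - s *\<^sub>R e))"
      proof (rule AE_I2)
        fix x
        have "((\<lambda>h. (\<psi> (x - (s + h) *\<^sub>R e) - \<psi> (x - s *\<^sub>R e)) / h) \<longlongrightarrow> - ?D (x - s *\<^sub>R e)) (at 0)"
          using test_function_directional[OF \<psi>, of x e s] by (simp add: DERIV_def)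
        then have "(\<lambda>n. (\<psi> (x - (s + X n) *\<^sub>R e) - \<psi> (x - s *\<^sub>R e)) / X n) \<longlonglongrightarrow> - ?D (x - s *\<^sub>R e)"
          using X unfolding tendsto_at_iff_sequentially o_def by blast
        then show "(\<lambda>n. ?q n x) \<longlonglongrightarrow> U x * (- ?D (x - s *\<^sub>R e))" by (rule tendsto_mult_left)
      qed
      show "AE x in lebesgue. norm (?q n x) \<le> B * \<bar>U x\<bar>" for n
      proof (rule AE_I2)
        fix x
        have "\<bar>\<psi> (x - (s + X n) *\<^sub>R e) - \<psi> (x - s *\<^sub>R e)\<bar> \<le> B * \<bar>X n\<bar>"
          using lip[of x "s + X n" s] by simp
        then have "\<bar>(\<psi> (x - (s + X n) *\<^sub>R e) - \<psi> (x - s *\<^sub>R e)) / X n\<bar> \<le> B"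
          using X(1) by (simp add: divide_simps)
        then have "\<bar>U x\<bar> * \<bar>(\<psi> (x - (s + X n) *\<^sub>R e) - \<psi> (x - s *\<^sub>R e)) / X n\<bar> \<le> \<bar>U x\<bar> * B"
          by (rule mult_left_mono) simp
        then show "norm (?q n x) \<le> B * \<bar>U x\<bar>" by (simp only: real_norm_def abs_mult mult.commute[of B])
      qed
      show "integrable lebesgue (\<lambda>x. B * \<bar>U x\<bar>)" using U by simp
    qed measurable
    moreover have "(\<integral>x. ?q n x \<partial>lebesgue)
        = ((\<integral>x. U x * \<psi> (x - (s + X n) *\<^sub>R e) \<partial>lebesgue) - (\<integral>x. U x * \<psi> (x - s *\<^sub>R e) \<partial>lebesgue)) / X n" for n
    proof -
      have "?q n x = (U x * \<psi> (x - (s + X n) *\<^sub>R e) - U x * \<psi> (x - s *\<^sub>R e)) / X n" for x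
        by (simp add: right_diff_distrib)
      then show ?thesis
        by (simp only: integral_divide_zero Bochner_Integration.integral_diff[OF iU iU])
    qed
    ultimately show "(\<lambda>n. ((\<integral>x. U x * \<psi> (x - (s + X n) *\<^sub>R e) \<partial>lebesgue) - (\<integral>x. U x * \<psi> (x - s *\<^sub>R e) \<partial>lebesgue)) / X n)
       \<longlonglongrightarrow> - (\<integral>x. U x * ?D (x - s *\<^sub>R e) \<partial>lebesgue)"
      by (simp only: mult_minus_right Bochner_Integration.integral_minus)
  qed
  then show ?thesis unfolding DERIV_def .
qed

text \<open>By \<open>wk\<close> the integral of U(x) \<psi>(x - s e) has the integral of H(x)
  \<psi>(x - s e) as its derivative in s. The mean value theorem expresses the increment over [0,t]
  by a translate of \<open>H\<close>, and replacing the translate by \<open>H\<close> costs at most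
  t \<omega>. Duality removes \<psi>. The identity \<open>wk\<close> is assumed only for short
  translates because in the application \<open>U\<close> and \<open>H\<close> are cut off.\<close>

lemma difference_quotient_estimate:
  fixes U H :: "'a::euclidean_space \<Rightarrow> real"
  assumes U: "integrable lebesgue U" and H: "integrable lebesgue H" and e: "e \<in> Basis"
    and K: "compact K" "open S" "K \<subseteq> S" and t: "0 < t"
    and wk: "\<And>\<psi> s. \<psi> \<in> test_functions S \<Longrightarrow> 0 \<le> s \<Longrightarrow> s \<le> t \<Longrightarrow>
      (\<integral>x. U x * frechet_derivative \<psi> (at (x - s *\<^sub>R e)) e \<partial>lebesgue) = - (\<integral>x. H x * \<psi> (x - s *\<^sub>R e) \<partial>lebesgue)"
    and \<omega>: "\<And>s. 0 \<le> s \<Longrightarrow> s \<le> t \<Longrightarrow> (\<integral>x. \<bar>H (x + s *\<^sub>R e) - H x\<bar> \<partial>lebesgue) \<le> \<omega>"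
  shows "(\<integral>x. \<bar>U (x + t *\<^sub>R e) - U x - t * H x\<bar> * indicator K x \<partial>lebesgue) \<le> t * \<omega>"
proof (rule integral_abs_le_test_functions[OF _ K])
  show "integrable lebesgue (\<lambda>x. U (x + t *\<^sub>R e) - U x - t * H x)"
    using U H integrable_translate[OF U] by simp
  fix \<psi> assume \<psi>: "\<psi> \<in> test_functions S" and \<psi>1: "\<And>x. \<bar>\<psi> x\<bar> \<le> 1"
  have m\<psi>: "(\<lambda>x. \<psi> (x - a *\<^sub>R e)) \<in> borel_measurable lebesgue" for a
    by (intro continuous_imp_lebesgue_measurable continuous_intros
        continuous_on_compose2[OF test_functionsD(4)[OF \<psi>]]) auto
  have shift: "integrable lebesgue (\<lambda>x. f x * \<psi> (x - s *\<^sub>R e))"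
    "integrable lebesgue (\<lambda>x. f (x + s *\<^sub>R e) * \<psi> x)"
    "(\<integral>x. f x * \<psi> (x - s *\<^sub>R e) \<partial>lebesgue) = (\<integral>x. f (x + s *\<^sub>R e) * \<psi> x \<partial>lebesgue)"
    if "integrable lebesgue f" for f s
  proof -
    show 1: "integrable lebesgue (\<lambda>x. f x * \<psi> (x - s *\<^sub>R e))"
      by (rule integrable_mult_bounded[OF that m\<psi> \<psi>1])
    from integrable_translate[OF this, of "s *\<^sub>R e"]
    show "integrable lebesgue (\<lambda>x. f (x + s *\<^sub>R e) * \<psi> x)" by simp
    from integral_translate[OF 1, of "s *\<^sub>R e"]
    show "(\<integral>x. f x * \<psi> (x - s *\<^sub>R e) \<partial>lebesgue) = (\<integral>x. f (x + s *\<^sub>R e) * \<psi> x \<partial>lebesgue)" by simp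
  qed
  let ?J = "\<lambda>s. \<integral>x. U x * \<psi> (x - s *\<^sub>R e) \<partial>lebesgue"
  have "DERIV ?J s :> (\<integral>x. H x * \<psi> (x - s *\<^sub>R e) \<partial>lebesgue)" if "0 \<le> s" "s \<le> t" for s
    using DERIV_integral_test_function[OF U \<psi> e, of s] wk[OF \<psi> that] by simp
  \<comment> \<open>The point \<open>z\<close> depends on \<psi>, which is harmless: \<omega> bounds
    the translation error for every s in [0,t].\<close>
  from MVT2[OF t this] obtain z where z: "0 < z" "z < t"
    "?J t - ?J 0 = (t - 0) * (\<integral>x. H x * \<psi> (x - z *\<^sub>R e) \<partial>lebesgue)" by blast
  have "(\<integral>x. (U (x + t *\<^sub>R e) - U x - t * H x) * \<psi> x \<partial>lebesgue)
      = (\<integral>x. U (x + t *\<^sub>R e) * \<psi> x \<partial>lebesgue) - (\<integral>x. U x * \<psi> x \<partial>lebesgue) - t * (\<integral>x. H x * \<psi> x \<partial>lebesgue)"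
    using shift(2)[OF U, of t] shift(2)[OF U, of 0] shift(2)[OF H, of 0]
    by (simp add: left_diff_distrib mult.assoc)
  also have "\<dots> = t * (\<integral>x. H (x + z *\<^sub>R e) * \<psi> x \<partial>lebesgue) - t * (\<integral>x. H x * \<psi> x \<partial>lebesgue)"
    using z(3) shift(3)[OF U, of t] shift(3)[OF H, of z] by simp
  also have "\<dots> = t * (\<integral>x. (H (x + z *\<^sub>R e) - H x) * \<psi> x \<partial>lebesgue)"
    using shift(2)[OF H, of z] shift(2)[OF H, of 0]
    by (simp add: left_diff_distrib right_diff_distrib)
  also have "\<dots> \<le> t * (\<integral>x. \<bar>H (x + z *\<^sub>R e) - H x\<bar> \<partial>lebesgue)"
  proof (rule mult_left_mono[OF integral_mono])
    show "integrable lebesgue (\<lambda>x. (H (x + z *\<^sub>R e) - H x) * \<psi> x)"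
      using shift(2)[OF H, of z] shift(2)[OF H, of 0] by (simp add: left_diff_distrib)
    show "integrable lebesgue (\<lambda>x. \<bar>H (x + z *\<^sub>R e) - H x\<bar>)"
      using H integrable_translate[OF H] by simp
    show "(H (x + z *\<^sub>R e) - H x) * \<psi> x \<le> \<bar>H (x + z *\<^sub>R e) - H x\<bar>" for x
    proof -
      have "(H (x + z *\<^sub>R e) - H x) * \<psi> x \<le> \<bar>H (x + z *\<^sub>R e) - H x\<bar> * \<bar>\<psi> x\<bar>"
        by (metis abs_ge_self abs_mult)
      also have "\<dots> \<le> \<bar>H (x + z *\<^sub>R e) - H x\<bar>" using \<psi>1 by (simp add: mult_left_le)
      finally show ?thesis .
    qed
  qed (use t in simp)
  also have "\<dots> \<le> t * \<omega>" using t z by (intro mult_left_mono \<omega>) auto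
  finally show "(\<integral>x. (U (x + t *\<^sub>R e) - U x - t * H x) * \<psi> x \<partial>lebesgue) \<le> t * \<omega>" .
qed

lemma L1_translation_tendsto:
  fixes f :: "'a::euclidean_space \<Rightarrow> real"
  assumes f: "integrable lebesgue f" and c: "c \<longlonglongrightarrow> 0"
  shows "(\<lambda>n::nat. \<integral>x. \<bar>f (x + c n) - f x\<bar> \<partial>lebesgue) \<longlonglongrightarrow> 0"
proof (rule LIMSEQ_I)
  fix \<epsilon> :: real assume "0 < \<epsilon>"
  then have "0 < \<epsilon> / 2" by simp
  from L1_translation_continuous[OF f this] obtain d where d: "0 < d"
    "\<And>c. norm c < d \<Longrightarrow> (\<integral>x. \<bar>f (x + c) - f x\<bar> \<partial>lebesgue) \<le> \<epsilon> / 2" by blast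
  from LIMSEQ_D[OF c d(1)] obtain N where N: "\<And>n. n \<ge> N \<Longrightarrow> norm (c n) < d" by auto
  have "norm ((\<integral>x. \<bar>f (x + c n) - f x\<bar> \<partial>lebesgue) - 0) < \<epsilon>" if "n \<ge> N" for n
  proof -
    have "0 \<le> (\<integral>x. \<bar>f (x + c n) - f x\<bar> \<partial>lebesgue)" by simp
    with d(2)[OF N[OF that]] \<open>0 < \<epsilon>\<close> show ?thesis by simp
  qed
  then show "\<exists>N. \<forall>n\<ge>N. norm ((\<integral>x. \<bar>f (x + c n) - f x\<bar> \<partial>lebesgue) - 0) < \<epsilon>" by blast
qed

text \<open>Caratheodory's form of the derivative: with the diagonal filled in by \<open>F'\<close>,
  the factorisation of increments holds without case distinction, and differentiability at
  \<open>b\<close> becomes continuity in \<open>a\<close> at \<open>b\<close>, even along sequences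
  that hit \<open>b\<close>.\<close>

definition slope :: "(real \<Rightarrow> real) \<Rightarrow> (real \<Rightarrow> real) \<Rightarrow> real \<Rightarrow> real \<Rightarrow> real" where
  "slope F F' a b = (if a = b then F' b else (F a - F b) / (a - b))"

lemma slope_eq: "F a - F b = slope F F' a b * (a - b)"
  by (simp add: slope_def)

lemma DERIV_everywhere_borel_measurable:
  fixes F :: "real \<Rightarrow> real"
  assumes "\<And>s. (F has_real_derivative F' s) (at s)"
  shows "F \<in> borel_measurable borel"
  using DERIV_isCont[OF assms] by (intro borel_measurable_continuous_onI continuous_at_imp_continuous_on) auto

lemma slope_le:
  fixes F F' :: "real \<Rightarrow> real"
  assumes F: "\<And>s. (F has_real_derivative F' s) (at s)" and L: "\<And>s. \<bar>F' s\<bar> \<le> L"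
  shows "\<bar>slope F F' a b\<bar> \<le> L"
proof -
  have "\<bar>F a - F b\<bar> \<le> L * \<bar>a - b\<bar>"
    using field_differentiable_bound[of UNIV F F' L a b] F L by simp
  then show ?thesis
    using L by (auto simp: slope_def divide_simps)
qed

lemma slope_tendsto:
  assumes F: "(F has_real_derivative F' b) (at b)" and "X \<longlonglongrightarrow> b"
  shows "(\<lambda>n::nat. slope F F' (X n) b) \<longlonglongrightarrow> F' b"
proof -
  obtain g where g: "\<And>z. F z - F b = g z * (z - b)" "isCont g b" "g b = F' b"
    using F unfolding CARAT_DERIV by blast
  have "g z = slope F F' z b" for z
    using g(1)[of z] g(3) by (simp add: slope_def)
  with isCont_tendsto_compose[OF g(2) \<open>X \<longlonglongrightarrow> b\<close>] g(3) show ?thesis by simp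
qed

lemma slope_measurable:
  assumes F: "\<And>s. (F has_real_derivative F' s) (at s)" and [measurable]: "F' \<in> borel_measurable borel"
    and [measurable]: "u \<in> borel_measurable M" "v \<in> borel_measurable M"
  shows "(\<lambda>x. slope F F' (u x) (v x)) \<in> borel_measurable M"
proof -
  note [measurable] = DERIV_everywhere_borel_measurable[OF F]
  show ?thesis unfolding slope_def by measurable
qed

text \<open>The difference quotients of F(U), tested with \<phi>, are evaluated twice. Moving the
  translation to \<phi> produces its derivative. Writing the increment of \<open>F\<close> as slope
  times increment of \<open>U\<close> produces \<open>F'(U) * H\<close>, because the quotients of
  \<open>U\<close> tend to \<open>H\<close> in L^1 on the support of \<phi> and the bounded slopes
  tend to \<open>F'(U)\<close> almost everywhere.\<close>

lemma integral_compose_derivative: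
  fixes U H :: "'a::euclidean_space \<Rightarrow> real"
  assumes U: "integrable lebesgue U" and H: "integrable lebesgue H" and e: "e \<in> Basis"
    and \<phi>: "\<phi> \<in> test_functions S" "open S" and r: "0 < r"
    and wk: "\<And>\<psi> s. \<psi> \<in> test_functions S \<Longrightarrow> 0 \<le> s \<Longrightarrow> s \<le> r \<Longrightarrow>
      (\<integral>x. U x * frechet_derivative \<psi> (at (x - s *\<^sub>R e)) e \<partial>lebesgue) = - (\<integral>x. H x * \<psi> (x - s *\<^sub>R e) \<partial>lebesgue)"
    and F: "\<And>s. (F has_real_derivative F' s) (at s)" and L: "\<And>s. \<bar>F' s\<bar> \<le> L"
    and F': "F' \<in> borel_measurable borel" and "F 0 = 0"
  shows "(\<integral>x. F (U x) * frechet_derivative \<phi> (at x) e \<partial>lebesgue) = - (\<integral>x. F' (U x) * H x * \<phi> x \<partial>lebesgue)"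
proof -
  define q where "q = slope F F'"
  note q = slope_eq[of F _ _ F', folded q_def] and q_le = slope_le[of F F', OF F L, folded q_def]
    and q_lim = slope_tendsto[of F F', OF F, folded q_def]
  have "0 \<le> L" using L[of 0] by linarith
  obtain B where B: "0 \<le> B" "\<And>x. \<bar>\<phi> x\<bar> \<le> B" using test_function_bounded[OF \<phi>(1)] by blast
  define K where "K = closure {x. \<phi> x \<noteq> 0}"
  have K: "compact K" "K \<subseteq> S" and \<phi>0: "\<And>x. x \<notin> K \<Longrightarrow> \<phi> x = 0"
    using test_functionsD(2,3)[OF \<phi>(1)] closure_subset[of "{x. \<phi> x \<noteq> 0}"] by (auto simp: K_def)
  have [measurable]: "K \<in> sets lebesgue" using K(1) by simp
  note [measurable] = borel_measurable_integrable[OF U] borel_measurable_integrable[OF H] F'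
    test_function_lebesgue_measurable[OF \<phi>(1)]
  \<comment> \<open>The steps stay in (0, r], where the weak identity for translates is
    available.\<close>
  define t where "t n = r * inverse (real (Suc n))" for n
  have t: "0 < t n" "t n \<le> r" for n
    using r by (auto simp: t_def field_simps)
  have t0: "t \<longlonglongrightarrow> 0"
    unfolding t_def using tendsto_mult_left[OF LIMSEQ_inverse_real_of_nat, of r] by simp
  have te0: "(\<lambda>n. t n *\<^sub>R e) \<longlonglongrightarrow> 0" using tendsto_scaleR[OF t0 tendsto_const, of e] by simp
  have Ut: "integrable lebesgue (\<lambda>x. U (x + c))" for c by (rule integrable_translate[OF U])
  note [measurable] = borel_measurable_integrable[OF Ut]
  have F_le: "\<bar>F a\<bar> \<le> L * \<bar>a\<bar>" for a
    using q[of a 0] q_le[of a 0] \<open>F 0 = 0\<close> by (simp add: abs_mult mult_right_mono)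
  note [measurable] = DERIV_everywhere_borel_measurable[OF F]
  have FU: "integrable lebesgue (\<lambda>x. F (U x))"
  proof (rule Bochner_Integration.integrable_bound[OF integrable_mult_right[OF U, of L]])
    show "AE x in lebesgue. norm (F (U x)) \<le> norm (L * U x)"
      using F_le \<open>0 \<le> L\<close> by (simp add: abs_mult)
  qed measurable
  have F'U: "integrable lebesgue (\<lambda>x. H x * F' (U x))"
    by (rule integrable_mult_bounded[OF H _ L]) measurable
  have F'UH: "integrable lebesgue (\<lambda>x. F' (U x) * H x * \<phi> x)"
    using integrable_mult_bounded[OF F'U test_function_lebesgue_measurable[OF \<phi>(1)] B(2)]
    by (simp add: mult.commute)

  let ?J = "\<lambda>s. \<integral>x. F (U x) * \<phi> (x - s *\<^sub>R e) \<partial>lebesgue"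
  let ?D = "\<lambda>n x. (F (U (x + t n *\<^sub>R e)) - F (U x)) / t n * \<phi> x"
  have FUt: "integrable lebesgue (\<lambda>x. F (U (x + c)))" for c by (rule integrable_translate[OF FU])
  have FU\<phi>: "integrable lebesgue (\<lambda>x. F (U (x + c)) * \<phi> x)" for c
    by (rule integrable_mult_bounded[OF FUt test_function_lebesgue_measurable[OF \<phi>(1)] B(2)])
  have FU\<phi>0: "integrable lebesgue (\<lambda>x. F (U x) * \<phi> x)"
    using FU\<phi>[of 0] by simp
  have D_eq: "?D n x = (F (U (x + t n *\<^sub>R e)) * \<phi> x - F (U x) * \<phi> x) / t n" for n x
    by (simp add: left_diff_distrib)
  have D_int: "integrable lebesgue (?D n)" for n
    unfolding D_eq using FU\<phi> FU\<phi>0 by simp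
  have J_shift: "?J s = (\<integral>x. F (U (x + s *\<^sub>R e)) * \<phi> x \<partial>lebesgue)" for s
  proof -
    have "integrable lebesgue (\<lambda>x. F (U x) * \<phi> (x - s *\<^sub>R e))"
      using integrable_translate[OF FU\<phi>[of "s *\<^sub>R e"], of "- (s *\<^sub>R e)"] by simp
    from integral_translate[OF this, of "s *\<^sub>R e"] show ?thesis by simp
  qed
  have I_eq: "(\<integral>x. ?D n x \<partial>lebesgue) = (?J (0 + t n) - ?J 0) / t n" for n
    unfolding D_eq integral_divide_zero Bochner_Integration.integral_diff[OF FU\<phi> FU\<phi>0] J_shift by simp
  have "((\<lambda>h. (?J (0 + h) - ?J 0) / h) \<longlongrightarrow> - (\<integral>x. F (U x) * frechet_derivative \<phi> (at (x - 0 *\<^sub>R e)) e \<partial>lebesgue)) (at 0)"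
    using DERIV_integral_test_function[OF FU \<phi>(1) e, of 0] unfolding DERIV_def .
  moreover have "filterlim t (at 0) sequentially"
    using t(1) t0 by (auto simp: filterlim_at less_le)
  ultimately have "(\<lambda>n. (?J (0 + t n) - ?J 0) / t n)
      \<longlonglongrightarrow> - (\<integral>x. F (U x) * frechet_derivative \<phi> (at (x - 0 *\<^sub>R e)) e \<partial>lebesgue)"
    by (rule filterlim_compose)
  then have lim1: "(\<lambda>n. \<integral>x. ?D n x \<partial>lebesgue) \<longlonglongrightarrow> - (\<integral>x. F (U x) * frechet_derivative \<phi> (at x) e \<partial>lebesgue)"
    by (simp only: I_eq scaleR_zero_left diff_zero)

  \<comment> \<open>Two errors are estimated separately: \<open>b n\<close>, for replacing the
    increment of \<open>U\<close> by \<open>t n * H\<close>, and below \<open>c n\<close>, for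
    replacing the slope by \<open>F' (U x)\<close>, weighted with \<open>H\<close>. The former must
    be small even after division by \<open>t n\<close>.\<close>
  define b where "b n = (\<integral>x. \<bar>U (x + t n *\<^sub>R e) - U x - t n * H x\<bar> * indicator K x \<partial>lebesgue)" for n
  have b_int: "integrable lebesgue (\<lambda>x. \<bar>U (x + t n *\<^sub>R e) - U x - t n * H x\<bar> * indicator K x)" for n
    by (rule integrable_mult_bounded[of _ _ _ 1]) (use U H Ut in \<open>auto split: split_indicator\<close>)
  have b_lim: "(\<lambda>n. b n / t n) \<longlonglongrightarrow> 0"
  proof (rule LIMSEQ_I)
    fix \<epsilon> :: real assume "0 < \<epsilon>"
    then have "0 < \<epsilon> / 2" by simp
    from L1_translation_continuous[OF H this] obtain d where d: "0 < d"
      "\<And>c. norm c < d \<Longrightarrow> (\<integral>x. \<bar>H (x + c) - H x\<bar> \<partial>lebesgue) \<le> \<epsilon> / 2" by blast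
    from LIMSEQ_D[OF t0 d(1)] obtain N where N: "\<And>n. n \<ge> N \<Longrightarrow> norm (t n - 0) < d" by blast
    have "norm (b n / t n - 0) < \<epsilon>" if "n \<ge> N" for n
    proof -
      have "b n \<le> t n * (\<epsilon> / 2)"
        unfolding b_def
      proof (rule difference_quotient_estimate[OF U H e K(1) \<phi>(2) K(2) t(1) wk])
        fix s assume "0 \<le> s" "s \<le> t n"
        then show "(\<integral>x. \<bar>H (x + s *\<^sub>R e) - H x\<bar> \<partial>lebesgue) \<le> \<epsilon> / 2"
          using N[OF that] e by (intro d(2)) simp
      qed (use t(2)[of n] in auto)
      then have "b n / t n \<le> \<epsilon> / 2" using t(1)[of n] by (simp add: divide_simps mult.commute)
      moreover have "0 \<le> b n / t n" using t(1)[of n] by (simp add: b_def)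
      ultimately show ?thesis using \<open>0 < \<epsilon>\<close> unfolding real_norm_def by linarith
    qed
    then show "\<exists>N. \<forall>n\<ge>N. norm (b n / t n - 0) < \<epsilon>" by blast
  qed

  \<comment> \<open>Translates of \<open>U\<close> converge only in L^1, so the slopes converge
    pointwise only along a subsequence. That is enough, because the first evaluation and
    \<open>b_lim\<close> hold for the full sequence.\<close>
  have "(\<lambda>n. \<integral>x. norm (U (x + t n *\<^sub>R e) - U x) \<partial>lebesgue) \<longlonglongrightarrow> 0"
    using L1_translation_tendsto[OF U te0] by simp
  moreover have "integrable lebesgue (\<lambda>x. U (x + t n *\<^sub>R e) - U x)" for n using U Ut by simp
  ultimately obtain \<rho> :: "nat \<Rightarrow> nat" where \<rho>: "strict_mono \<rho>"
    and AE\<rho>: "AE x in lebesgue. (\<lambda>n. U (x + t (\<rho> n) *\<^sub>R e) - U x) \<longlonglongrightarrow> 0"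
    using tendsto_L1_AE_subseq[of lebesgue "\<lambda>n x. U (x + t n *\<^sub>R e) - U x"] by blast
  let ?q = "\<lambda>n x. q (U (x + t n *\<^sub>R e)) (U x)"
  have q_m [measurable]: "(\<lambda>x. ?q n x) \<in> borel_measurable lebesgue" for n
    unfolding q_def by (rule slope_measurable[OF F F']) measurable
  define c where "c n = (\<integral>x. \<bar>?q n x - F' (U x)\<bar> * \<bar>H x\<bar> \<partial>lebesgue)" for n
  have c_le: "\<bar>?q n x - F' (U x)\<bar> * \<bar>H x\<bar> \<le> 2 * L * \<bar>H x\<bar>" for n x
    using q_le[of "U (x + t n *\<^sub>R e)" "U x"] L[of "U x"] by (intro mult_right_mono) linarith+
  have c_int: "integrable lebesgue (\<lambda>x. \<bar>?q n x - F' (U x)\<bar> * \<bar>H x\<bar>)" for n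
  proof (rule Bochner_Integration.integrable_bound[OF integrable_mult_right[OF H, of "2 * L"]])
    show "AE x in lebesgue. norm (\<bar>?q n x - F' (U x)\<bar> * \<bar>H x\<bar>) \<le> norm (2 * L * H x)"
      using c_le \<open>0 \<le> L\<close> by (simp add: abs_mult)
  qed measurable
  have c_lim: "(\<lambda>n. c (\<rho> n)) \<longlonglongrightarrow> 0"
  proof -
    have "(\<lambda>n. c (\<rho> n)) \<longlonglongrightarrow> (\<integral>x. 0 \<partial>(lebesgue :: 'a measure))"
      unfolding c_def
    proof (rule integral_dominated_convergence[where w = "\<lambda>x. 2 * L * \<bar>H x\<bar>"])
      show "AE x in lebesgue. (\<lambda>n. \<bar>?q (\<rho> n) x - F' (U x)\<bar> * \<bar>H x\<bar>) \<longlonglongrightarrow> 0"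
        using AE\<rho>
      proof eventually_elim
        case (elim x)
        then have "(\<lambda>n. U (x + t (\<rho> n) *\<^sub>R e)) \<longlonglongrightarrow> U x" by (rule LIM_zero_cancel)
        from q_lim[OF this]
        have "(\<lambda>n. \<bar>?q (\<rho> n) x - F' (U x)\<bar> * \<bar>H x\<bar>) \<longlonglongrightarrow> \<bar>F' (U x) - F' (U x)\<bar> * \<bar>H x\<bar>"
          by (intro tendsto_intros)
        then show ?case by simp
      qed
      show "AE x in lebesgue. norm (\<bar>?q (\<rho> n) x - F' (U x)\<bar> * \<bar>H x\<bar>) \<le> 2 * L * \<bar>H x\<bar>" for n
        using c_le by simp
      show "integrable lebesgue (\<lambda>x. 2 * L * \<bar>H x\<bar>)" using H by simp
    qed measurable
    then show ?thesis by simp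
  qed

  have est: "\<bar>(\<integral>x. ?D n x \<partial>lebesgue) - (\<integral>x. F' (U x) * H x * \<phi> x \<partial>lebesgue)\<bar>
      \<le> B * L * (b n / t n) + B * c n" for n
  proof -
    let ?b = "\<lambda>x. \<bar>U (x + t n *\<^sub>R e) - U x - t n * H x\<bar> * indicator K x"
    let ?c = "\<lambda>x. \<bar>?q n x - F' (U x)\<bar> * \<bar>H x\<bar>"
    have pt: "\<bar>?D n x - F' (U x) * H x * \<phi> x\<bar> \<le> B * L / t n * ?b x + B * ?c x" for x
    proof (cases "x \<in> K")
      case False
      then show ?thesis using \<phi>0 B(1) by simp
    next
      case True
      let ?a = "U (x + t n *\<^sub>R e) - U x - t n * H x"
      \<comment> \<open>The product of the slope with \<open>H\<close> is added and subtracted. The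
        factor 1 / \<open>t n\<close> falls only on the part measured by \<open>b n\<close>.\<close>
      have "?D n x - F' (U x) * H x * \<phi> x = (?q n x / t n * ?a + (?q n x - F' (U x)) * H x) * \<phi> x"
        unfolding q[of "U (x + t n *\<^sub>R e)" "U x"] using t(1)[of n] by (simp add: field_simps)
      then have "\<bar>?D n x - F' (U x) * H x * \<phi> x\<bar> = \<bar>?q n x / t n * ?a + (?q n x - F' (U x)) * H x\<bar> * \<bar>\<phi> x\<bar>"
        by (simp only: abs_mult)
      also have "\<dots> \<le> (L / t n * \<bar>?a\<bar> + ?c x) * B"
      proof (rule mult_mono[OF _ B(2)])
        have "\<bar>?q n x / t n\<bar> \<le> L / t n" using q_le t(1)[of n] by (simp add: divide_right_mono)
        then have "\<bar>?q n x / t n * ?a\<bar> \<le> L / t n * \<bar>?a\<bar>" unfolding abs_mult by (intro mult_right_mono) auto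
        moreover have "\<bar>(?q n x - F' (U x)) * H x\<bar> = ?c x" by (rule abs_mult)
        ultimately show "\<bar>?q n x / t n * ?a + (?q n x - F' (U x)) * H x\<bar> \<le> L / t n * \<bar>?a\<bar> + ?c x"
          by linarith
        show "0 \<le> L / t n * \<bar>?a\<bar> + ?c x" using \<open>0 \<le> L\<close> t(1)[of n] by simp
      qed simp
      finally show ?thesis using True by (simp add: algebra_simps)
    qed
    have "\<bar>(\<integral>x. ?D n x \<partial>lebesgue) - (\<integral>x. F' (U x) * H x * \<phi> x \<partial>lebesgue)\<bar>
        = \<bar>\<integral>x. ?D n x - F' (U x) * H x * \<phi> x \<partial>lebesgue\<bar>"
      by (simp only: Bochner_Integration.integral_diff[OF D_int F'UH])
    also have "\<dots> \<le> (\<integral>x. \<bar>?D n x - F' (U x) * H x * \<phi> x\<bar> \<partial>lebesgue)"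
      by (rule integral_abs_bound)
    also have "\<dots> \<le> (\<integral>x. B * L / t n * ?b x + B * ?c x \<partial>lebesgue)"
      by (rule integral_mono[OF _ _ pt])
         (intro integrable_abs Bochner_Integration.integrable_diff D_int F'UH
           Bochner_Integration.integrable_add integrable_mult_right b_int c_int)+
    also have "\<dots> = B * L / t n * b n + B * c n"
      unfolding b_def c_def
      by (simp only: Bochner_Integration.integral_add[OF integrable_mult_right[OF b_int] integrable_mult_right[OF c_int]]
          integral_mult_right_zero)
    finally show ?thesis by simp
  qed
  have "(\<lambda>n. (\<integral>x. ?D (\<rho> n) x \<partial>lebesgue) - (\<integral>x. F' (U x) * H x * \<phi> x \<partial>lebesgue)) \<longlonglongrightarrow> 0"
  proof (rule Lim_null_comparison)
    show "\<forall>\<^sub>F n in sequentially. norm ((\<integral>x. ?D (\<rho> n) x \<partial>lebesgue) - (\<integral>x. F' (U x) * H x * \<phi> x \<partial>lebesgue))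
        \<le> B * L * (b (\<rho> n) / t (\<rho> n)) + B * c (\<rho> n)"
      using est by simp
    have "(\<lambda>n. b (\<rho> n) / t (\<rho> n)) \<longlonglongrightarrow> 0"
      using LIMSEQ_subseq_LIMSEQ[OF b_lim \<rho>] by (simp add: o_def)
    then have "(\<lambda>n. B * L * (b (\<rho> n) / t (\<rho> n)) + B * c (\<rho> n)) \<longlonglongrightarrow> B * L * 0 + B * 0"
      by (intro tendsto_add tendsto_mult_left c_lim)
    then show "(\<lambda>n. B * L * (b (\<rho> n) / t (\<rho> n)) + B * c (\<rho> n)) \<longlonglongrightarrow> 0" by simp
  qed
  then have "(\<lambda>n. \<integral>x. ?D (\<rho> n) x \<partial>lebesgue) \<longlonglongrightarrow> (\<integral>x. F' (U x) * H x * \<phi> x \<partial>lebesgue)"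
    by (rule LIM_zero_cancel)
  moreover have "(\<lambda>n. \<integral>x. ?D (\<rho> n) x \<partial>lebesgue) \<longlonglongrightarrow> - (\<integral>x. F (U x) * frechet_derivative \<phi> (at x) e \<partial>lebesgue)"
    using LIMSEQ_subseq_LIMSEQ[OF lim1 \<rho>] by (simp add: o_def)
  ultimately show ?thesis using LIMSEQ_unique by fastforce
qed

section \<open>Calculus of weak gradients\<close>

lemma has_weak_gradientD:
  assumes "has_weak_gradient \<Omega> u G" "compact C" "C \<subseteq> \<Omega>"
  shows "set_integrable lebesgue C u" "set_integrable lebesgue C G"
    "set_integrable lebesgue C (\<lambda>x. G x \<bullet> i)"
  using assms by (auto simp: has_weak_gradient_def locally_integrable_on_def intro: set_integrable_inner)

lemma has_weak_gradient_integral: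
  assumes "has_weak_gradient \<Omega> u G" "\<phi> \<in> test_functions \<Omega>" "i \<in> Basis"
  shows "(\<integral>x. u x * frechet_derivative \<phi> (at x) i \<partial>lebesgue_on \<Omega>) = - (\<integral>x. (G x \<bullet> i) * \<phi> x \<partial>lebesgue_on \<Omega>)"
  using assms unfolding has_weak_gradient_def by blast

lemma test_function_support:
  fixes \<phi> :: "'a::euclidean_space \<Rightarrow> real"
  assumes "\<phi> \<in> test_functions \<Omega>"
  obtains C where "compact C" "C \<subseteq> \<Omega>" "\<phi> \<in> test_functions C"
proof
  show "compact (closure {x. \<phi> x \<noteq> 0})" "closure {x. \<phi> x \<noteq> 0} \<subseteq> \<Omega>"
    "\<phi> \<in> test_functions (closure {x. \<phi> x \<noteq> 0})"
    using assms by (auto simp: test_functions_def)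
qed

lemma has_weak_gradient_diff:
  assumes "open \<Omega>" and u: "has_weak_gradient \<Omega> u G" and v: "has_weak_gradient \<Omega> v H"
  shows "has_weak_gradient \<Omega> (\<lambda>x. u x - v x) (\<lambda>x. G x - H x)"
  unfolding has_weak_gradient_def
proof (intro conjI ballI)
  show "locally_integrable_on \<Omega> (\<lambda>x. u x - v x)" "locally_integrable_on \<Omega> (\<lambda>x. G x - H x)"
    using u v by (auto simp: has_weak_gradient_def locally_integrable_on_def intro: set_integral_diff)
  fix \<phi> i assume \<phi>: "\<phi> \<in> test_functions \<Omega>" and i: "i \<in> (Basis :: 'a set)"
  obtain C where C: "compact C" "C \<subseteq> \<Omega>" "\<phi> \<in> test_functions C" using test_function_support[OF \<phi>] .
  note \<phi>0 = test_function_eq_0[OF C(3)]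
  note D = frechet_derivative_test_function[OF C(3) i]
  note cut = integrable_cutoff[OF _ C(2) \<open>open \<Omega>\<close>]
  note ud = cut[OF has_weak_gradientD(1)[OF u C(1,2)] D test_function_eq_0[OF D]]
  note vd = cut[OF has_weak_gradientD(1)[OF v C(1,2)] D test_function_eq_0[OF D]]
  note Gd = cut[OF has_weak_gradientD(3)[OF u C(1,2), of i] C(3) \<phi>0]
  note Hd = cut[OF has_weak_gradientD(3)[OF v C(1,2), of i] C(3) \<phi>0]
  show "(\<integral>x. (u x - v x) * frechet_derivative \<phi> (at x) i \<partial>lebesgue_on \<Omega>)
      = - (\<integral>x. ((G x - H x) \<bullet> i) * \<phi> x \<partial>lebesgue_on \<Omega>)"
    using ud vd Gd Hd has_weak_gradient_integral[OF u \<phi> i] has_weak_gradient_integral[OF v \<phi> i]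
    by (simp add: left_diff_distrib inner_diff_left)
qed

text \<open>The integral of a translate of \<phi> does not depend on the translation, and its
  derivative in the length of the translation is minus the integral in question.\<close>

lemma integral_frechet_derivative_test_function:
  fixes \<phi> :: "'a::euclidean_space \<Rightarrow> real"
  assumes \<phi>: "\<phi> \<in> test_functions S" and e: "e \<in> Basis"
  shows "(\<integral>x. frechet_derivative \<phi> (at x) e \<partial>lebesgue) = 0"
proof -
  have "bounded (closure {x. \<phi> x \<noteq> 0})" using test_functionsD(2)[OF \<phi>] by (rule compact_imp_bounded)
  then obtain R where R: "0 < R" "closure {x. \<phi> x \<noteq> 0} \<subseteq> ball 0 R"
    using bounded_subset_ballD by blast
  have \<phi>R: "\<phi> \<in> test_functions (ball 0 R)"
    using \<phi> R(2) by (auto simp: test_functions_def)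
  \<comment> \<open>Stands in for the constant 1, which is not integrable. The radius exceeds that
    of a ball containing the support by 1, so translates of length below 1 do not notice the
    difference.\<close>
  define U :: "'a \<Rightarrow> real" where "U = indicator (ball 0 (R + 1))"
  have U: "integrable lebesgue U"
    using emeasure_bounded_finite[OF bounded_ball, of "0 :: 'a" "R + 1"]
    by (simp add: integrable_indicator_iff U_def)
  obtain B where B: "\<And>x. \<bar>\<phi> x\<bar> \<le> B" using test_function_bounded[OF \<phi>] by blast
  have drop_U: "U x * \<phi> (x - s *\<^sub>R e) = \<phi> (x - s *\<^sub>R e)" if "\<bar>s\<bar> < 1" for x s
  proof (cases "norm x < R + 1")
    case False
    then have "x - s *\<^sub>R e \<notin> ball 0 R"
      using norm_triangle_ineq2[of x "s *\<^sub>R e"] that e by simp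
    then show ?thesis using test_function_eq_0[OF \<phi>R] by simp
  qed (simp add: U_def)
  have drop_U0: "U x * \<phi> x = \<phi> x" for x using drop_U[of 0 x] by simp
  have \<phi>_int: "integrable lebesgue \<phi>"
    using integrable_mult_bounded[OF U test_function_lebesgue_measurable[OF \<phi>] B] by (simp add: drop_U0)
  have "(\<integral>x. U x * \<phi> (x - s *\<^sub>R e) \<partial>lebesgue) = (\<integral>x. \<phi> x \<partial>lebesgue)" if "\<bar>s\<bar> < 1" for s
    using integral_translate[OF \<phi>_int, of "- (s *\<^sub>R e)"] by (simp add: drop_U[OF that])
  then have "((\<lambda>s. \<integral>x. U x * \<phi> (x - s *\<^sub>R e) \<partial>lebesgue) has_real_derivative 0) (at 0)"
    by (intro has_field_derivative_transform_within_open[OF DERIV_const, of "{-1<..<1}"]) auto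
  with DERIV_integral_test_function[OF U \<phi> e, of 0]
  have "(\<integral>x. U x * frechet_derivative \<phi> (at x) e \<partial>lebesgue) = 0"
    using DERIV_unique by fastforce
  moreover have "U x * frechet_derivative \<phi> (at x) e = frechet_derivative \<phi> (at x) e" for x
    using test_function_eq_0[OF frechet_derivative_test_function[OF \<phi>R e], of x]
    by (cases "norm x < R + 1") (auto simp: U_def)
  ultimately show ?thesis by simp
qed

lemma has_weak_gradient_const:
  assumes "open \<Omega>"
  shows "has_weak_gradient \<Omega> (\<lambda>_. c) (\<lambda>_. 0 :: 'a::euclidean_space)"
  unfolding has_weak_gradient_def
proof (intro conjI ballI)
  show "locally_integrable_on \<Omega> (\<lambda>_. c)"
    unfolding locally_integrable_on_def set_integrable_def
    using lmeasurable_compact by (auto intro!: integrable_scaleR_left simp: lmeasurable_iff_integrable)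
  show "locally_integrable_on \<Omega> (\<lambda>_. 0 :: 'a)"
    by (simp add: locally_integrable_on_def set_integrable_def)
  fix \<phi> i assume \<phi>: "\<phi> \<in> test_functions \<Omega>" and i: "i \<in> (Basis :: 'a set)"
  have ind: "indicator \<Omega> x * frechet_derivative \<phi> (at x) i = frechet_derivative \<phi> (at x) i" for x
    using test_function_eq_0[OF frechet_derivative_test_function[OF \<phi> i], of x]
    by (cases "x \<in> \<Omega>") auto
  have "\<Omega> \<in> sets lebesgue" using assms by auto
  then have "(\<integral>x. frechet_derivative \<phi> (at x) i \<partial>lebesgue_on \<Omega>) = 0"
    by (simp add: integral_restrict_space ind integral_frechet_derivative_test_function[OF \<phi> i])
  then show "(\<integral>x. c * frechet_derivative \<phi> (at x) i \<partial>lebesgue_on \<Omega>)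
      = - (\<integral>x. (0 \<bullet> i) * \<phi> x \<partial>lebesgue_on \<Omega>)"
    by simp
qed

text \<open>Reduction to the whole space. With \<phi> supported in \<open>K\<close>, the data are
  cut off at a compact neighbourhood \<open>C\<close> of \<open>K\<close> in \<Omega>. Functions
  supported in a smaller neighbourhood \<open>S\<close> vanish off \<open>C\<close> even after short
  translations, so they see the original weak identity.\<close>

lemma has_weak_gradient_compose:
  fixes u :: "'a::euclidean_space \<Rightarrow> real"
  assumes "open \<Omega>" and u: "has_weak_gradient \<Omega> u G"
    and F: "\<And>s. (F has_real_derivative F' s) (at s)" and L: "\<And>s. \<bar>F' s\<bar> \<le> L"
    and F': "F' \<in> borel_measurable borel" and "F 0 = 0"
  shows "has_weak_gradient \<Omega> (\<lambda>x. F (u x)) (\<lambda>x. F' (u x) *\<^sub>R G x)"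
proof -
  note [measurable] = DERIV_everywhere_borel_measurable[OF F] F'
  have F_le: "\<bar>F a\<bar> \<le> L * \<bar>a\<bar>" for a
    using field_differentiable_bound[of UNIV F F' L a 0] F L \<open>F 0 = 0\<close> by simp
  have L0: "0 \<le> L" using L[of 0] by linarith
  \<comment> \<open>Here \<open>F 0 = 0\<close> enters: composition with \<open>F\<close> commutes
    with the cut-off.\<close>
  have F_ind: "indicator C x * F (u x) = F (indicator C x * u x)" for C x
    using \<open>F 0 = 0\<close> by (auto split: split_indicator)
  have F'_ind: "indicator C x *\<^sub>R F' (u x) *\<^sub>R G x = F' (indicator C x * u x) *\<^sub>R (indicator C x *\<^sub>R G x)" for C x
    by (auto split: split_indicator)
  have int_F: "set_integrable lebesgue C (\<lambda>x. F (u x))"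
    and int_F': "set_integrable lebesgue C (\<lambda>x. F' (u x) *\<^sub>R G x)" if C: "compact C" "C \<subseteq> \<Omega>" for C
  proof -
    have uC: "integrable lebesgue (\<lambda>x. indicator C x * u x)" and GC: "integrable lebesgue (\<lambda>x. indicator C x *\<^sub>R G x)"
      using has_weak_gradientD(1,2)[OF u C] by (auto simp: set_integrable_def)
    note [measurable] = borel_measurable_integrable[OF uC] borel_measurable_integrable[OF GC]
    show "set_integrable lebesgue C (\<lambda>x. F (u x))"
      unfolding set_integrable_def real_scaleR_def F_ind
    proof (rule Bochner_Integration.integrable_bound[OF integrable_mult_right[OF uC, of L]])
      show "AE x in lebesgue. norm (F (indicator C x * u x)) \<le> norm (L * (indicator C x * u x))"
      proof (rule AE_I2)
        fix x
        show "norm (F (indicator C x * u x)) \<le> norm (L * (indicator C x * u x))"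
          using F_le[of "indicator C x * u x"] L0 by (simp only: real_norm_def abs_mult[of L] abs_of_nonneg)
      qed
    qed measurable
    show "set_integrable lebesgue C (\<lambda>x. F' (u x) *\<^sub>R G x)"
      unfolding set_integrable_def F'_ind
    proof (rule Bochner_Integration.integrable_bound[OF integrable_scaleR_right[OF GC, of L]])
      show "AE x in lebesgue. norm (F' (indicator C x * u x) *\<^sub>R indicator C x *\<^sub>R G x)
          \<le> norm (L *\<^sub>R indicator C x *\<^sub>R G x)"
      proof (rule AE_I2)
        fix x
        show "norm (F' (indicator C x * u x) *\<^sub>R indicator C x *\<^sub>R G x) \<le> norm (L *\<^sub>R indicator C x *\<^sub>R G x)"
          unfolding norm_scaleR[of _ "indicator C x *\<^sub>R G x"] using L[of "indicator C x * u x"] L0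
          by (intro mult_right_mono) auto
      qed
    qed measurable
  qed
  show ?thesis
    unfolding has_weak_gradient_def
  proof (intro conjI ballI)
    show "locally_integrable_on \<Omega> (\<lambda>x. F (u x))" "locally_integrable_on \<Omega> (\<lambda>x. F' (u x) *\<^sub>R G x)"
      using int_F int_F' by (auto simp: locally_integrable_on_def)
    fix \<phi> i assume \<phi>: "\<phi> \<in> test_functions \<Omega>" and i: "i \<in> (Basis :: 'a set)"
    obtain K where K: "compact K" "K \<subseteq> \<Omega>" "\<phi> \<in> test_functions K" using test_function_support[OF \<phi>] .
    obtain \<epsilon> where \<epsilon>: "0 < \<epsilon>" "(\<Union>x\<in>K. cball x \<epsilon>) \<subseteq> \<Omega>"
      using compact_subset_open_imp_cball_epsilon_subset[OF K(1) \<open>open \<Omega>\<close> K(2)] .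
    \<comment> \<open>The closed \<epsilon>-neighbourhood of \<open>K\<close>, written as a sum of
      two compact sets to have compactness at once; \<open>C_iff\<close> gives the form used later.
      Radius \<epsilon>/2 for \<open>S\<close> leaves \<epsilon>/2 for translations.\<close>
    define C where "C = {x + y | x y. x \<in> K \<and> y \<in> cball 0 \<epsilon>}"
    define S where "S = (\<Union>x\<in>K. ball x (\<epsilon> / 2))"
    have C: "compact C" unfolding C_def by (intro compact_sums K(1) compact_cball)
    have C_iff: "x \<in> C \<longleftrightarrow> (\<exists>k\<in>K. dist k x \<le> \<epsilon>)" for x
    proof
      assume "\<exists>k\<in>K. dist k x \<le> \<epsilon>"
      then obtain k where "k \<in> K" "norm (x - k) \<le> \<epsilon>" by (auto simp: dist_norm norm_minus_commute)
      then show "x \<in> C" unfolding C_def by (intro CollectI exI[of _ k] exI[of _ "x - k"]) auto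
    next
      assume "x \<in> C"
      then obtain k y where "x = k + y" "k \<in> K" "norm y \<le> \<epsilon>" by (auto simp: C_def)
      then show "\<exists>k\<in>K. dist k x \<le> \<epsilon>" by (intro bexI[of _ k]) (auto simp: dist_norm)
    qed
    have "C \<subseteq> \<Omega>" using \<epsilon>(2) by (force simp: C_iff)
    have "open S" by (auto simp: S_def)
    have "K \<subseteq> S" using \<epsilon>(1) by (force simp: S_def)
    have \<phi>S: "\<phi> \<in> test_functions S" using test_functions_mono[OF \<open>K \<subseteq> S\<close>] K(3) by blast
    have shift: "x - s *\<^sub>R i \<notin> S" if "x \<notin> C" "0 \<le> s" "s \<le> \<epsilon> / 2" for x s
    proof
      assume "x - s *\<^sub>R i \<in> S"
      then obtain k where k: "k \<in> K" "dist k (x - s *\<^sub>R i) < \<epsilon> / 2" by (auto simp: S_def)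
      have "dist k x \<le> dist k (x - s *\<^sub>R i) + dist (x - s *\<^sub>R i) x" by (rule dist_triangle)
      also have "dist (x - s *\<^sub>R i) x = s" using i that(2) by (simp add: dist_norm)
      finally show False using k that C_iff[of x] by auto
    qed
    have "S \<subseteq> C"
    proof
      fix x assume "x \<in> S"
      then show "x \<in> C" using shift[of x 0] \<epsilon>(1) by auto
    qed
    define U where "U = (\<lambda>x. indicator C x * u x)"
    define H where "H = (\<lambda>x. indicator C x * (G x \<bullet> i))"
    have U: "integrable lebesgue U" and H: "integrable lebesgue H"
      using has_weak_gradientD(1,3)[OF u C \<open>C \<subseteq> \<Omega>\<close>] by (auto simp: U_def H_def set_integrable_def)
    have "(\<integral>x. F (U x) * frechet_derivative \<phi> (at x) i \<partial>lebesgue) = - (\<integral>x. F' (U x) * H x * \<phi> x \<partial>lebesgue)"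
    proof (rule integral_compose_derivative[OF U H i \<phi>S \<open>open S\<close> _ _ F L F' \<open>F 0 = 0\<close>])
      show "0 < \<epsilon> / 2" using \<epsilon>(1) by simp
      fix \<psi> s assume \<psi>: "\<psi> \<in> test_functions S" and s: "0 \<le> s" "s \<le> \<epsilon> / 2"
      let ?\<psi> = "\<lambda>x. \<psi> (x - s *\<^sub>R i)"
      have \<psi>0: "?\<psi> x = 0" if "x \<notin> C" for x
        by (rule test_function_eq_0[OF \<psi> shift[OF that s]])
      have \<psi>s: "?\<psi> \<in> test_functions \<Omega>"
        by (rule test_functionsI[OF Ck_translate[OF test_functionsD(1)[OF \<psi>]] C \<open>C \<subseteq> \<Omega>\<close> \<psi>0])
      have D: "frechet_derivative ?\<psi> (at x) = frechet_derivative \<psi> (at (x - s *\<^sub>R i))" for x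
        by (rule frechet_derivative_translate[OF test_functionsD(1)[OF \<psi>, of "Suc 0"]])
      have D0: "frechet_derivative ?\<psi> (at x) i = 0" if "x \<notin> C" for x
        unfolding D by (rule test_function_eq_0[OF frechet_derivative_test_function[OF \<psi> i] shift[OF that s]])
      show "(\<integral>x. U x * frechet_derivative \<psi> (at (x - s *\<^sub>R i)) i \<partial>lebesgue)
          = - (\<integral>x. H x * \<psi> (x - s *\<^sub>R i) \<partial>lebesgue)"
        using has_weak_gradient_integral[OF u \<psi>s i]
          integral_cutoff[OF has_weak_gradientD(1)[OF u C \<open>C \<subseteq> \<Omega>\<close>] \<open>C \<subseteq> \<Omega>\<close> \<open>open \<Omega>\<close>
            frechet_derivative_test_function[OF \<psi>s i] D0]
          integral_cutoff[OF has_weak_gradientD(3)[OF u C \<open>C \<subseteq> \<Omega>\<close>, of i] \<open>C \<subseteq> \<Omega>\<close> \<open>open \<Omega>\<close> \<psi>s \<psi>0]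
        by (simp add: D U_def H_def)
    qed
    moreover have "F' (U x) * H x = indicator C x * ((F' (u x) *\<^sub>R G x) \<bullet> i)" for x
      by (auto simp: U_def H_def split: split_indicator)
    moreover have "F (U x) = indicator C x * F (u x)" for x
      by (simp add: U_def F_ind)
    moreover have "\<phi> x = 0" if "x \<notin> C" for x
      using that \<open>S \<subseteq> C\<close> test_function_eq_0[OF \<phi>S] by blast
    moreover have "frechet_derivative \<phi> (at x) i = 0" if "x \<notin> C" for x
      using that \<open>S \<subseteq> C\<close> test_function_eq_0[OF frechet_derivative_test_function[OF \<phi>S i]] by blast
    ultimately show "(\<integral>x. F (u x) * frechet_derivative \<phi> (at x) i \<partial>lebesgue_on \<Omega>)
      = - (\<integral>x. ((F' (u x) *\<^sub>R G x) \<bullet> i) * \<phi> x \<partial>lebesgue_on \<Omega>)"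
      by (subst integral_cutoff[OF int_F[OF C \<open>C \<subseteq> \<Omega>\<close>] \<open>C \<subseteq> \<Omega>\<close> \<open>open \<Omega>\<close>
            frechet_derivative_test_function[OF \<phi>S i]], blast,
          subst integral_cutoff[OF set_integrable_inner[OF int_F'[OF C \<open>C \<subseteq> \<Omega>\<close>]] \<open>C \<subseteq> \<Omega>\<close> \<open>open \<Omega>\<close> \<phi>S], blast)
         (simp only:)
  qed
qed

section \<open>Variable exponent spaces\<close>

text \<open>Integrability on a compact set gives measurability there, and countably many compact
  sets cover \<Omega>.\<close>

lemma has_weak_gradient_measurable:
  fixes G :: "'a::euclidean_space \<Rightarrow> 'a"
  assumes "open \<Omega>" and u: "has_weak_gradient \<Omega> u G"
  shows "G \<in> borel_measurable (lebesgue_on \<Omega>)"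
proof (rule open_Union_compact_subsets[OF \<open>open \<Omega>\<close>])
  fix C :: "nat \<Rightarrow> 'a set"
  assume C: "\<And>n. compact (C n)" "\<And>n. C n \<subseteq> \<Omega>" and un: "\<Union> (range C) = \<Omega>"
  have \<Omega>: "\<Omega> \<in> sets lebesgue" using \<open>open \<Omega>\<close> by auto
  show ?thesis
  proof (rule measurable_piecewise_restrict[of "range C"])
    fix S assume "S \<in> range C"
    then obtain n where S: "S = C n" by blast
    have "set_integrable lebesgue S G" unfolding S by (rule has_weak_gradientD(2)[OF u C])
    then have "integrable (lebesgue_on S) G"
      using compact_sets_lebesgue[OF C(1)[of n]] by (simp add: set_integrable_def integrable_restrict_space S)
    then have "G \<in> borel_measurable (lebesgue_on S)" by simp
    moreover have "restrict_space (lebesgue_on \<Omega>) S = lebesgue_on S"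
      using C(2)[of n] \<Omega> S by (simp add: restrict_restrict_space compact_sets_lebesgue C(1) Int_absorb1)
    ultimately show "G \<in> borel_measurable (restrict_space (lebesgue_on \<Omega>) S)" by simp
    show "S \<inter> space (lebesgue_on \<Omega>) \<in> sets (lebesgue_on \<Omega>)"
      using C[of n] \<Omega> S by (auto simp: sets_restrict_space_iff Int_absorb2)
  qed (use un in auto)
qed

text \<open>Any explicitly known weak gradient makes the choice in \<open>weak_gradient\<close>
  legitimate and identifies the chosen one up to a null set.\<close>

lemma weak_gradient_AE:
  assumes "open \<Omega>" "has_weak_gradient \<Omega> u G"
  shows "has_weak_gradient \<Omega> u (weak_gradient \<Omega> u)"
    and "AE x in lebesgue_on \<Omega>. weak_gradient \<Omega> u x = G x"
proof -
  show "has_weak_gradient \<Omega> u (weak_gradient \<Omega> u)"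
    unfolding weak_gradient_def by (rule someI[of "has_weak_gradient \<Omega> u", OF assms(2)])
  then show "AE x in lebesgue_on \<Omega>. weak_gradient \<Omega> u x = G x"
    by (rule weak_gradient_unique[OF \<open>open \<Omega>\<close> _ assms(2)])
qed

text \<open>The bound \<open>P\<close> yields constants such as \<open>2 powr P\<close> that are
  uniform in the point; nonnegativity of \<open>p x\<close> makes the power monotone on nonnegative
  bases.\<close>

locale variable_exponent =
  fixes \<Omega> :: "'a::euclidean_space set" and p :: "'a \<Rightarrow> real" and P :: real
  assumes open_\<Omega>: "open \<Omega>" and bounded_\<Omega>: "bounded \<Omega>"
    and p_measurable [measurable]: "p \<in> borel_measurable (lebesgue_on \<Omega>)"
    and p_bounds: "\<And>x. x \<in> \<Omega> \<Longrightarrow> 0 \<le> p x \<and> p x \<le> P"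
begin

lemma \<Omega>_sets: "\<Omega> \<in> sets lebesgue"
  using open_\<Omega> by auto

lemma finite_lebesgue_on: "finite_measure (lebesgue_on \<Omega>)"
  by (intro finite_measure_lebesgue_on bounded_set_imp_lmeasurable bounded_\<Omega> \<Omega>_sets)

lemma integrable_bounded:
  fixes u :: "'a \<Rightarrow> real"
  assumes "u \<in> borel_measurable (lebesgue_on \<Omega>)" "AE x in lebesgue_on \<Omega>. \<bar>u x\<bar> \<le> B"
  shows "integrable (lebesgue_on \<Omega>) u"
  using finite_measure.integrable_const_bound[OF finite_lebesgue_on, of u B] assms by simp

lemma Lvar_measurable: "u \<in> Lvar \<Omega> p \<Longrightarrow> u \<in> borel_measurable (lebesgue_on \<Omega>)"
  by (simp add: Lvar_def)

text \<open>A sum is at most twice the maximum, and the power of the maximum is at most the sum of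
  the powers. Two dominating functions are allowed so that differences are covered; for a single one
  the other is 0.\<close>

lemma Lvar_dominated:
  assumes u: "u \<in> Lvar \<Omega> p" and v: "v \<in> Lvar \<Omega> p" and w: "w \<in> borel_measurable (lebesgue_on \<Omega>)"
    and dom: "AE x in lebesgue_on \<Omega>. \<bar>w x\<bar> \<le> \<bar>u x\<bar> + \<bar>v x\<bar>"
  shows "w \<in> Lvar \<Omega> p"
proof -
  note [measurable] = Lvar_measurable[OF u] Lvar_measurable[OF v] w
  have "integrable (lebesgue_on \<Omega>) (\<lambda>x. 2 powr P * (\<bar>u x\<bar> powr p x + \<bar>v x\<bar> powr p x))"
    using u v by (simp add: Lvar_def)
  then have "integrable (lebesgue_on \<Omega>) (\<lambda>x. \<bar>w x\<bar> powr p x)"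
  proof (rule Bochner_Integration.integrable_bound)
    show "AE x in lebesgue_on \<Omega>. norm (\<bar>w x\<bar> powr p x)
        \<le> norm (2 powr P * (\<bar>u x\<bar> powr p x + \<bar>v x\<bar> powr p x))"
      using dom AE_space
    proof eventually_elim
      case (elim x)
      then have p: "0 \<le> p x" "p x \<le> P" using p_bounds by auto
      let ?m = "max \<bar>u x\<bar> \<bar>v x\<bar>"
      have "\<bar>w x\<bar> powr p x \<le> (2 * ?m) powr p x"
        using elim(1) p by (intro powr_mono2) auto
      also have "\<dots> = 2 powr p x * ?m powr p x" by (rule powr_mult)
      also have "\<dots> \<le> 2 powr P * (\<bar>u x\<bar> powr p x + \<bar>v x\<bar> powr p x)"
        using p by (intro mult_mono powr_mono) (auto simp: max_def)
      finally show ?case by simp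
    qed
  qed measurable
  then show ?thesis using w by (simp add: Lvar_def)
qed

lemma Lvar_const: "(\<lambda>_. c) \<in> Lvar \<Omega> p"
proof -
  have "integrable (lebesgue_on \<Omega>) (\<lambda>x. \<bar>c\<bar> powr p x)"
  proof (rule integrable_bounded)
    show "AE x in lebesgue_on \<Omega>. \<bar>\<bar>c\<bar> powr p x\<bar> \<le> (max 1 \<bar>c\<bar>) powr P"
    proof (rule AE_I2)
      fix x assume "x \<in> space (lebesgue_on \<Omega>)"
      then have p: "0 \<le> p x" "p x \<le> P" using p_bounds by auto
      have "\<bar>c\<bar> powr p x \<le> (max 1 \<bar>c\<bar>) powr p x" using p by (intro powr_mono2) auto
      also have "\<dots> \<le> (max 1 \<bar>c\<bar>) powr P" using p by (intro powr_mono) auto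
      finally show "\<bar>\<bar>c\<bar> powr p x\<bar> \<le> (max 1 \<bar>c\<bar>) powr P" by simp
    qed
  qed measurable
  then show ?thesis by (simp add: Lvar_def)
qed

lemma W1varD:
  assumes "u \<in> W1var \<Omega> p"
  shows "u \<in> Lvar \<Omega> p" "has_weak_gradient \<Omega> u (weak_gradient \<Omega> u)"
    "(\<lambda>x. norm (weak_gradient \<Omega> u x)) \<in> Lvar \<Omega> p"
    "u \<in> borel_measurable (lebesgue_on \<Omega>)"
    "weak_gradient \<Omega> u \<in> borel_measurable (lebesgue_on \<Omega>)"
  using assms has_weak_gradient_measurable[OF open_\<Omega>] by (auto simp: W1var_def Lvar_def)

lemma W1varI:
  assumes "u \<in> Lvar \<Omega> p" and G: "has_weak_gradient \<Omega> u G"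
    and "v \<in> Lvar \<Omega> p" "w \<in> Lvar \<Omega> p" "\<And>x. norm (G x) \<le> \<bar>v x\<bar> + \<bar>w x\<bar>"
  shows "u \<in> W1var \<Omega> p" "AE x in lebesgue_on \<Omega>. weak_gradient \<Omega> u x = G x"
proof -
  note wg = weak_gradient_AE[OF open_\<Omega> G]
  show "AE x in lebesgue_on \<Omega>. weak_gradient \<Omega> u x = G x" by (rule wg(2))
  have "AE x in lebesgue_on \<Omega>. \<bar>norm (weak_gradient \<Omega> u x)\<bar> \<le> \<bar>v x\<bar> + \<bar>w x\<bar>"
    using wg(2) by eventually_elim (simp add: assms(5))
  moreover have "(\<lambda>x. norm (weak_gradient \<Omega> u x)) \<in> borel_measurable (lebesgue_on \<Omega>)"
    using has_weak_gradient_measurable[OF open_\<Omega> wg(1)] by measurable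
  ultimately have "(\<lambda>x. norm (weak_gradient \<Omega> u x)) \<in> Lvar \<Omega> p"
    using Lvar_dominated[OF assms(3,4)] by blast
  with assms(1) wg(1) show "u \<in> W1var \<Omega> p" by (simp add: W1var_def)
qed

lemma W1var_diff:
  assumes u: "u \<in> W1var \<Omega> p" and v: "v \<in> W1var \<Omega> p"
  shows "(\<lambda>x. u x - v x) \<in> W1var \<Omega> p"
    "AE x in lebesgue_on \<Omega>. weak_gradient \<Omega> (\<lambda>x. u x - v x) x = weak_gradient \<Omega> u x - weak_gradient \<Omega> v x"
proof -
  have "(\<lambda>x. u x - v x) \<in> Lvar \<Omega> p"
    using W1varD(4)[OF u] W1varD(4)[OF v]
    by (intro Lvar_dominated[OF W1varD(1)[OF u] W1varD(1)[OF v]]) (auto intro: abs_triangle_ineq4)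
  note W = W1varI[OF this has_weak_gradient_diff[OF open_\<Omega> W1varD(2)[OF u] W1varD(2)[OF v]]
      W1varD(3)[OF u] W1varD(3)[OF v]]
  show "(\<lambda>x. u x - v x) \<in> W1var \<Omega> p"
    by (rule W(1)) (simp add: norm_triangle_ineq4)
  show "AE x in lebesgue_on \<Omega>. weak_gradient \<Omega> (\<lambda>x. u x - v x) x = weak_gradient \<Omega> u x - weak_gradient \<Omega> v x"
    by (rule W(2)) (simp add: norm_triangle_ineq4)
qed

lemma W1var_const:
  "(\<lambda>_. c) \<in> W1var \<Omega> p" "AE x in lebesgue_on \<Omega>. weak_gradient \<Omega> (\<lambda>_. c) x = 0"
  using W1varI[OF Lvar_const has_weak_gradient_const[OF open_\<Omega>] Lvar_const[of 0] Lvar_const[of 0]]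
  by auto

lemma W1var_compose:
  assumes u: "u \<in> W1var \<Omega> p"
    and F: "\<And>s. (F has_real_derivative F' s) (at s)" and L: "\<And>s. \<bar>F' s\<bar> \<le> 1"
    and F': "F' \<in> borel_measurable borel" and "F 0 = 0"
  shows "(\<lambda>x. F (u x)) \<in> W1var \<Omega> p"
    "AE x in lebesgue_on \<Omega>. weak_gradient \<Omega> (\<lambda>x. F (u x)) x = F' (u x) *\<^sub>R weak_gradient \<Omega> u x"
proof -
  note [measurable] = DERIV_everywhere_borel_measurable[OF F] F' W1varD(4)[OF u]
  have F_le: "\<bar>F a\<bar> \<le> \<bar>a\<bar>" for a
    using field_differentiable_bound[of UNIV F F' 1 a 0] F L \<open>F 0 = 0\<close> by simp
  have "(\<lambda>x. F (u x)) \<in> Lvar \<Omega> p"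
    by (rule Lvar_dominated[OF W1varD(1)[OF u] Lvar_const[of 0]]) (simp_all add: F_le)
  note W = W1varI[OF this has_weak_gradient_compose[OF open_\<Omega> W1varD(2)[OF u] F L F' \<open>F 0 = 0\<close>]
      W1varD(3)[OF u] Lvar_const[of 0]]
  have "norm (F' (u x) *\<^sub>R weak_gradient \<Omega> u x) \<le> \<bar>norm (weak_gradient \<Omega> u x)\<bar> + \<bar>0\<bar>" for x
    using L[of "u x"] by (simp add: mult_left_le_one_le)
  then show "(\<lambda>x. F (u x)) \<in> W1var \<Omega> p"
    "AE x in lebesgue_on \<Omega>. weak_gradient \<Omega> (\<lambda>x. F (u x)) x = F' (u x) *\<^sub>R weak_gradient \<Omega> u x"
    using W by blast+
qed

end

section \<open>Continuity and boundedness of the exponent\<close>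

lemma log_Hoelder_imp_continuous_on:
  assumes "log_Hoelder_on S p"
  shows "continuous_on S p"
  unfolding continuous_on_iff
proof (intro ballI allI impI)
  fix x and \<epsilon> :: real assume x: "x \<in> S" and \<epsilon>: "0 < \<epsilon>"
  obtain C where C: "0 < C"
    "\<And>x y. x \<in> S \<Longrightarrow> y \<in> S \<Longrightarrow> 0 < dist x y \<Longrightarrow> dist x y \<le> 1/2 \<Longrightarrow> \<bar>p x - p y\<bar> \<le> C / (- ln (dist x y))"
    using assms unfolding log_Hoelder_on_def by blast
  \<comment> \<open>The exponential is the distance at which the modulus C / (- ln d) equals
    \<epsilon>; 1/2 keeps within the range where the log-Hoelder bound is stated.\<close>
  define d where "d = min (1/2) (exp (- (C / \<epsilon>)))"
  have "dist (p y) (p x) < \<epsilon>" if y: "y \<in> S" "dist y x < d" for y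
  proof (cases "y = x")
    case False
    then have pos: "0 < dist x y" by simp
    have d: "dist x y \<le> 1/2" "dist x y < exp (- (C / \<epsilon>))" using y by (auto simp: d_def dist_commute)
    have "ln (dist x y) < - (C / \<epsilon>)" using ln_less_cancel_iff[of "dist x y" "exp (- (C / \<epsilon>))"] pos d(2) by simp
    then have "C / \<epsilon> < - ln (dist x y)" by simp
    moreover from this have "0 < - ln (dist x y)" using C(1) \<epsilon> by (meson divide_pos_pos less_trans)
    ultimately have "C / (- ln (dist x y)) < \<epsilon>"
      using \<epsilon> by (simp only: pos_divide_less_eq mult.commute)
    with C(2)[OF x y(1) pos d(1)] show ?thesis by (simp add: dist_real_def abs_minus_commute)
  qed (use \<epsilon> in simp)
  then show "\<exists>d>0. \<forall>y\<in>S. dist y x < d \<longrightarrow> dist (p y) (p x) < \<epsilon>"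
    by (intro exI[of _ d]) (auto simp: d_def)
qed

lemma variable_exponent_admissible:
  assumes "open \<Omega>" "bounded \<Omega>" "admissible_exponent \<Omega> p"
  obtains P where "variable_exponent \<Omega> p P"
proof -
  have c: "continuous_on (closure \<Omega>) p" and p1: "\<And>x. x \<in> closure \<Omega> \<Longrightarrow> 1 < p x"
    using assms(3) log_Hoelder_imp_continuous_on unfolding admissible_exponent_def Let_def by blast+
  have "compact (closure \<Omega>)" using \<open>bounded \<Omega>\<close> by simp
  from compact_imp_bounded[OF compact_continuous_image[OF c this]]
  obtain P where P: "\<And>x. x \<in> closure \<Omega> \<Longrightarrow> \<bar>p x\<bar> \<le> P" unfolding bounded_iff by auto
  have "variable_exponent \<Omega> p P"
  proof
    show "p \<in> borel_measurable (lebesgue_on \<Omega>)"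
      using continuous_on_subset[OF c closure_subset] \<open>open \<Omega>\<close>
      by (intro continuous_imp_measurable_on_sets_lebesgue) auto
    show "0 \<le> p x \<and> p x \<le> P" if "x \<in> \<Omega>" for x
      using p1[of x] P[of x] closure_subset that by fastforce
  qed fact+
  then show ?thesis by (rule that)
qed

section \<open>A smooth substitute for the positive part\<close>

text \<open>Squaring the positive part removes its corner at 0, and the logarithm then bounds the
  derivative: 2s / (1 + s^2) \<le> 1. Hence composition needs no bound on the argument.\<close>

definition pos_test :: "real \<Rightarrow> real" where
  "pos_test s = ln (1 + (max 0 s)\<^sup>2)"

definition pos_test_deriv :: "real \<Rightarrow> real" where
  "pos_test_deriv s = 2 * max 0 s / (1 + (max 0 s)\<^sup>2)"

lemma max_square_has_derivative: "((\<lambda>s::real. (max 0 s)\<^sup>2) has_real_derivative 2 * max 0 s) (at s)"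
proof -
  consider "s < 0" | "s = 0" | "0 < s" by linarith
  then show ?thesis
  proof cases
    case 1
    have "((\<lambda>s::real. (max 0 s)\<^sup>2) has_real_derivative 0) (at s)"
      by (rule has_field_derivative_transform_within_open[OF DERIV_const[of 0], of "{..<0}"])
         (use 1 in auto)
    then show ?thesis using 1 by simp
  next
    case 2
    have "((\<lambda>h::real. (max 0 h)\<^sup>2 / h) \<longlongrightarrow> 0) (at 0)"
    proof (rule Lim_null_comparison)
      show "\<forall>\<^sub>F h::real in at 0. norm ((max 0 h)\<^sup>2 / h) \<le> \<bar>h\<bar>"
        by (rule always_eventually) (auto simp: max_def power2_eq_square)
      show "((\<lambda>h::real. \<bar>h\<bar>) \<longlongrightarrow> 0) (at 0)" by (rule tendsto_rabs_zero) simp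
    qed
    then show ?thesis using 2 by (simp add: DERIV_def)
  next
    case 3
    have "((\<lambda>s::real. s\<^sup>2) has_real_derivative 2 * s) (at s)"
      by (auto intro!: derivative_eq_intros)
    then have "((\<lambda>s::real. (max 0 s)\<^sup>2) has_real_derivative 2 * s) (at s)"
      by (rule has_field_derivative_transform_within_open[of _ _ _ "{0<..}"]) (use 3 in auto)
    then show ?thesis using 3 by simp
  qed
qed

lemma pos_test_has_derivative: "(pos_test has_real_derivative pos_test_deriv s) (at s)"
proof -
  have "((\<lambda>s. 1 + (max 0 s)\<^sup>2) has_real_derivative 2 * max 0 s) (at s)"
    using DERIV_add[OF DERIV_const max_square_has_derivative] by simp
  then have "((\<lambda>s. ln (1 + (max 0 s)\<^sup>2)) has_real_derivative 1 / (1 + (max 0 s)\<^sup>2) * (2 * max 0 s)) (at s)"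
    by (rule DERIV_chain2[rotated]) (intro DERIV_ln_divide add_pos_nonneg, auto)
  then show ?thesis by (simp add: pos_test_def[abs_def] pos_test_deriv_def)
qed

lemma pos_test_deriv_bounds: "0 \<le> pos_test_deriv s" "\<bar>pos_test_deriv s\<bar> \<le> 1"
proof -
  have pos: "0 < 1 + (max 0 s)\<^sup>2" by (intro add_pos_nonneg) auto
  then show "0 \<le> pos_test_deriv s" unfolding pos_test_deriv_def by (intro divide_nonneg_pos) auto
  moreover have "2 * max 0 s \<le> 1 + (max 0 s)\<^sup>2"
    using zero_le_power2[of "max 0 s - 1"] by (simp add: power2_diff)
  then have "pos_test_deriv s \<le> 1" using pos unfolding pos_test_deriv_def by simp
  ultimately show "\<bar>pos_test_deriv s\<bar> \<le> 1" by simp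
qed

lemma pos_test_deriv_measurable: "pos_test_deriv \<in> borel_measurable borel"
  unfolding pos_test_deriv_def[abs_def] by measurable

lemma pos_test_pos: "0 < s \<Longrightarrow> 0 < pos_test s"
  by (simp add: pos_test_def ln_gt_zero)

lemma pos_test_eq_0: "s \<le> 0 \<Longrightarrow> pos_test s = 0"
  by (simp add: pos_test_def)

section \<open>Monotonicity of the operator\<close>

text \<open>Cauchy-Schwarz reduces the vector inequality to a scalar one: the inner product is at
  least the product of the increments of \<open>c \<xi> * norm \<xi>\<close> and of
  \<open>norm \<xi>\<close>, which have the same sign. The factor \<open>c\<close> is set to 0 at
  the origin, so both branches of \<open>a_field\<close> have the form
  \<open>c \<xi> *\<^sub>R \<xi>\<close>.\<close>

lemma a_field_monotone:
  assumes pos: "\<And>s. 0 < s \<Longrightarrow> 0 < \<Psi> x s" and mono: "strict_mono_on {0<..} (\<lambda>s. \<Psi> x s * s)"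
  shows "0 \<le> (a_field \<Psi> x \<xi> - a_field \<Psi> x \<eta>) \<bullet> (\<xi> - \<eta>)"
proof -
  define c where "c \<xi> = (if \<xi> = 0 then 0 else \<Psi> x (norm \<xi>))" for \<xi> :: 'a
  have a: "a_field \<Psi> x \<xi> = c \<xi> *\<^sub>R \<xi>" for \<xi> by (simp add: a_field_def c_def)
  have c_nonneg: "0 \<le> c \<xi>" for \<xi> using pos[of "norm \<xi>"] by (simp add: c_def less_imp_le)
  have c_mono: "c \<xi> * norm \<xi> \<le> c \<eta> * norm \<eta>" if "norm \<xi> \<le> norm \<eta>" for \<xi> \<eta>
  proof (cases "\<xi> = 0 \<or> norm \<xi> = norm \<eta>")
    case True
    then show ?thesis
      using mult_nonneg_nonneg[OF c_nonneg[of \<eta>] norm_ge_zero[of \<eta>]] by (auto simp: c_def)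
  next
    case False
    then have "0 < norm \<xi>" "norm \<xi> < norm \<eta>" using that by auto
    then show ?thesis using strict_mono_onD[OF mono, of "norm \<xi>" "norm \<eta>"] by (auto simp: c_def)
  qed
  have "0 \<le> (c \<xi> * norm \<xi> - c \<eta> * norm \<eta>) * (norm \<xi> - norm \<eta>)"
    using c_mono[of \<xi> \<eta>] c_mono[of \<eta> \<xi>] by (cases "norm \<xi> \<le> norm \<eta>") (auto simp: mult_nonneg_nonneg mult_nonpos_nonpos)
  also have "\<dots> = c \<xi> * (norm \<xi>)\<^sup>2 + c \<eta> * (norm \<eta>)\<^sup>2 - (c \<xi> + c \<eta>) * (norm \<xi> * norm \<eta>)"
    by (simp add: algebra_simps power2_eq_square)
  also have "\<dots> \<le> c \<xi> * (norm \<xi>)\<^sup>2 + c \<eta> * (norm \<eta>)\<^sup>2 - (c \<xi> + c \<eta>) * (\<xi> \<bullet> \<eta>)"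
    using mult_left_mono[OF norm_cauchy_schwarz[of \<xi> \<eta>], of "c \<xi> + c \<eta>"] c_nonneg by simp
  also have "\<dots> = (a_field \<Psi> x \<xi> - a_field \<Psi> x \<eta>) \<bullet> (\<xi> - \<eta>)"
    by (simp add: a inner_diff_left inner_diff_right inner_commute power2_norm_eq_inner algebra_simps)
  finally show ?thesis .
qed

lemma b_bar_strict_mono:
  assumes "0 \<le> \<delta>0" and mono: "strict_mono_on {0..\<delta>0} (b x)" and "s < t"
  shows "b_bar \<delta>0 b x s < b_bar \<delta>0 b x t"
proof -
  have le: "b x u \<le> b x v" if "0 \<le> u" "u \<le> v" "v \<le> \<delta>0" for u v
    using strict_mono_on_leD[OF mono, of u v] that by simp
  have "b x u < b x v" if "0 \<le> u" "u < v" "v \<le> \<delta>0" for u v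
    using strict_mono_onD[OF mono, of u v] that by simp
  then show ?thesis
    using \<open>s < t\<close> \<open>0 \<le> \<delta>0\<close> le[of 0 t] le[of s \<delta>0] le[of 0 \<delta>0] by (auto simp: b_bar_def) 
qed

text \<open>As long as \<open>v n\<close> is at least \<open>r\<close> away from \<open>w\<close>,
  monotonicity makes \<beta> differ from its value at \<open>w\<close> by at least \<open>m\<close>,
  the smaller of its increments over steps of length \<open>r\<close> to either side. The product is
  then at least \<open>m * r\<close>.\<close>

lemma tendsto_from_monotone_product:
  fixes \<beta> :: "real \<Rightarrow> real"
  assumes mono: "strict_mono \<beta>" and lim: "(\<lambda>n. (\<beta> (v n) - \<beta> w) * (v n - w)) \<longlonglongrightarrow> 0"
  shows "v \<longlonglongrightarrow> w"
proof (rule LIMSEQ_I)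
  fix r :: real assume r: "0 < r"
  define m where "m = min (\<beta> (w + r) - \<beta> w) (\<beta> w - \<beta> (w - r))"
  have m: "0 < m" using strict_monoD[OF mono, of w "w + r"] strict_monoD[OF mono, of "w - r" w] r
    by (simp add: m_def)
  from LIMSEQ_D[OF lim, of "m * r"] m r obtain N where
    N: "\<And>n. n \<ge> N \<Longrightarrow> \<bar>(\<beta> (v n) - \<beta> w) * (v n - w)\<bar> < m * r" by auto
  have "\<bar>v n - w\<bar> < r" if "n \<ge> N" for n
  proof (rule ccontr)
    assume "\<not> \<bar>v n - w\<bar> < r"
    then have far: "r \<le> \<bar>v n - w\<bar>" by simp
    have "m \<le> \<bar>\<beta> (v n) - \<beta> w\<bar>"
    proof (cases "w \<le> v n")
      case True
      with far have "w + r \<le> v n" by simp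
      then have "\<beta> (w + r) \<le> \<beta> (v n)" using mono by (simp add: strict_mono_less_eq)
      then show ?thesis by (simp add: m_def)
    next
      case False
      with far have "v n \<le> w - r" by simp
      then have "\<beta> (v n) \<le> \<beta> (w - r)" using mono by (simp add: strict_mono_less_eq)
      then show ?thesis by (simp add: m_def)
    qed
    then have "m * r \<le> \<bar>\<beta> (v n) - \<beta> w\<bar> * \<bar>v n - w\<bar>" using far m r by (intro mult_mono) auto
    with N[OF that] show False by (simp add: abs_mult)
  qed
  then show "\<exists>N. \<forall>n\<ge>N. norm (v n - w) < r" by auto
qed

lemma tendsto_0_by_subsequences:
  fixes d :: "nat \<Rightarrow> real"
  assumes "\<And>\<sigma> :: nat \<Rightarrow> nat. strict_mono \<sigma> \<Longrightarrow> \<exists>\<rho> :: nat \<Rightarrow> nat. strict_mono \<rho> \<and> (\<lambda>n. d (\<sigma> (\<rho> n))) \<longlonglongrightarrow> 0"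
  shows "d \<longlonglongrightarrow> 0"
proof (rule ccontr)
  assume "\<not> d \<longlonglongrightarrow> 0"
  then obtain r where r: "0 < r" "\<And>N. \<exists>n\<ge>N. r \<le> \<bar>d n\<bar>" unfolding LIMSEQ_iff by force
  then have "infinite {n. r \<le> \<bar>d n\<bar>}" unfolding infinite_nat_iff_unbounded_le by blast
  then obtain \<sigma> :: "nat \<Rightarrow> nat" where \<sigma>: "strict_mono \<sigma>" "\<And>n. r \<le> \<bar>d (\<sigma> n)\<bar>"
    using infinite_enumerate by blast
  obtain \<rho> where "(\<lambda>n. d (\<sigma> (\<rho> n))) \<longlonglongrightarrow> 0" using assms[OF \<sigma>(1)] by blast
  from LIMSEQ_D[OF this r(1)] obtain n where "\<bar>d (\<sigma> (\<rho> n))\<bar> < r" by auto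
  with \<sigma>(2)[of "\<rho> n"] show False by simp
qed

section \<open>The solution operator\<close>

locale solution_operator_setting = variable_exponent \<Omega> p P
  for \<Omega> :: "'a::euclidean_space set" and p P +
  fixes \<Psi> b f :: "'a \<Rightarrow> real \<Rightarrow> real" and \<delta>0 lam0 :: real and K :: "('a \<Rightarrow> real) \<Rightarrow> 'a \<Rightarrow> real"
  assumes Psi: "admissible_Psi \<Omega> p \<Psi>"
    and \<delta>0: "0 < \<delta>0" and lam0: "0 < lam0"
    and b: "admissible_b \<Omega> \<delta>0 b" and f: "admissible_f \<Omega> \<delta>0 lam0 b f"
    and K: "solution_operator \<Omega> p \<Psi> \<delta>0 lam0 b f K"
begin

abbreviation "M \<equiv> lebesgue_on \<Omega>"
abbreviation "\<U> \<equiv> order_interval \<Omega> \<delta>0"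
abbreviation "grad u \<equiv> weak_gradient \<Omega> u"
abbreviation "B x s \<equiv> b_bar \<delta>0 b x s"

text \<open>The right-hand side of the equation. The shift by \<open>lam0 * b\<close> makes it
  increasing in \<open>s\<close>, though \<open>f\<close> itself need not be.\<close>

definition g :: "'a \<Rightarrow> real \<Rightarrow> real" where "g x s = f x s + lam0 * b x s"

definition flux :: "('a \<Rightarrow> real) \<Rightarrow> 'a \<Rightarrow> 'a" where "flux V x = a_field \<Psi> x (grad V x)"

text \<open>The vectors are quantified inside, so the exceptional null set does not depend on the
  gradients inserted later.\<close>

lemma flux_monotone:
  "AE x in M. \<forall>\<xi> \<eta>. 0 \<le> (a_field \<Psi> x \<xi> - a_field \<Psi> x \<eta>) \<bullet> (\<xi> - \<eta>)"
proof -
  have "AE x in M. strict_mono_on {0<..} (\<lambda>s. \<Psi> x s * s)"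
    using Psi unfolding admissible_Psi_def by (auto elim: eventually_mono)
  then show ?thesis
    using AE_space
  proof eventually_elim
    case (elim x)
    then have "x \<in> closure \<Omega>" using closure_subset by auto
    then have "0 < \<Psi> x s" if "0 < s" for s using Psi that unfolding admissible_Psi_def by blast
    then show ?case using elim(1) by (intro allI a_field_monotone)
  qed
qed

lemma B_strict_mono: "AE x in M. strict_mono (b_bar \<delta>0 b x)"
proof -
  have "AE x in M. strict_mono_on {0..\<delta>0} (b x)" using b unfolding admissible_b_def by blast
  then show ?thesis
    by eventually_elim (use \<delta>0 in \<open>auto intro!: strict_monoI b_bar_strict_mono\<close>)
qed

lemma B_eq: "s \<in> {0..\<delta>0} \<Longrightarrow> B x s = b x s"
  by (simp add: b_bar_def)

lemma g_strict_mono: "AE x in M. strict_mono_on {0..\<delta>0} (g x)"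
  using f unfolding admissible_f_def g_def[abs_def] by blast

lemma U_range: "U \<in> \<U> \<Longrightarrow> AE x in M. U x \<in> {0..\<delta>0}"
  by (simp add: order_interval_def)

lemma U_measurable: "U \<in> \<U> \<Longrightarrow> U \<in> borel_measurable M"
  by (simp add: order_interval_def)

lemma const_order_interval: "c \<in> {0..\<delta>0} \<Longrightarrow> (\<lambda>_. c) \<in> \<U>"
  by (simp add: order_interval_def)

lemma K_W1var: "U \<in> \<U> \<Longrightarrow> K U \<in> W1var \<Omega> p"
  using K unfolding solution_operator_def weak_solution_def by blast

lemma K_equation:
  assumes "U \<in> \<U>" "\<phi> \<in> W1var \<Omega> p"
  shows "integrable M (\<lambda>x. flux (K U) x \<bullet> grad \<phi> x)" "integrable M (\<lambda>x. B x (K U x) * \<phi> x)"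
    "integrable M (\<lambda>x. g x (U x) * \<phi> x)"
    "(\<integral>x. flux (K U) x \<bullet> grad \<phi> x \<partial>M) + lam0 * (\<integral>x. B x (K U x) * \<phi> x \<partial>M) = (\<integral>x. g x (U x) * \<phi> x \<partial>M)"
  using K assms unfolding solution_operator_def weak_solution_def flux_def g_def by blast+

text \<open>Minus the divergence of the flux of \<open>K U\<close>, in the weak sense. All zero
  order terms are gathered here to give the equation the two-sided shape used by the comparison
  argument.\<close>

definition residual :: "('a \<Rightarrow> real) \<Rightarrow> 'a \<Rightarrow> real" where
  "residual U x = g x (U x) - lam0 * B x (K U x)"

lemma K_residual:
  assumes "U \<in> \<U>" "\<phi> \<in> W1var \<Omega> p"
  shows "integrable M (\<lambda>x. residual U x * \<phi> x)"
    "(\<integral>x. flux (K U) x \<bullet> grad \<phi> x \<partial>M) = (\<integral>x. residual U x * \<phi> x \<partial>M)"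
proof -
  note E = K_equation[OF assms]
  have eq: "residual U x * \<phi> x = g x (U x) * \<phi> x - lam0 * (B x (K U x) * \<phi> x)" for x
    by (simp add: residual_def algebra_simps)
  show "integrable M (\<lambda>x. residual U x * \<phi> x)" unfolding eq using E(2,3) by simp
  show "(\<integral>x. flux (K U) x \<bullet> grad \<phi> x \<partial>M) = (\<integral>x. residual U x * \<phi> x \<partial>M)"
    unfolding eq using E by simp
qed

text \<open>Using \<open>pos_test\<close> in place of the positive part makes the \<open>C\<^sup>1\<close> chain rule sufficient.\<close>

lemma comparison:
  assumes w: "w \<in> W1var \<Omega> p"
    and int: "\<And>\<phi>. \<phi> \<in> W1var \<Omega> p \<Longrightarrow> integrable M (\<lambda>x. A x \<bullet> grad \<phi> x)"
      "\<And>\<phi>. \<phi> \<in> W1var \<Omega> p \<Longrightarrow> integrable M (\<lambda>x. r x * \<phi> x)"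
    and eq: "\<And>\<phi>. \<phi> \<in> W1var \<Omega> p \<Longrightarrow> (\<integral>x. A x \<bullet> grad \<phi> x \<partial>M) = (\<integral>x. r x * \<phi> x \<partial>M)"
    and A: "AE x in M. 0 \<le> A x \<bullet> grad w x"
    and r: "AE x in M. 0 < w x \<longrightarrow> r x < 0"
  shows "AE x in M. w x \<le> 0"
proof -
  let ?\<phi> = "\<lambda>x. pos_test (w x)"
  note W = W1var_compose[OF w pos_test_has_derivative pos_test_deriv_bounds(2) pos_test_deriv_measurable
      pos_test_eq_0[OF order_refl]]
  \<comment> \<open>By the chain rule the gradient of the test function is a nonnegative multiple of
    that of \<open>w\<close>, so the sign of the flux term survives.\<close>
  have "AE x in M. 0 \<le> A x \<bullet> grad ?\<phi> x"
    using A W(2) by eventually_elim (simp add: pos_test_deriv_bounds(1))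
  then have "0 \<le> (\<integral>x. A x \<bullet> grad ?\<phi> x \<partial>M)" by (rule integral_nonneg_AE)
  also have "\<dots> = (\<integral>x. r x * ?\<phi> x \<partial>M)" by (rule eq[OF W(1)])
  finally have "(\<integral>x. - (r x * ?\<phi> x) \<partial>M) \<le> 0" by simp
  \<comment> \<open>The integrand has a sign and an integral of the opposite sign, so it vanishes
    almost everywhere. Where \<open>w\<close> is positive both of its factors are nonzero, hence
    such points form a null set.\<close>
  have nonneg: "AE x in M. 0 \<le> - (r x * ?\<phi> x)"
    using r
  proof eventually_elim
    case (elim x)
    then show ?case
      using pos_test_pos[of "w x"] pos_test_eq_0[of "w x"]
      by (cases "0 < w x") (auto simp: mult_le_0_iff)
  qed
  moreover have "0 \<le> (\<integral>x. - (r x * ?\<phi> x) \<partial>M)" using nonneg by (rule integral_nonneg_AE)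
  moreover have "integrable M (\<lambda>x. - (r x * ?\<phi> x))" using int(2)[OF W(1)] by simp
  ultimately have "AE x in M. - (r x * ?\<phi> x) = 0"
    using \<open>(\<integral>x. - (r x * ?\<phi> x) \<partial>M) \<le> 0\<close> integral_nonneg_eq_0_iff_AE[of M "\<lambda>x. - (r x * ?\<phi> x)"] by simp
  then show ?thesis
    using r
  proof eventually_elim
    case (elim x)
    then show ?case using pos_test_pos[of "w x"] by force
  qed
qed

section \<open>Comparison with constants and invariance of the order interval\<close>

lemma flux_grad_nonneg: "AE x in M. 0 \<le> flux V x \<bullet> grad V x"
  using flux_monotone
proof eventually_elim
  case (elim x)
  then have "0 \<le> (a_field \<Psi> x (grad V x) - a_field \<Psi> x 0) \<bullet> (grad V x - 0)" by blast
  then show ?case by (simp add: flux_def a_field_def)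
qed

text \<open>A constant has zero flux, so it is a supersolution as soon as
  \<open>lam0 * b x c\<close> dominates the right-hand side: wherever \<open>K U\<close> exceeds
  \<open>c\<close>, strict monotonicity of \<open>b_bar\<close> makes the residual negative. With
  \<open>c\<close> = \<delta>0 this yields the upper bound for \<open>K U\<close>.\<close>

lemma K_le_const:
  assumes U: "U \<in> \<U>" and c: "c \<in> {0..\<delta>0}" and le: "AE x in M. g x (U x) \<le> lam0 * b x c"
  shows "AE x in M. K U x \<le> c"
proof -
  note V = K_W1var[OF U]
  note W = W1var_diff[OF V W1var_const(1)[of c]]
  have "AE x in M. K U x - c \<le> 0"
  proof (rule comparison[OF W(1), of "flux (K U)" "residual U"])
    show "AE x in M. 0 \<le> flux (K U) x \<bullet> grad (\<lambda>x. K U x - c) x"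
      using flux_grad_nonneg W(2) W1var_const(2)[of c] by eventually_elim simp
    show "AE x in M. 0 < K U x - c \<longrightarrow> residual U x < 0"
      using B_strict_mono le
    proof eventually_elim
      case (elim x)
      show ?case
      proof
        assume "0 < K U x - c"
        then have "b x c < B x (K U x)" using strict_monoD[OF elim(1), of c "K U x"] B_eq[OF c] by simp
        then have "lam0 * b x c < lam0 * B x (K U x)" using lam0 by simp
        with elim(2) show "residual U x < 0" by (simp add: residual_def)
      qed
    qed
  qed (use K_residual[OF U] K_equation(1)[OF U] in auto)
  then show ?thesis by eventually_elim simp
qed

lemma K_ge_const:
  assumes U: "U \<in> \<U>" and c: "c \<in> {0..\<delta>0}" and ge: "AE x in M. lam0 * b x c \<le> g x (U x)"
  shows "AE x in M. c \<le> K U x"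
proof -
  note V = K_W1var[OF U]
  note W = W1var_diff[OF W1var_const(1)[of c] V]
  have "AE x in M. c - K U x \<le> 0"
  proof (rule comparison[OF W(1), of "\<lambda>x. - flux (K U) x" "\<lambda>x. - residual U x"])
    show "AE x in M. 0 \<le> - flux (K U) x \<bullet> grad (\<lambda>x. c - K U x) x"
      using flux_grad_nonneg W(2) W1var_const(2)[of c] by eventually_elim simp
    show "AE x in M. 0 < c - K U x \<longrightarrow> - residual U x < 0"
      using B_strict_mono ge
    proof eventually_elim
      case (elim x)
      show ?case
      proof
        assume "0 < c - K U x"
        then have "B x (K U x) < b x c" using strict_monoD[OF elim(1), of "K U x" c] B_eq[OF c] by simp
        then have "lam0 * B x (K U x) < lam0 * b x c" using lam0 by simp
        with elim(2) show "- residual U x < 0" by (simp add: residual_def)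
      qed
    qed
  qed (use K_residual[OF U] K_equation(1)[OF U] in auto)
  then show ?thesis by eventually_elim simp
qed

text \<open>The sign conditions on \<open>f\<close> at the end points, spread over the whole
  interval by monotonicity of \<open>g\<close>: they make 0 a subsolution and \<delta>0 a
  supersolution for every admissible right-hand side.\<close>

lemma g_bounds:
  assumes "U \<in> \<U>"
  shows "AE x in M. lam0 * b x 0 \<le> g x (U x) \<and> g x (U x) \<le> lam0 * b x \<delta>0"
proof -
  have "AE x in M. 0 \<le> f x 0 \<and> f x \<delta>0 \<le> 0" using f unfolding admissible_f_def by blast
  then show ?thesis
    using g_strict_mono U_range[OF assms]
  proof eventually_elim
    case (elim x)
    then have "g x 0 \<le> g x (U x)" "g x (U x) \<le> g x \<delta>0"
      using strict_mono_on_leD[OF elim(2)] \<delta>0 by auto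
    with elim(1) show ?case by (simp add: g_def)
  qed
qed

lemma K_order_interval:
  assumes U: "U \<in> \<U>"
  shows "K U \<in> \<U>"
proof -
  have "AE x in M. 0 \<le> K U x"
    by (rule K_ge_const[OF U]) (use \<delta>0 g_bounds[OF U] in \<open>auto elim: eventually_mono\<close>)
  moreover have "AE x in M. K U x \<le> \<delta>0"
    by (rule K_le_const[OF U]) (use \<delta>0 g_bounds[OF U] in \<open>auto elim: eventually_mono\<close>)
  ultimately show ?thesis
    using W1varD(4)[OF K_W1var[OF U]] by (simp add: order_interval_def)
qed

lemma flux_diff_nonneg: "AE x in M. 0 \<le> (flux V x - flux V' x) \<bullet> (grad V x - grad V' x)"
  using flux_monotone by eventually_elim (simp add: flux_def)

text \<open>Where \<open>K U1\<close> exceeded \<open>K U2\<close>, the term with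
  \<open>b_bar\<close> would be strictly larger and the right-hand side no larger, so the difference
  of the residuals would be negative, as comparison requires.\<close>

lemma K_mono:
  assumes U1: "U1 \<in> \<U>" and U2: "U2 \<in> \<U>" and le: "AE x in M. U1 x \<le> U2 x"
  shows "AE x in M. K U1 x \<le> K U2 x"
proof -
  note W = W1var_diff[OF K_W1var[OF U1] K_W1var[OF U2]]
  have "AE x in M. K U1 x - K U2 x \<le> 0"
  proof (rule comparison[OF W(1), of "\<lambda>x. flux (K U1) x - flux (K U2) x" "\<lambda>x. residual U1 x - residual U2 x"])
    show "AE x in M. 0 \<le> (flux (K U1) x - flux (K U2) x) \<bullet> grad (\<lambda>x. K U1 x - K U2 x) x"
      using flux_diff_nonneg[of "K U1" "K U2"] W(2) by eventually_elim simp
    show "AE x in M. 0 < K U1 x - K U2 x \<longrightarrow> residual U1 x - residual U2 x < 0"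
      using B_strict_mono g_strict_mono U_range[OF U1] U_range[OF U2] le
    proof eventually_elim
      case (elim x)
      show ?case
      proof
        assume "0 < K U1 x - K U2 x"
        then have "B x (K U2 x) < B x (K U1 x)" using strict_monoD[OF elim(1)] by simp
        then have "lam0 * B x (K U2 x) < lam0 * B x (K U1 x)" using lam0 by simp
        moreover have "g x (U1 x) \<le> g x (U2 x)" using strict_mono_on_leD[OF elim(2)] elim by blast
        ultimately show "residual U1 x - residual U2 x < 0" by (simp add: residual_def)
      qed
    qed
    fix \<phi> assume \<phi>: "\<phi> \<in> W1var \<Omega> p"
    note i1 = K_equation(1)[OF U1 \<phi>] and i2 = K_equation(1)[OF U2 \<phi>]
    note r1 = K_residual[OF U1 \<phi>] and r2 = K_residual[OF U2 \<phi>]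
    show "integrable M (\<lambda>x. (flux (K U1) x - flux (K U2) x) \<bullet> grad \<phi> x)"
      using i1 i2 by (simp add: inner_diff_left)
    show "integrable M (\<lambda>x. (residual U1 x - residual U2 x) * \<phi> x)"
      using r1(1) r2(1) by (simp add: left_diff_distrib)
    show "(\<integral>x. (flux (K U1) x - flux (K U2) x) \<bullet> grad \<phi> x \<partial>M) = (\<integral>x. (residual U1 x - residual U2 x) * \<phi> x \<partial>M)"
      using i1 i2 r1 r2 by (simp add: inner_diff_left left_diff_distrib)
  qed
  then show ?thesis by eventually_elim simp
qed

text \<open>Functions that agree almost everywhere have the same predicate of weak gradients, and
  therefore literally the same chosen gradient. This makes the flux terms cancel in the strictness
  argument.\<close>

lemma has_weak_gradient_cong_AE:
  assumes "AE x in M. u x = v x"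
    and "u \<in> borel_measurable M" "v \<in> borel_measurable M"
  shows "has_weak_gradient \<Omega> u G \<longleftrightarrow> has_weak_gradient \<Omega> v G"
proof -
  have *: "has_weak_gradient \<Omega> v G" if G: "has_weak_gradient \<Omega> u G" and eq: "AE x in M. u x = v x"
    and m: "u \<in> borel_measurable M" "v \<in> borel_measurable M" for u v
    unfolding has_weak_gradient_def
  proof (intro conjI ballI)
    have eq': "AE x in lebesgue. x \<in> \<Omega> \<longrightarrow> u x = v x"
      using eq \<Omega>_sets by (simp add: AE_restrict_space_iff)
    show "locally_integrable_on \<Omega> v"
      unfolding locally_integrable_on_def
    proof (intro allI impI)
      fix C assume C: "compact C \<and> C \<subseteq> \<Omega>"
      have uC: "integrable lebesgue (\<lambda>x. indicator C x *\<^sub>R u x)"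
        using has_weak_gradientD(1)[OF G] C by (simp add: set_integrable_def)
      have ae: "AE x in lebesgue. indicator C x *\<^sub>R u x = indicator C x *\<^sub>R v x"
        using eq' by eventually_elim (use C in \<open>auto split: split_indicator\<close>)
      have "(\<lambda>x. indicator C x *\<^sub>R v x) \<in> borel_measurable lebesgue"
        by (rule borel_measurable_AE[OF borel_measurable_integrable[OF uC] ae])
      then show "set_integrable lebesgue C v"
        using integrable_cong_AE_imp[OF uC _ ae] by (simp add: set_integrable_def)
    qed
    show "locally_integrable_on \<Omega> G" using G by (simp add: has_weak_gradient_def)
    fix \<phi> i assume \<phi>: "\<phi> \<in> test_functions \<Omega>" and i: "i \<in> (Basis :: 'a set)"
    have [measurable]: "(\<lambda>x. frechet_derivative \<phi> (at x) i) \<in> borel_measurable M"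
      using test_function_lebesgue_measurable[OF frechet_derivative_test_function[OF \<phi> i]]
      by (rule measurable_restrict_space1)
    note [measurable] = m
    have "(\<integral>x. v x * frechet_derivative \<phi> (at x) i \<partial>M) = (\<integral>x. u x * frechet_derivative \<phi> (at x) i \<partial>M)"
    proof (rule integral_cong_AE)
      show "AE x in M. v x * frechet_derivative \<phi> (at x) i = u x * frechet_derivative \<phi> (at x) i"
        using eq by eventually_elim simp
    qed measurable
    then show "(\<integral>x. v x * frechet_derivative \<phi> (at x) i \<partial>M) = - (\<integral>x. (G x \<bullet> i) * \<phi> x \<partial>M)"
      using has_weak_gradient_integral[OF G \<phi> i] by simp
  qed
  have "AE x in M. v x = u x" using assms(1) by eventually_elim simp
  then show ?thesis using *[OF _ assms] *[of v u, OF _ _ assms(3,2)] by blast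
qed

text \<open>The contrapositive of strictness. Equal images cancel everything except the right-hand
  sides, whose integrals then coincide. Being ordered, they agree almost everywhere, and strict
  monotonicity of \<open>g\<close> gives back equality of the arguments.\<close>

lemma K_strict:
  assumes U1: "U1 \<in> \<U>" and U2: "U2 \<in> \<U>" and le: "AE x in M. U1 x \<le> U2 x"
    and eq: "AE x in M. K U1 x = K U2 x"
  shows "AE x in M. U1 x = U2 x"
proof -
  note one = W1var_const(1)[of 1]
  note m1 = W1varD(4)[OF K_W1var[OF U1]] and m2 = W1varD(4)[OF K_W1var[OF U2]]
  note E1 = K_equation[OF U1 one] and E2 = K_equation[OF U2 one]
  have "has_weak_gradient \<Omega> (K U1) = has_weak_gradient \<Omega> (K U2)"
    by (intro ext has_weak_gradient_cong_AE[OF eq m1 m2])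
  then have "grad (K U1) = grad (K U2)" by (simp add: weak_gradient_def)
  then have "flux (K U1) = flux (K U2)" by (simp add: flux_def[abs_def])
  moreover have "(\<integral>x. B x (K U1 x) * 1 \<partial>M) = (\<integral>x. B x (K U2 x) * 1 \<partial>M)"
  proof (rule integral_cong_AE)
    show "AE x in M. B x (K U1 x) * 1 = B x (K U2 x) * 1" using eq by eventually_elim simp
  qed (use E1(2) E2(2) in auto)
  ultimately have "(\<integral>x. g x (U1 x) \<partial>M) = (\<integral>x. g x (U2 x) \<partial>M)" using E1(4) E2(4) by simp
  then have zero: "(\<integral>x. g x (U2 x) - g x (U1 x) \<partial>M) = 0" using E1(3) E2(3) by simp
  have "AE x in M. 0 \<le> g x (U2 x) - g x (U1 x)"
    using g_strict_mono U_range[OF U1] U_range[OF U2] le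
  proof eventually_elim
    case (elim x)
    then show ?case using strict_mono_on_leD[OF elim(1), of "U1 x" "U2 x"] by simp
  qed
  then have "AE x in M. g x (U2 x) - g x (U1 x) = 0"
    using zero E1(3) E2(3) integral_nonneg_eq_0_iff_AE[of M "\<lambda>x. g x (U2 x) - g x (U1 x)"] by simp
  then show ?thesis
    using g_strict_mono U_range[OF U1] U_range[OF U2]
  proof eventually_elim
    case (elim x)
    then show ?case using strict_mono_on_eqD[OF elim(2), of "U1 x" "U2 x"] by simp
  qed
qed

section \<open>Continuity in L^2\<close>

lemma square_integrable:
  assumes U: "U \<in> \<U>" and V: "V \<in> \<U>"
  shows "AE x in M. (U x - V x)\<^sup>2 \<le> \<delta>0\<^sup>2" "(\<lambda>x. (U x - V x)\<^sup>2) \<in> borel_measurable M"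
    "integrable M (\<lambda>x. (U x - V x)\<^sup>2)"
proof -
  note [measurable] = U_measurable[OF U] U_measurable[OF V]
  show 1: "AE x in M. (U x - V x)\<^sup>2 \<le> \<delta>0\<^sup>2"
    using U_range[OF U] U_range[OF V]
  proof eventually_elim
    case (elim x)
    then have "\<bar>U x - V x\<bar> \<le> \<bar>\<delta>0\<bar>" by auto
    then show ?case by (simp only: abs_le_square_iff)
  qed
  show "(\<lambda>x. (U x - V x)\<^sup>2) \<in> borel_measurable M" by measurable
  then show "integrable M (\<lambda>x. (U x - V x)\<^sup>2)"
    by (rule integrable_bounded[where B = "\<delta>0\<^sup>2"]) (use 1 in simp)
qed

lemma b_\<delta>0_integrable: "integrable M (\<lambda>x. b x \<delta>0)"
proof -
  have m [measurable]: "(\<lambda>x. b x \<delta>0) \<in> borel_measurable M" and "integrable M (\<lambda>x. \<bar>b x \<delta>0\<bar> powr 2)"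
    using b unfolding admissible_b_def Lvar_def by auto
  then have sq: "integrable M (\<lambda>x. 1 + (b x \<delta>0)\<^sup>2)"
    using integrable_bounded[of "\<lambda>_. 1" 1] by simp
  show ?thesis
  proof (rule Bochner_Integration.integrable_bound[OF sq])
    show "AE x in M. norm (b x \<delta>0) \<le> norm (1 + (b x \<delta>0)\<^sup>2)"
    proof (rule AE_I2)
      fix x
      \<comment> \<open>The right-hand side is twice the difference of 1 + t^2 and t, for t the
        absolute value of \<open>b x \<delta>0\<close>.\<close>
      have "0 \<le> (\<bar>b x \<delta>0\<bar> - 1)\<^sup>2 + \<bar>b x \<delta>0\<bar>\<^sup>2 + 1" by simp
      then show "norm (b x \<delta>0) \<le> norm (1 + (b x \<delta>0)\<^sup>2)" by (simp add: power2_diff)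
    qed
  qed measurable
qed

text \<open>Along almost everywhere convergent data the right-hand sides converge in \<open>L\<^sup>1\<close> by dominated
  convergence. Testing with the difference of the solutions bounds the strictly monotone term by this.\<close>

lemma K_monotone_product_tendsto:
  assumes Us: "\<And>n::nat. Us n \<in> \<U>" and U: "U \<in> \<U>"
    and lim: "AE x in M. (\<lambda>n. Us n x) \<longlonglongrightarrow> U x"
  shows "integrable M (\<lambda>x. (B x (K (Us n) x) - B x (K U x)) * (K (Us n) x - K U x))"
    "(\<lambda>n. \<integral>x. \<bar>(B x (K (Us n) x) - B x (K U x)) * (K (Us n) x - K U x)\<bar> \<partial>M) \<longlonglongrightarrow> 0"
proof -
  let ?\<phi> = "\<lambda>n x. K (Us n) x - K U x"
  let ?z = "\<lambda>n x. (B x (K (Us n) x) - B x (K U x)) * ?\<phi> n x"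
  let ?h = "\<lambda>n x. (g x (Us n x) - g x (U x)) * ?\<phi> n x"
  note W = W1var_diff[OF K_W1var[OF Us] K_W1var[OF U]]
  note E = K_equation[OF Us W(1)] and E' = K_equation[OF U W(1)]
  show z: "integrable M (?z n)" for n using E(2) E'(2) by (simp add: left_diff_distrib)
  have h: "integrable M (?h n)" for n using E(3) E'(3) by (simp add: left_diff_distrib)
  \<comment> \<open>Nothing is known yet about convergence of the solutions; they enter only through
    their distance, at most \<delta>0. The factor with \<open>g\<close> tends to 0 pointwise and is
    at most \<open>lam0 * b x \<delta>0\<close>, since both of its terms lie between
    \<open>lam0 * b x 0\<close>, which is nonnegative, and that value.\<close>
  have h_lim: "(\<lambda>n. \<integral>x. ?h n x \<partial>M) \<longlonglongrightarrow> (\<integral>x. 0 \<partial>M)"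
  proof (rule integral_dominated_convergence[where w = "\<lambda>x. lam0 * b x \<delta>0 * \<delta>0"])
    have "AE x in M. continuous_on {0..\<delta>0} (f x)" "AE x in M. continuous_on {0..\<delta>0} (b x)"
      using f b unfolding admissible_f_def admissible_b_def Caratheodory_on_def by blast+
    then have cont: "AE x in M. continuous_on {0..\<delta>0} (g x)"
      by eventually_elim (auto simp: g_def[abs_def] intro!: continuous_intros)
    have "AE x in M. \<forall>n. Us n x \<in> {0..\<delta>0}" "AE x in M. \<forall>n. K (Us n) x \<in> {0..\<delta>0}"
      unfolding AE_all_countable using U_range Us K_order_interval by blast+
    then show "AE x in M. (\<lambda>n. ?h n x) \<longlonglongrightarrow> 0"
      using cont lim U_range[OF U] U_range[OF K_order_interval[OF U]]
    proof eventually_elim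
      case (elim x)
      have "(\<lambda>n. g x (Us n x)) \<longlonglongrightarrow> g x (U x)"
        by (rule continuous_on_tendsto_compose[OF elim(3,4,5)]) (use elim(1) in auto)
      then have "(\<lambda>n. g x (Us n x) - g x (U x)) \<longlonglongrightarrow> 0" by (rule LIM_zero)
      from tendsto_mult_left_zero[OF tendsto_rabs_zero[OF this]]
      have bound0: "(\<lambda>n. \<bar>g x (Us n x) - g x (U x)\<bar> * \<delta>0) \<longlonglongrightarrow> 0" .
      have "norm (?h n x) \<le> \<bar>g x (Us n x) - g x (U x)\<bar> * \<delta>0" for n
      proof -
        have "K (Us n) x \<in> {0..\<delta>0}" using elim(2) by blast
        with elim(6) have "\<bar>?\<phi> n x\<bar> \<le> \<delta>0" by auto
        then show ?thesis unfolding real_norm_def abs_mult by (intro mult_left_mono) auto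
      qed
      then have "\<forall>\<^sub>F n in sequentially. norm (?h n x) \<le> \<bar>g x (Us n x) - g x (U x)\<bar> * \<delta>0"
        by (rule always_eventually[OF allI])
      then show ?case using bound0 by (rule Lim_null_comparison)
    qed
    show "AE x in M. norm (?h n x) \<le> lam0 * b x \<delta>0 * \<delta>0" for n
      using g_bounds[OF Us[of n]] g_bounds[OF U] U_range[OF K_order_interval[OF Us[of n]]]
        U_range[OF K_order_interval[OF U]] AE_space
    proof eventually_elim
      case (elim x)
      then have "0 \<le> b x 0" using b closure_subset \<delta>0 by (force simp: admissible_b_def)
      then have "0 \<le> lam0 * b x 0" using lam0 by simp
      then have "\<bar>g x (Us n x) - g x (U x)\<bar> \<le> lam0 * b x \<delta>0" using elim(1,2) by linarith
      moreover have "\<bar>?\<phi> n x\<bar> \<le> \<delta>0" using elim(3,4) by auto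
      ultimately show ?case unfolding real_norm_def abs_mult by (intro mult_mono) auto
    qed
    show "integrable M (\<lambda>x. lam0 * b x \<delta>0 * \<delta>0)" using b_\<delta>0_integrable by simp
  qed (use h in auto)
  have z_nonneg: "AE x in M. 0 \<le> ?z n x" for n
    using B_strict_mono
  proof eventually_elim
    case (elim x)
    then show ?case
      using strict_mono_less_eq[OF elim]
      by (cases "K (Us n) x \<le> K U x") (auto intro: mult_nonneg_nonneg mult_nonpos_nonpos)
  qed
  have bound: "lam0 * (\<integral>x. \<bar>?z n x\<bar> \<partial>M) \<le> (\<integral>x. ?h n x \<partial>M)" for n
  proof -
    have "AE x in M. 0 \<le> flux (K (Us n)) x \<bullet> grad (?\<phi> n) x - flux (K U) x \<bullet> grad (?\<phi> n) x"
      using flux_diff_nonneg[of "K (Us n)" "K U"] W(2)[of n] by eventually_elim (simp add: inner_diff_left)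
    then have "0 \<le> (\<integral>x. flux (K (Us n)) x \<bullet> grad (?\<phi> n) x - flux (K U) x \<bullet> grad (?\<phi> n) x \<partial>M)"
      by (rule integral_nonneg_AE)
    then have "(\<integral>x. flux (K U) x \<bullet> grad (?\<phi> n) x \<partial>M) \<le> (\<integral>x. flux (K (Us n)) x \<bullet> grad (?\<phi> n) x \<partial>M)"
      using E(1) E'(1) by simp
    then have "lam0 * ((\<integral>x. B x (K (Us n) x) * ?\<phi> n x \<partial>M) - (\<integral>x. B x (K U x) * ?\<phi> n x \<partial>M))
        \<le> (\<integral>x. g x (Us n x) * ?\<phi> n x \<partial>M) - (\<integral>x. g x (U x) * ?\<phi> n x \<partial>M)"
      using E(4)[of n n] E'(4)[of n] by (simp add: right_diff_distrib)
    moreover have "(\<integral>x. ?z n x \<partial>M) = (\<integral>x. B x (K (Us n) x) * ?\<phi> n x \<partial>M) - (\<integral>x. B x (K U x) * ?\<phi> n x \<partial>M)"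
      unfolding left_diff_distrib[of _ _ "?\<phi> n _"] by (rule Bochner_Integration.integral_diff[OF E(2) E'(2)])
    moreover have "(\<integral>x. ?h n x \<partial>M) = (\<integral>x. g x (Us n x) * ?\<phi> n x \<partial>M) - (\<integral>x. g x (U x) * ?\<phi> n x \<partial>M)"
      unfolding left_diff_distrib[of _ _ "?\<phi> n _"] by (rule Bochner_Integration.integral_diff[OF E(3) E'(3)])
    moreover have "(\<integral>x. \<bar>?z n x\<bar> \<partial>M) = (\<integral>x. ?z n x \<partial>M)"
    proof (rule integral_cong_AE)
      show "AE x in M. \<bar>?z n x\<bar> = ?z n x" using z_nonneg[of n] by eventually_elim simp
    qed (use z in auto)
    ultimately show ?thesis by simp
  qed
  show "(\<lambda>n. \<integral>x. \<bar>?z n x\<bar> \<partial>M) \<longlonglongrightarrow> 0"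
  proof (rule tendsto_sandwich[of "\<lambda>_. 0" _ _ "\<lambda>n. (\<integral>x. ?h n x \<partial>M) / lam0"])
    show "\<forall>\<^sub>F n in sequentially. (\<integral>x. \<bar>?z n x\<bar> \<partial>M) \<le> (\<integral>x. ?h n x \<partial>M) / lam0"
      using bound lam0 by (simp add: pos_le_divide_eq mult.commute)
    show "(\<lambda>n. (\<integral>x. ?h n x \<partial>M) / lam0) \<longlonglongrightarrow> 0"
      using tendsto_divide[OF h_lim tendsto_const[of lam0]] lam0 by simp
  qed simp_all
qed

text \<open>It suffices to find, in each subsequence, a further one with the desired limit. Two
  extractions are needed: one makes the data converge almost everywhere, the other does the same for
  the monotone product.\<close>

lemma K_continuous:
  assumes Us: "\<And>n::nat. Us n \<in> \<U>" and U: "U \<in> \<U>"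
    and lim: "(\<lambda>n. L2_norm_on \<Omega> (\<lambda>x. Us n x - U x)) \<longlonglongrightarrow> 0"
  shows "(\<lambda>n. L2_norm_on \<Omega> (\<lambda>x. K (Us n) x - K U x)) \<longlonglongrightarrow> 0"
proof (rule tendsto_0_by_subsequences)
  fix \<sigma> :: "nat \<Rightarrow> nat" assume \<sigma>: "strict_mono \<sigma>"
  \<comment> \<open>The norm is squared so that L^2 convergence becomes L^1 convergence of the
    squares, which has an almost everywhere convergent subsequence.\<close>
  have "(\<lambda>n. (L2_norm_on \<Omega> (\<lambda>x. Us n x - U x))\<^sup>2) \<longlonglongrightarrow> 0\<^sup>2" by (intro tendsto_power lim)
  then have "(\<lambda>n. \<integral>x. (Us n x - U x)\<^sup>2 \<partial>M) \<longlonglongrightarrow> 0" by (simp add: L2_norm_on_def)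
  from LIMSEQ_subseq_LIMSEQ[OF this \<sigma>]
  have "(\<lambda>n. \<integral>x. norm ((Us (\<sigma> n) x - U x)\<^sup>2) \<partial>M) \<longlonglongrightarrow> 0" by (simp add: o_def)
  from tendsto_L1_AE_subseq[OF square_integrable(3)[OF Us U] this]
  obtain \<rho>1 :: "nat \<Rightarrow> nat" where \<rho>1: "strict_mono \<rho>1"
    and AE1: "AE x in M. (\<lambda>n. (Us (\<sigma> (\<rho>1 n)) x - U x)\<^sup>2) \<longlonglongrightarrow> 0" by blast
  have lim1: "AE x in M. (\<lambda>n. Us (\<sigma> (\<rho>1 n)) x) \<longlonglongrightarrow> U x"
    using AE1
  proof eventually_elim
    case (elim x)
    from tendsto_real_sqrt[OF this] have "(\<lambda>n. \<bar>Us (\<sigma> (\<rho>1 n)) x - U x\<bar>) \<longlonglongrightarrow> 0" by simp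
    then show ?case by (rule LIM_zero_cancel[OF tendsto_rabs_zero_cancel])
  qed
  note prod = K_monotone_product_tendsto[of "\<lambda>n. Us (\<sigma> (\<rho>1 n))", OF Us U lim1]
  have "(\<lambda>n. \<integral>x. norm ((B x (K (Us (\<sigma> (\<rho>1 n))) x) - B x (K U x)) * (K (Us (\<sigma> (\<rho>1 n))) x - K U x)) \<partial>M) \<longlonglongrightarrow> 0"
    using prod(2) by simp
  from tendsto_L1_AE_subseq[OF prod(1) this]
  obtain \<rho>2 :: "nat \<Rightarrow> nat" where \<rho>2: "strict_mono \<rho>2"
    and AE2: "AE x in M. (\<lambda>n. (B x (K (Us (\<sigma> (\<rho>1 (\<rho>2 n)))) x) - B x (K U x))
      * (K (Us (\<sigma> (\<rho>1 (\<rho>2 n)))) x - K U x)) \<longlonglongrightarrow> 0" by blast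
  \<comment> \<open>Strict monotonicity of \<open>b_bar\<close> at each point turns convergence of
    the product into convergence of the solutions; the order interval supplies the constant bound,
    integrable because \<Omega> has finite measure.\<close>
  have "(\<lambda>n. \<integral>x. (K (Us (\<sigma> (\<rho>1 (\<rho>2 n)))) x - K U x)\<^sup>2 \<partial>M) \<longlonglongrightarrow> (\<integral>x. 0 \<partial>M)"
  proof (rule integral_dominated_convergence[where w = "\<lambda>_. \<delta>0\<^sup>2"])
    note sq = square_integrable[OF K_order_interval[OF Us] K_order_interval[OF U]]
    show "AE x in M. (\<lambda>n. (K (Us (\<sigma> (\<rho>1 (\<rho>2 n)))) x - K U x)\<^sup>2) \<longlonglongrightarrow> 0"
      using AE2 B_strict_mono
    proof eventually_elim
      case (elim x)
      from tendsto_from_monotone_product[OF elim(2,1)]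
      have "(\<lambda>n. K (Us (\<sigma> (\<rho>1 (\<rho>2 n)))) x - K U x) \<longlonglongrightarrow> 0" by (rule LIM_zero)
      from tendsto_power[OF this, of 2] show ?case by simp
    qed
    show "(\<lambda>x. (K (Us (\<sigma> (\<rho>1 (\<rho>2 n)))) x - K U x)\<^sup>2) \<in> borel_measurable M" for n by (rule sq(2))
    show "AE x in M. norm ((K (Us (\<sigma> (\<rho>1 (\<rho>2 n)))) x - K U x)\<^sup>2) \<le> \<delta>0\<^sup>2" for n
      using sq(1) by simp
    show "integrable M (\<lambda>_. \<delta>0\<^sup>2)" by (rule integrable_bounded[where B = "\<delta>0\<^sup>2"]) auto
  qed simp
  from tendsto_real_sqrt[OF this]
  have "(\<lambda>n. L2_norm_on \<Omega> (\<lambda>x. K (Us (\<sigma> (\<rho>1 (\<rho>2 n)))) x - K U x)) \<longlonglongrightarrow> 0"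
    by (simp add: L2_norm_on_def)
  moreover have "strict_mono (\<lambda>n. \<rho>1 (\<rho>2 n))" using strict_mono_o[OF \<rho>1 \<rho>2] by (simp add: o_def)
  ultimately show "\<exists>\<rho> :: nat \<Rightarrow> nat. strict_mono \<rho> \<and>
      (\<lambda>n. L2_norm_on \<Omega> (\<lambda>x. K (Us (\<sigma> (\<rho> n))) x - K U x)) \<longlonglongrightarrow> 0"
    by (intro exI[of _ "\<lambda>n. \<rho>1 (\<rho>2 n)"]) simp
qed

end

theorem proposition8p2:
  fixes \<Omega> :: "'a::euclidean_space set"
    and p :: "'a \<Rightarrow> real"
    and \<Psi> b f :: "'a \<Rightarrow> real \<Rightarrow> real"
    and \<delta>0 lam0 :: real
    and K :: "('a \<Rightarrow> real) \<Rightarrow> 'a \<Rightarrow> real"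
  assumes "2 \<le> DIM('a)"
    and "lipschitz_domain \<Omega>"
    and "admissible_exponent \<Omega> p"
    and "admissible_Psi \<Omega> p \<Psi>"
    and "0 < \<delta>0"
    and "0 < lam0"
    and "admissible_b \<Omega> \<delta>0 b"
    and "admissible_f \<Omega> \<delta>0 lam0 b f"
    and "solution_operator \<Omega> p \<Psi> \<delta>0 lam0 b f K"
  shows "(\<forall>U\<in>order_interval \<Omega> \<delta>0. K U \<in> W1var \<Omega> p \<inter> order_interval \<Omega> \<delta>0) \<and>
         (\<forall>U1\<in>order_interval \<Omega> \<delta>0. \<forall>U2\<in>order_interval \<Omega> \<delta>0.
            (AE x in lebesgue_on \<Omega>. U1 x \<le> U2 x) \<and> \<not> (AE x in lebesgue_on \<Omega>. U1 x = U2 x) \<longrightarrow>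
            (AE x in lebesgue_on \<Omega>. K U1 x \<le> K U2 x) \<and>
            \<not> (AE x in lebesgue_on \<Omega>. K U1 x = K U2 x)) \<and>
         (\<forall>\<epsilon>\<in>{0..\<delta>0}. (AE x in lebesgue_on \<Omega>. 0 \<le> f x \<epsilon>) \<longrightarrow>
            (AE x in lebesgue_on \<Omega>. \<epsilon> \<le> K (\<lambda>_. \<epsilon>) x)) \<and>
         (\<forall>\<delta>\<in>{0..\<delta>0}. (AE x in lebesgue_on \<Omega>. f x \<delta> \<le> 0) \<longrightarrow>
            (AE x in lebesgue_on \<Omega>. K (\<lambda>_. \<delta>) x \<le> \<delta>)) \<and>
         (\<forall>Us U. (\<forall>n::nat. Us n \<in> order_interval \<Omega> \<delta>0) \<and> U \<in> order_interval \<Omega> \<delta>0 \<and>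
            (\<lambda>n. L2_norm_on \<Omega> (\<lambda>x. Us n x - U x)) \<longlonglongrightarrow> 0 \<longrightarrow>
            (\<lambda>n. L2_norm_on \<Omega> (\<lambda>x. K (Us n) x - K U x)) \<longlonglongrightarrow> 0)"
proof -
  have "open \<Omega>" "bounded \<Omega>" using assms(2) by (auto simp: lipschitz_domain_def)
  from variable_exponent_admissible[OF this assms(3)] obtain P where "variable_exponent \<Omega> p P" .
  then interpret variable_exponent \<Omega> p P .
  interpret solution_operator_setting \<Omega> p P \<Psi> b f \<delta>0 lam0 K
    by unfold_locales (fact assms)+
  show ?thesis
  proof (intro conjI ballI allI impI)
    fix U assume "U \<in> order_interval \<Omega> \<delta>0"
    then show "K U \<in> W1var \<Omega> p \<inter> order_interval \<Omega> \<delta>0" using K_W1var K_order_interval by blast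
  next
    fix U1 U2 assume U: "U1 \<in> order_interval \<Omega> \<delta>0" "U2 \<in> order_interval \<Omega> \<delta>0"
      and le: "(AE x in lebesgue_on \<Omega>. U1 x \<le> U2 x) \<and> \<not> (AE x in lebesgue_on \<Omega>. U1 x = U2 x)"
    show "AE x in lebesgue_on \<Omega>. K U1 x \<le> K U2 x" using K_mono[OF U] le by blast
    show "\<not> (AE x in lebesgue_on \<Omega>. K U1 x = K U2 x)" using K_strict[OF U] le by blast
  next
    fix \<epsilon> assume \<epsilon>: "\<epsilon> \<in> {0..\<delta>0}" and "AE x in lebesgue_on \<Omega>. 0 \<le> f x \<epsilon>"
    \<comment> \<open>For constant data the terms with \<open>b\<close> on both sides are equal, so
      the sign of \<open>f\<close> is exactly the sub- or supersolution condition for that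
      constant.\<close>
    then have "AE x in lebesgue_on \<Omega>. lam0 * b x \<epsilon> \<le> g x \<epsilon>" by (simp add: g_def)
    then show "AE x in lebesgue_on \<Omega>. \<epsilon> \<le> K (\<lambda>_. \<epsilon>) x"
      by (rule K_ge_const[OF const_order_interval[OF \<epsilon>] \<epsilon>])
  next
    fix \<delta> assume \<delta>: "\<delta> \<in> {0..\<delta>0}" and "AE x in lebesgue_on \<Omega>. f x \<delta> \<le> 0"
    then have "AE x in lebesgue_on \<Omega>. g x \<delta> \<le> lam0 * b x \<delta>" by (simp add: g_def)
    then show "AE x in lebesgue_on \<Omega>. K (\<lambda>_. \<delta>) x \<le> \<delta>"
      by (rule K_le_const[OF const_order_interval[OF \<delta>] \<delta>])
  next
    fix Us :: "nat \<Rightarrow> 'a \<Rightarrow> real" and U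
    assume "(\<forall>n. Us n \<in> order_interval \<Omega> \<delta>0) \<and> U \<in> order_interval \<Omega> \<delta>0 \<and>
      (\<lambda>n. L2_norm_on \<Omega> (\<lambda>x. Us n x - U x)) \<longlonglongrightarrow> 0"
    then show "(\<lambda>n. L2_norm_on \<Omega> (\<lambda>x. K (Us n) x - K U x)) \<longlonglongrightarrow> 0"
      using K_continuous by blast
  qed
qed

end
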